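(* Let $(\Omega,\Sigma,p)$ be a probability measure space, let $k,n\in\mathbb{N}$ and let $E\subseteq\mathbb{R}^k$ be an $m$-dimensional submanifold of $\mathbb{R}^k$. Let $X:\Omega\to E$ be a random variable having a probability density function $f_X$ with respect to the Hausdorff measure $\mathcal{H}^m_{|E}$ on $E$. Let $\phi:\mathbb{R}^k\to\mathbb{R}^n$ be a $C^1$-map whose tangential Jacobian $J^E\phi(x)$ has maximum rank at any point $x\in E$. Then the following hold. (i) If $m\le n$, then the probability measure $p_Y$ induced by the statistic $Y:=\phi\circ X$ is absolutely continuous with respect to the Hausdorff measure $\mathcal{H}^m_{|\phi(E)}$ on $\phi(E)$ and its density function $f_Y$ satisfies $$f_Y(y)=\int_{E\cap\phi^{-1}(y)}f_X(x)\frac{1}{J_m^E\phi(x)}\,d\mathcal{H}^0(x)=\sum_{x\in E,\ \phi(x)=y}f_X(x)\frac{1}{J_m^E\phi(x)}\qquad\text{for }\mathcal{H}^m\text{-a.e. } y\in\phi(E).$$ (ii) If $m\ge n$, then the statistic $Y:=\phi\circ X$ is an absolutely continuous random variable (i.e. $p_Y\ll\mathcal{L}^n$) and its probability density function $f_Y$ satisfies $$f_Y(y)=\int_{E\cap\phi^{-1}(y)}f_X(x)\frac{1}{J_n^E\phi(x)}\,d\mathcal{H}^{m-n}(x)\qquad\text{for a.e. } y\in\phi(E).$$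
   Context: For a random variable $X$, $p_X(A)=p(X^{-1}(A))$ is the induced measure on Borel sets; $X$ has density $f_X$ with respect to a measure $\mu$ if $f_X\ge0$ is measurable and $p_X(A)=\int_A f_X\,d\mu$ for all Borel $A$. A random variable $Y:\Omega\to\mathbb{R}^n$ is absolutely continuous if $p_Y\ll\mathcal{L}^n$ (Lebesgue measure), and "a.e." without further specification refers to Lebesgue measure. $\mathcal{H}^s$ is the $s$-dimensional Hausdorff measure: $\mathcal{H}^s(E)=\lim_{\epsilon\to0^+}\frac{\pi^{s/2}}{\Gamma(1+s/2)}\inf\sum_i r_i^s$, the infimum being over countable coverings of $E$ by balls $B(x_i,r_i)$ with $r_i\le\epsilon$. Thus $\mathcal{H}^0$ is the counting measure and $\mathcal{H}^n=\mathcal{L}^n$ on $\mathbb{R}^n$. Submanifolds are (at least) $C^1$ embedded submanifolds of $\mathbb{R}^k$. The tangential Jacobian $J^E\phi(x)$ of $\phi$ with respect to $E$ at $x\in E$ is the (matrix of the) restriction of the differential $J\phi(x)$ to the tangent space $T_xE$, a linear map $T_xE\to\mathbb{R}^n$; maximum rank means rank $\min\{m,n\}$. For $j\in\mathbb{N}$, the $j$-dimensional tangential Jacobian is $$J_j^E\phi(x)=\sup\left\{\frac{\mathcal{H}^j(J^E\phi(x)(P))}{\mathcal{H}^j(P)} : P\text{ a } j\text{-dimensional parallelepiped of } T_xE\right\}.$$ *)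

theory Defs
  imports "HOL-Probability.Probability"
begin

(* A countable covering is a countable set C of pairs (centre, radius).  Radii are positive, so that
   r powr 0 = 1 and the 0-dimensional measure counts points; C may be finite or empty.
   unit_ball_vol s = pi powr (s / 2) / Gamma (s / 2 + 1). *)
definition hausdorff_outer :: "real \<Rightarrow> 'a::metric_space set \<Rightarrow> ennreal" where
  "hausdorff_outer s A = Lim (at_right 0) (\<lambda>\<epsilon>::real. ennreal (unit_ball_vol s) *
     (INF C \<in> {C :: ('a \<times> real) set. countable C \<and> (\<forall>(x, r) \<in> C. 0 < r \<and> r \<le> \<epsilon>) \<and>
                 A \<subseteq> (\<Union>(x, r) \<in> C. ball x r)}.
        \<Sum>\<^sub>\<infinity>(x, r) \<in> C. ennreal (r powr s)))"

definition hausdorff_measure :: "real \<Rightarrow> 'a::metric_space measure" where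
  "hausdorff_measure s = measure_of UNIV (sets borel) (hausdorff_outer s)"

abbreviation hausdorff_on :: "real \<Rightarrow> 'a::metric_space set \<Rightarrow> 'a measure" where
  "hausdorff_on s A \<equiv> restrict_space (hausdorff_measure s) A"

definition C1_map_on :: "'a::euclidean_space set \<Rightarrow> ('a \<Rightarrow> 'b::euclidean_space) \<Rightarrow> bool" where
  "C1_map_on U f \<longleftrightarrow> open U \<and>
     (\<exists>f' :: 'a \<Rightarrow> 'a \<Rightarrow>\<^sub>L 'b. continuous_on U f' \<and>
        (\<forall>x\<in>U. (f has_derivative blinfun_apply (f' x)) (at x)))"

(* Local C1 straightening of E onto an m-dimensional linear subspace S, in the role of
   R^m x {0} in R^k. *)
definition C1_submanifold :: "nat \<Rightarrow> 'a::euclidean_space set \<Rightarrow> bool" where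
  "C1_submanifold m E \<longleftrightarrow>
     (\<forall>p\<in>E. \<exists>U (V :: 'a set) \<Phi> \<Psi> S. p \<in> U \<and> C1_map_on U \<Phi> \<and> C1_map_on V \<Psi> \<and> homeomorphism U V \<Phi> \<Psi> \<and>
        subspace S \<and> dim S = m \<and> \<Phi> ` (U \<inter> E) = V \<inter> S)"

definition tangent_space :: "'a::euclidean_space set \<Rightarrow> 'a \<Rightarrow> 'a set" where
  "tangent_space E x = {v. \<exists>(\<gamma> :: real \<Rightarrow> 'a) \<epsilon>. 0 < \<epsilon> \<and> \<gamma> C1_differentiable_on {-\<epsilon><..<\<epsilon>} \<and>
     \<gamma> ` {-\<epsilon><..<\<epsilon>} \<subseteq> E \<and> \<gamma> 0 = x \<and> (\<gamma> has_vector_derivative v) (at 0)}"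

definition tangential_jacobian ::
    "'a::euclidean_space set \<Rightarrow> ('a \<Rightarrow> 'b::euclidean_space) \<Rightarrow> 'a \<Rightarrow> 'a \<Rightarrow> 'b" where
  "tangential_jacobian E \<phi> x = restrict (frechet_derivative \<phi> (at x)) (tangent_space E x)"

(* The j-dimensional parallelepipeds contained in the linear subspace T: corner a, edges B. *)
definition parallelepipeds :: "nat \<Rightarrow> 'a::euclidean_space set \<Rightarrow> 'a set set" where
  "parallelepipeds j T =
     {{a + (\<Sum>b\<in>B. c b *\<^sub>R b) | c. \<forall>b\<in>B. 0 \<le> c b \<and> c b \<le> 1} | a B.
        a \<in> T \<and> B \<subseteq> T \<and> independent B \<and> card B = j}"

definition tangential_jacobian_dim ::
    "nat \<Rightarrow> 'a::euclidean_space set \<Rightarrow> ('a \<Rightarrow> 'b::euclidean_space) \<Rightarrow> 'a \<Rightarrow> ennreal" where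
  "tangential_jacobian_dim j E \<phi> x =
     (SUP P \<in> parallelepipeds j (tangent_space E x).
        emeasure (hausdorff_measure (real j)) (tangential_jacobian E \<phi> x ` P) /
        emeasure (hausdorff_measure (real j)) P)"

(* distributed includes measurability of X into N, of the density, and distr M N X = density N f. *)
definition has_density :: "'w measure \<Rightarrow> 'a measure \<Rightarrow> ('w \<Rightarrow> 'a) \<Rightarrow> ('a \<Rightarrow> real) \<Rightarrow> bool" where
  "has_density M N X f \<longleftrightarrow>
     (\<forall>x\<in>space N. 0 \<le> f x) \<and> distributed M N X (\<lambda>x. ennreal (f x))"

end

theory Submission
  imports Defs
begin

text \<open>
  Both parts of the theorem are one coarea formula.  Let \<open>r = min m n\<close> be the rank of the tangential
  Jacobian, and let \<open>\<H> d\<close> denote \<open>d\<close>-dimensional Hausdorff measure.  For every Borel function \<open>g \<ge> 0\<close>,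
  the integral of \<open>g \<cdot> J\<^sub>r\<close> over \<open>E\<close> against \<open>\<H> m\<close> equals the integral over \<open>y\<close>, against \<open>\<H> r\<close>, of
  the integral of \<open>g\<close> over the fibre \<open>E \<inter> \<phi> -` {y}\<close> against \<open>\<H> (m - r)\<close>
  (\<open>submanifold_coarea\<close>).  Since the rank is maximal, \<open>J\<^sub>r\<close> is positive and finite on \<open>E\<close>, so \<open>g = fX / J\<^sub>r\<close>, cut
  down to \<open>\<phi> -` B\<close>, may be inserted: the left side becomes the probability of \<open>\<phi> \<circ> X \<in> B\<close> and
  the right side the integral over \<open>B\<close> of the claimed density (\<open>statistic_density\<close>).  For \<open>r = m\<close> the
  fibres are countable and \<open>\<H> 0\<close> counts points, so that the fibre integral is a sum; for
  \<open>r = n\<close> the measure \<open>\<H> n\<close> is Lebesgue measure.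

  For the proof of the coarea formula everything is compared with flat models, by maps that are
  nearly the identity and whose effect on Hausdorff measure can be controlled directly from its definition.

  Flat case.  A \<open>\<sigma>\<close>-finite measure on a linear subspace that is invariant under its translations is unique up
  to a factor (\<open>translation_invariant_measures_proportional\<close>).  Hence \<open>\<H> d\<close> on a
  \<open>d\<close>-dimensional subspace is a multiple of Lebesgue measure, with factor 1 because the balls inscribed in a
  fine grid fill a fixed fraction of a cube (\<open>hausdorff_eq_leb_span\<close>), and an
  injective linear map multiplies \<open>\<H> d\<close> by a constant (\<open>hausdorff_linear_image\<close>).  The supremum
  that defines \<open>J\<^sub>r\<close> is this constant for the restriction of the derivative to the orthogonal
  complement of its kernel (\<open>tangential_jacobian_dim_eq\<close>), and Fubini's theorem for orthogonal
  subspaces gives the linear coarea formula (\<open>hausdorff_linear_coarea\<close>).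

  Nearly flat case.  If \<open>h\<close> differs from the identity by a \<open>\<delta>\<close>-Lipschitz map on a relatively open
  part of a subspace, then \<open>h\<close> changes every \<open>\<H> d\<close> by a factor close to 1
  (\<open>hausdorff_outer_near_id\<close>).  Near each of its points, \<open>E\<close> is the image under such a map of an open part of its tangent
  space (\<open>submanifold_tangent_chart\<close>).  If \<open>m \<le> n\<close>, then \<open>\<phi>\<close> becomes in this chart nearly
  linear and injective (\<open>immersion_local_area\<close>); if \<open>n \<le> m\<close>, the chart can be changed so that
  \<open>\<phi>\<close> becomes exactly affine, and its fibres become parallel flat pieces
  (\<open>submersion_local_coarea\<close>).  Hence the coarea formula holds locally up to a factor \<open>c\<close>, for every
  \<open>c > 1\<close>.  Patching countably many such pieces and letting \<open>c\<close> tend to 1 gives equality, and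
  with it the measurability of the fibre integrals (\<open>coarea_local_to_global\<close>).
\<close>

section \<open>Spherical Hausdorff measure is a Borel measure\<close>

lemma infsum_ennreal_eq_nn_integral:
  fixes f :: "'a \<Rightarrow> ennreal"
  assumes "countable C"
  shows "infsum f C = (\<integral>\<^sup>+x. f x * indicator C x \<partial>count_space UNIV)"
proof -
  have fin: "sum f F = (\<integral>\<^sup>+x. f x * indicator F x \<partial>count_space UNIV)" if "finite F" for F
    using that
    by (simp add: nn_integral_count_space_indicator[symmetric] nn_integral_count_space_finite)
  have "infsum f C = (SUP F\<in>{F. finite F \<and> F \<subseteq> C}. sum f F)"
    by (intro nonneg_infsum_complete) auto
  also have "\<dots> = (\<integral>\<^sup>+x. f x * indicator C x \<partial>count_space UNIV)"
  proof (rule antisym)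
    show "(SUP F\<in>{F. finite F \<and> F \<subseteq> C}. sum f F) \<le> (\<integral>\<^sup>+x. f x * indicator C x \<partial>count_space UNIV)"
      by (rule SUP_least) (auto simp: fin intro!: nn_integral_mono split: split_indicator)
    show "(\<integral>\<^sup>+x. f x * indicator C x \<partial>count_space UNIV) \<le> (SUP F\<in>{F. finite F \<and> F \<subseteq> C}. sum f F)"
    proof (cases "C = {}")
      case False
      define A where "A n = from_nat_into C ` {..<n}" for n :: nat
      have A: "incseq A" "\<And>n. finite (A n)" "\<And>n. A n \<subseteq> C" "(\<Union>n. A n) = C"
      proof -
        have R: "range (from_nat_into C) = C" using False assms by (rule range_from_nat_into)
        show "incseq A" by (auto simp: A_def incseq_def)
        show "finite (A n)" for n by (simp add: A_def)
        show "A n \<subseteq> C" for n using R by (auto simp: A_def)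
        have "(\<Union>n. A n) = range (from_nat_into C)" by (auto simp: A_def)
        then show "(\<Union>n. A n) = C" using R by simp
      qed
      have "(\<integral>\<^sup>+x. f x * indicator C x \<partial>count_space UNIV) = emeasure (density (count_space UNIV) f) (\<Union>n. A n)"
        using A(4) by (simp add: emeasure_density)
      also have "\<dots> = (SUP n. emeasure (density (count_space UNIV) f) (A n))"
        by (rule SUP_emeasure_incseq[symmetric]) (use A in auto)
      also have "\<dots> = (SUP n. sum f (A n))"
        using A by (simp add: emeasure_density fin)
      also have "\<dots> \<le> (SUP F\<in>{F. finite F \<and> F \<subseteq> C}. sum f F)"
        by (rule SUP_least, rule SUP_upper) (use A in auto)
      finally show ?thesis .
    qed simp
  qed
  finally show ?thesis .
qed

lemma infsum_ennreal_image_le: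
  fixes f :: "'b \<Rightarrow> ennreal"
  shows "infsum f (h ` C) \<le> infsum (\<lambda>x. f (h x)) C"
proof -
  have "sum f F \<le> infsum (\<lambda>x. f (h x)) C" if F: "finite F" "F \<subseteq> h ` C" for F
  proof -
    obtain G where G: "G \<subseteq> C" "F = h ` G" "inj_on h G"
      using F by (auto simp: subset_image_inj)
    then have "sum f F = sum (\<lambda>x. f (h x)) G" by (simp add: sum.reindex)
    also have "\<dots> \<le> infsum (\<lambda>x. f (h x)) C"
      using G F by (subst nonneg_infsum_complete) (auto intro!: SUP_upper simp: finite_image_iff)
    finally show ?thesis .
  qed
  then show ?thesis
    by (subst nonneg_infsum_complete) (auto intro!: SUP_least)
qed

definition ball_covers :: "real \<Rightarrow> 'a::metric_space set \<Rightarrow> ('a \<times> real) set set" where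
  "ball_covers \<epsilon> A = {C. countable C \<and> (\<forall>(x, r) \<in> C. 0 < r \<and> r \<le> \<epsilon>) \<and> A \<subseteq> (\<Union>(x, r) \<in> C. ball x r)}"

definition cover_sum :: "real \<Rightarrow> ('a \<times> real) set \<Rightarrow> ennreal" where
  "cover_sum s C = (\<Sum>\<^sub>\<infinity>(x, r) \<in> C. ennreal (r powr s))"

text \<open>
  The size-\<open>\<epsilon>\<close> approximation of Hausdorff measure, without the factor \<open>unit_ball_vol s\<close>.
\<close>

definition hausdorff_pre :: "real \<Rightarrow> real \<Rightarrow> 'a::metric_space set \<Rightarrow> ennreal" where
  "hausdorff_pre s \<epsilon> A = (INF C \<in> ball_covers \<epsilon> A. cover_sum s C)"

lemma cover_sum_eq:
  "countable C \<Longrightarrow> cover_sum s C = emeasure (density (count_space UNIV) (\<lambda>(x, r). ennreal (r powr s))) C"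
  by (simp add: cover_sum_def infsum_ennreal_eq_nn_integral emeasure_density)

lemma hausdorff_pre_antimono: "\<epsilon> \<le> \<delta> \<Longrightarrow> hausdorff_pre s \<delta> A \<le> hausdorff_pre s \<epsilon> A"
  unfolding hausdorff_pre_def
  by (rule INF_superset_mono) (fastforce simp: ball_covers_def)+

lemma hausdorff_pre_mono: "A \<subseteq> B \<Longrightarrow> hausdorff_pre s \<epsilon> A \<le> hausdorff_pre s \<epsilon> B"
  unfolding hausdorff_pre_def
  by (rule INF_superset_mono) (auto simp: ball_covers_def)

lemma hausdorff_pre_tendsto:
  "((\<lambda>\<epsilon>. hausdorff_pre s \<epsilon> A) \<longlongrightarrow> (SUP \<epsilon>\<in>{0<..}. hausdorff_pre s \<epsilon> A)) (at_right 0)"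
proof (rule order_tendstoI)
  fix a assume "a < (SUP \<epsilon>\<in>{0<..}. hausdorff_pre s \<epsilon> A)"
  then obtain \<delta> where "\<delta> > 0" "a < hausdorff_pre s \<delta> A" by (auto simp: less_SUP_iff)
  then show "\<forall>\<^sub>F \<epsilon> in at_right 0. a < hausdorff_pre s \<epsilon> A"
    unfolding eventually_at_right_field
    by (intro exI[of _ \<delta>]) (meson hausdorff_pre_antimono less_le_trans less_imp_le)
next
  fix a assume a: "(SUP \<epsilon>\<in>{0<..}. hausdorff_pre s \<epsilon> A) < a"
  have "hausdorff_pre s \<epsilon> A < a" if "\<epsilon> > 0" for \<epsilon>
    using a that by (meson SUP_upper greaterThan_iff le_less_trans)
  then show "\<forall>\<^sub>F \<epsilon> in at_right 0. hausdorff_pre s \<epsilon> A < a"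
    by (auto simp: eventually_at_right_field intro!: exI[of _ 1])
qed

abbreviation hausdorff_outer_nat :: "nat \<Rightarrow> 'a::metric_space set \<Rightarrow> ennreal" ("\<H>") where
  "\<H> d \<equiv> hausdorff_outer (real d)"

lemma hausdorff_outer_tendsto:
  "((\<lambda>\<epsilon>. ennreal (unit_ball_vol s) * hausdorff_pre s \<epsilon> A) \<longlongrightarrow>
     ennreal (unit_ball_vol s) * (SUP \<epsilon>\<in>{0<..}. hausdorff_pre s \<epsilon> A)) (at_right 0)"
  by (rule ennreal_tendsto_cmult[OF _ hausdorff_pre_tendsto]) simp

text \<open>
  The approximations increase as \<open>\<epsilon>\<close> decreases, so the limit is a supremum.
\<close>

lemma hausdorff_outer_eq:
  "hausdorff_outer s A = ennreal (unit_ball_vol s) * (SUP \<epsilon>\<in>{0<..}. hausdorff_pre s \<epsilon> A)"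
proof -
  have "hausdorff_outer s A = Lim (at_right 0) (\<lambda>\<epsilon>. ennreal (unit_ball_vol s) * hausdorff_pre s \<epsilon> A)"
    unfolding hausdorff_outer_def hausdorff_pre_def ball_covers_def cover_sum_def ..
  also have "\<dots> = ennreal (unit_ball_vol s) * (SUP \<epsilon>\<in>{0<..}. hausdorff_pre s \<epsilon> A)"
    by (rule tendsto_Lim[OF _ hausdorff_outer_tendsto]) simp
  finally show ?thesis .
qed

lemma hausdorff_outer_SUP:
  "hausdorff_outer s A = (SUP \<epsilon>\<in>{0<..}. ennreal (unit_ball_vol s) * hausdorff_pre s \<epsilon> A)"
  by (simp add: hausdorff_outer_eq SUP_mult_left_ennreal)

lemma hausdorff_outer_leI:
  assumes "\<And>\<epsilon>. \<epsilon> > 0 \<Longrightarrow> ennreal (unit_ball_vol s) * hausdorff_pre s \<epsilon> A \<le> b"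
  shows "hausdorff_outer s A \<le> b"
  unfolding hausdorff_outer_SUP using assms by (auto intro: SUP_least)

lemma hausdorff_pre_le_outer:
  "\<epsilon> > 0 \<Longrightarrow> ennreal (unit_ball_vol s) * hausdorff_pre s \<epsilon> A \<le> hausdorff_outer s A"
  unfolding hausdorff_outer_SUP by (auto intro: SUP_upper)

lemma hausdorff_outer_mono: "A \<subseteq> B \<Longrightarrow> hausdorff_outer s A \<le> hausdorff_outer s B"
  unfolding hausdorff_outer_SUP
  by (intro SUP_mono) (auto intro!: mult_left_mono hausdorff_pre_mono bexI)

lemma hausdorff_pre_empty [simp]: "hausdorff_pre s \<epsilon> ({} :: 'a::metric_space set) = 0"
proof -
  have "hausdorff_pre s \<epsilon> ({} :: 'a set) \<le> cover_sum s ({} :: ('a \<times> real) set)"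
    unfolding hausdorff_pre_def by (rule INF_lower) (auto simp: ball_covers_def)
  then show ?thesis by (simp add: cover_sum_def)
qed

lemma hausdorff_outer_empty [simp]: "hausdorff_outer s {} = 0"
  by (simp add: hausdorff_outer_SUP)

lemma hausdorff_pre_countably_subadditive:
  "hausdorff_pre s \<epsilon> (\<Union>i::nat. A i) \<le> (\<Sum>i. hausdorff_pre s \<epsilon> (A i))"
proof (rule ennreal_le_epsilon)
  fix e :: real assume fin: "(\<Sum>i. hausdorff_pre s \<epsilon> (A i)) < top" and e: "0 < e"
  have "\<exists>C\<in>ball_covers \<epsilon> (A i). cover_sum s C \<le> hausdorff_pre s \<epsilon> (A i) + ennreal (e * (1/2)^Suc i)" for i
  proof -
    have "hausdorff_pre s \<epsilon> (A i) < top"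
      using fin by (meson ennreal_suminf_lessD)
    then have "hausdorff_pre s \<epsilon> (A i) < hausdorff_pre s \<epsilon> (A i) + ennreal (e * (1/2)^Suc i)"
      using e by (simp add: ennreal_zero_less_divide)
    then obtain C where "C \<in> ball_covers \<epsilon> (A i)" "cover_sum s C < hausdorff_pre s \<epsilon> (A i) + ennreal (e * (1/2)^Suc i)"
      unfolding hausdorff_pre_def[of s \<epsilon> "A i"] INF_less_iff by auto
    then show ?thesis by (auto intro: less_imp_le)
  qed
  then obtain C where C: "\<And>i. C i \<in> ball_covers \<epsilon> (A i)"
    "\<And>i. cover_sum s (C i) \<le> hausdorff_pre s \<epsilon> (A i) + ennreal (e * (1/2)^Suc i)" by metis
  have cn: "countable (C i)" for i using C(1) by (auto simp: ball_covers_def)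
  have "(\<Union>i. C i) \<in> ball_covers \<epsilon> (\<Union>i. A i)"
    using C(1) unfolding ball_covers_def by fastforce
  then have "hausdorff_pre s \<epsilon> (\<Union>i. A i) \<le> cover_sum s (\<Union>i. C i)"
    unfolding hausdorff_pre_def by (rule INF_lower)
  also have "\<dots> \<le> (\<Sum>i. cover_sum s (C i))"
    using cn by (simp add: cover_sum_eq) (rule emeasure_subadditive_countably, auto)
  also have "\<dots> \<le> (\<Sum>i. hausdorff_pre s \<epsilon> (A i) + ennreal (e * (1/2)^Suc i))"
    by (intro suminf_le C) auto
  also have "\<dots> = (\<Sum>i. hausdorff_pre s \<epsilon> (A i)) + (\<Sum>i. ennreal (e * (1/2)^Suc i))"
    by (rule suminf_add[symmetric]) auto
  also have "(\<Sum>i. ennreal (e * (1/2)^Suc i)) = ennreal e"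
    using e sums_mult[OF power_half_series, of e] by (intro suminf_ennreal_eq) auto
  finally show "hausdorff_pre s \<epsilon> (\<Union>i. A i) \<le> (\<Sum>i. hausdorff_pre s \<epsilon> (A i)) + ennreal e" .
qed

lemma hausdorff_outer_countably_subadditive:
  "hausdorff_outer s (\<Union>i::nat. A i) \<le> (\<Sum>i. hausdorff_outer s (A i))"
proof (rule hausdorff_outer_leI)
  fix \<epsilon> :: real assume e: "\<epsilon> > 0"
  have "ennreal (unit_ball_vol s) * hausdorff_pre s \<epsilon> (\<Union>i. A i) \<le>
        ennreal (unit_ball_vol s) * (\<Sum>i. hausdorff_pre s \<epsilon> (A i))"
    by (intro mult_left_mono hausdorff_pre_countably_subadditive) auto
  also have "\<dots> = (\<Sum>i. ennreal (unit_ball_vol s) * hausdorff_pre s \<epsilon> (A i))"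
    by simp
  also have "\<dots> \<le> (\<Sum>i. hausdorff_outer s (A i))"
    by (intro suminf_le hausdorff_pre_le_outer e) auto
  finally show "ennreal (unit_ball_vol s) * hausdorff_pre s \<epsilon> (\<Union>i. A i) \<le> (\<Sum>i. hausdorff_outer s (A i))" .
qed

lemma subadditive_of_countably_subadditive:
  fixes \<nu> :: "'a set \<Rightarrow> ennreal"
  assumes "\<nu> {} = 0" "\<And>F :: nat \<Rightarrow> 'a set. \<nu> (\<Union>i. F i) \<le> (\<Sum>i. \<nu> (F i))"
  shows "\<nu> (A \<union> B) \<le> \<nu> A + \<nu> B"
proof -
  define F where "F i = (if i = 0 then A else if i = Suc 0 then B else {})" for i :: nat
  have "(\<Union>i. F i) = A \<union> B" by (auto simp: F_def split: if_splits)
  moreover have "(\<Sum>i. \<nu> (F i)) = (\<Sum>i\<in>{0, Suc 0}. \<nu> (F i))"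
    using assms(1) by (intro suminf_finite) (auto simp: F_def)
  ultimately show ?thesis using assms(2)[of F] by (simp add: F_def)
qed

lemma hausdorff_pre_subadditive: "hausdorff_pre s \<epsilon> (A \<union> B) \<le> hausdorff_pre s \<epsilon> A + hausdorff_pre s \<epsilon> B"
  by (rule subadditive_of_countably_subadditive[OF hausdorff_pre_empty hausdorff_pre_countably_subadditive])

lemma hausdorff_outer_subadditive: "hausdorff_outer s (A \<union> B) \<le> hausdorff_outer s A + hausdorff_outer s B"
  by (rule subadditive_of_countably_subadditive[OF hausdorff_outer_empty hausdorff_outer_countably_subadditive])

lemma hausdorff_outer_measure_space: "outer_measure_space UNIV (hausdorff_outer s)"
  unfolding outer_measure_space_def positive_def increasing_def countably_subadditive_def
  by (auto intro: hausdorff_outer_mono hausdorff_outer_countably_subadditive)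

text \<open>
  A ball of radius at most \<open>d / 2\<close> cannot meet two sets at distance \<open>d\<close>, so a fine covering of the
  union splits into coverings of the two sets.
\<close>

lemma hausdorff_outer_separated:
  assumes d: "d > 0" and sep: "\<And>a b. a \<in> A \<Longrightarrow> b \<in> B \<Longrightarrow> d \<le> dist a b"
  shows "hausdorff_outer s A + hausdorff_outer s B \<le> hausdorff_outer s (A \<union> B)"
proof -
  have *: "hausdorff_pre s \<epsilon> A + hausdorff_pre s \<epsilon> B \<le> hausdorff_pre s \<epsilon> (A \<union> B)" if \<epsilon>: "\<epsilon> \<le> d / 2" for \<epsilon>
    unfolding hausdorff_pre_def[of s \<epsilon> "A \<union> B"]
  proof (rule INF_greatest)
    fix C assume C: "C \<in> ball_covers \<epsilon> (A \<union> B)"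
    define CA where "CA = {(x, r) \<in> C. ball x r \<inter> A \<noteq> {}}"
    define CB where "CB = {(x, r) \<in> C. ball x r \<inter> B \<noteq> {}}"
    have cC: "countable C" and sub: "CA \<subseteq> C" "CB \<subseteq> C"
      using C by (auto simp: ball_covers_def CA_def CB_def)
    have c: "countable CA" "countable CB" "countable (CA \<union> CB)"
      using countable_subset[OF _ cC] sub by auto
    have disj: "CA \<inter> CB = {}"
    proof (rule ccontr)
      assume "CA \<inter> CB \<noteq> {}"
      then obtain x r a b where xr: "(x, r) \<in> C" "a \<in> A" "b \<in> B" "dist x a < r" "dist x b < r"
        by (auto simp: CA_def CB_def)
      then have "r \<le> \<epsilon>" using C by (auto simp: ball_covers_def)
      have "dist a b \<le> dist x a + dist x b" by (metis dist_commute dist_triangle)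
      with xr \<epsilon> \<open>r \<le> \<epsilon>\<close> sep[of a b] show False by simp
    qed
    have cov: "\<exists>(x, r) \<in> C. a \<in> ball x r" if "a \<in> A \<union> B" for a
      using C that unfolding ball_covers_def by (fastforce simp del: mem_ball)
    have "A \<subseteq> (\<Union>(x, r)\<in>CA. ball x r)" "B \<subseteq> (\<Union>(x, r)\<in>CB. ball x r)"
      using cov unfolding CA_def CB_def by (force simp del: mem_ball)+
    moreover have "\<forall>(x, r) \<in> CA. 0 < r \<and> r \<le> \<epsilon>" "\<forall>(x, r) \<in> CB. 0 < r \<and> r \<le> \<epsilon>"
      using C sub by (auto simp: ball_covers_def)
    ultimately have "CA \<in> ball_covers \<epsilon> A" "CB \<in> ball_covers \<epsilon> B"
      using c by (simp_all add: ball_covers_def)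
    then have "hausdorff_pre s \<epsilon> A + hausdorff_pre s \<epsilon> B \<le> cover_sum s CA + cover_sum s CB"
      unfolding hausdorff_pre_def by (intro add_mono INF_lower)
    also have "\<dots> = cover_sum s (CA \<union> CB)"
      using c disj by (simp add: cover_sum_eq plus_emeasure)
    also have "\<dots> \<le> cover_sum s C"
      using c cC sub by (simp add: cover_sum_eq emeasure_mono)
    finally show "hausdorff_pre s \<epsilon> A + hausdorff_pre s \<epsilon> B \<le> cover_sum s C" .
  qed
  show ?thesis
    unfolding hausdorff_outer_eq
  proof (rule tendsto_le[OF _ hausdorff_outer_tendsto tendsto_add[OF hausdorff_outer_tendsto hausdorff_outer_tendsto]])
    show "\<forall>\<^sub>F \<epsilon> in at_right 0. ennreal (unit_ball_vol s) * hausdorff_pre s \<epsilon> A + ennreal (unit_ball_vol s) * hausdorff_pre s \<epsilon> B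
       \<le> ennreal (unit_ball_vol s) * hausdorff_pre s \<epsilon> (A \<union> B)"
      unfolding eventually_at_right_field
      using d by (intro exI[of _ "d/2"]) (auto simp: distrib_left[symmetric] intro!: mult_left_mono *)
  qed simp
qed

lemma hausdorff_outer_separated_sum:
  fixes N :: nat
  assumes "\<And>i j. i < j \<Longrightarrow> j < N \<Longrightarrow> \<exists>d>0. \<forall>a\<in>A i. \<forall>b\<in>A j. d \<le> dist a b"
  shows "(\<Sum>i<N. hausdorff_outer s (A i)) \<le> hausdorff_outer s (\<Union>i<N. A i)"
  using assms
proof (induction N)
  case (Suc N)
  have "\<forall>i\<in>{..<N}. \<exists>d>0. \<forall>a\<in>A i. \<forall>b\<in>A N. d \<le> dist a b"
    using Suc.prems by auto
  then obtain d where d: "\<And>i. i < N \<Longrightarrow> d i > 0" "\<And>i a b. i < N \<Longrightarrow> a \<in> A i \<Longrightarrow> b \<in> A N \<Longrightarrow> d i \<le> dist a b"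
    by (metis lessThan_iff)
  define D where "D = Min (insert 1 (d ` {..<N}))"
  have D: "D > 0" "\<And>i. i < N \<Longrightarrow> D \<le> d i"
    using d by (auto simp: D_def)
  have "(\<Sum>i<Suc N. hausdorff_outer s (A i)) \<le> hausdorff_outer s (\<Union>i<N. A i) + hausdorff_outer s (A N)"
    using Suc by (auto intro!: add_mono)
  also have "\<dots> \<le> hausdorff_outer s ((\<Union>i<N. A i) \<union> A N)"
    by (rule hausdorff_outer_separated[OF D(1)]) (use d D in force)
  also have "(\<Union>i<N. A i) \<union> A N = (\<Union>i<Suc N. A i)"
    by (auto simp: less_Suc_eq)
  finally show ?case .
qed simp

text \<open>
  Caratheodory's criterion for metric outer measures.  A set \<open>X\<close> of finite measure is split
  into \<open>X \<inter> F\<close>, the part \<open>Y n\<close> at distance at least \<open>1/(n+1)\<close> from \<open>F\<close>, and the shells \<open>R i\<close> between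
  consecutive distances.  Shells with indices of the same parity are separated, so their measures
  are summable, and what lies between \<open>Y n\<close> and \<open>F\<close> has measure tending to 0.
\<close>

lemma closed_in_lambda_system:
  fixes F :: "'a::metric_space set"
  assumes "closed F"
  shows "F \<in> lambda_system UNIV UNIV (hausdorff_outer s)"
proof (cases "F = {}")
  case True then show ?thesis by (auto simp: lambda_system_def)
next
  case ne: False
  let ?H = "hausdorff_outer s :: 'a set \<Rightarrow> ennreal"
  have key: "?H (F \<inter> X) + ?H (X - F) \<le> ?H X" for X
  proof (cases "?H X < top")
    case fin: True
    define Y where "Y n = {x \<in> X. infdist x F \<ge> 1 / real (Suc n)}" for n
    define R where "R n = {x \<in> X. 1 / real (Suc (Suc n)) \<le> infdist x F \<and> infdist x F < 1 / real (Suc n)}" for n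
    have ge: "infdist y F \<le> dist x y + infdist x F" for x y
      using infdist_triangle[of y F x] by (simp add: dist_commute)
    have Rsep: "\<exists>d>0. \<forall>a\<in>R i. \<forall>b\<in>R j. d \<le> dist a b" if "Suc i < j" for i j
    proof (intro exI conjI ballI)
      let ?d = "1 / real (Suc (Suc i)) - 1 / real (Suc j)"
      have "1 / real (Suc j) < 1 / real (Suc (Suc i))"
        using that by (intro divide_strict_left_mono) auto
      then show "?d > 0" by simp
      fix a b assume "a \<in> R i" "b \<in> R j"
      then show "?d \<le> dist a b" using ge[of a b] by (auto simp: R_def dist_commute)
    qed
    have half: "(\<Sum>i<N. ?H (R (2 * i + p))) \<le> ?H X" for N p
    proof -
      have "(\<Sum>i<N. ?H (R (2 * i + p))) \<le> ?H (\<Union>i<N. R (2 * i + p))"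
        by (rule hausdorff_outer_separated_sum) (auto intro!: Rsep)
      also have "\<dots> \<le> ?H X" by (rule hausdorff_outer_mono) (auto simp: R_def)
      finally show ?thesis .
    qed
    \<comment> \<open>shells of even and of odd index are summed separately\<close>
    have tot: "(\<Sum>i. ?H (R i)) < top"
    proof -
      have "(\<Sum>i<N. ?H (R i)) \<le> ?H X + ?H X" for N
      proof -
        have "(\<Sum>i<N. ?H (R i)) \<le> (\<Sum>i<2*N. ?H (R i))"
          by (rule sum_mono2) auto
        also have "\<dots> = (\<Sum>i<N. ?H (R (2 * i + 0))) + (\<Sum>i<N. ?H (R (2 * i + 1)))"
          by (induction N) (auto simp: algebra_simps)
        also have "\<dots> \<le> ?H X + ?H X" by (intro add_mono half)
        finally show ?thesis .
      qed
      then have "(\<Sum>i. ?H (R i)) \<le> ?H X + ?H X"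
        by (intro suminf_le_const) auto
      then show ?thesis using fin by (metis ennreal_add_less_top le_less_trans)
    qed
    have Y: "?H (F \<inter> X) + ?H (Y n) \<le> ?H X" for n
    proof -
      have "?H (F \<inter> X) + ?H (Y n) \<le> ?H ((F \<inter> X) \<union> Y n)"
      proof (rule hausdorff_outer_separated[of "1 / real (Suc n)"])
        fix a b assume "a \<in> F \<inter> X" "b \<in> Y n"
        then show "1 / real (Suc n) \<le> dist a b"
          using infdist_le[of a F b] by (auto simp: Y_def dist_commute)
      qed simp
      also have "\<dots> \<le> ?H X" by (rule hausdorff_outer_mono) (auto simp: Y_def)
      finally show ?thesis .
    qed
    have XF: "?H (X - F) \<le> ?H (Y n) + (\<Sum>i. ?H (R (i + n)))" for n
    proof -
      have "X - F \<subseteq> Y n \<union> (\<Union>i. R (i + n))"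
      proof
        fix x assume x: "x \<in> X - F"
        then have pos: "infdist x F > 0" using assms ne by (simp add: infdist_pos_not_in_closed)
        show "x \<in> Y n \<union> (\<Union>i. R (i + n))"
        proof (cases "x \<in> Y n")
          case False
          define k where "k = (LEAST k. 1 / real (Suc k) \<le> infdist x F)"
          have ex: "\<exists>k. 1 / real (Suc k) \<le> infdist x F"
            using pos by (metis nat_approx_posE less_imp_le)
          have k: "1 / real (Suc k) \<le> infdist x F" unfolding k_def by (rule LeastI_ex[OF ex])
          have lt: "infdist x F < 1 / real (Suc j)" if "j < k" for j
            using not_less_Least[of j] that unfolding k_def by (meson not_le)
          have nk: "n < k"
          proof (rule ccontr)
            assume "\<not> n < k"
            then have "1 / real (Suc n) \<le> 1 / real (Suc k)" by (simp add: field_simps)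
            with k False x show False by (auto simp: Y_def)
          qed
          then obtain j where j: "k = Suc (j + n)" by (metis add.commute less_imp_Suc_add)
          then have "x \<in> R (j + n)" using k lt[of "j + n"] x by (auto simp: R_def)
          then show ?thesis by auto
        qed auto
      qed
      then have "?H (X - F) \<le> ?H (Y n \<union> (\<Union>i. R (i + n)))" by (rule hausdorff_outer_mono)
      also have "\<dots> \<le> ?H (Y n) + ?H (\<Union>i. R (i + n))" by (rule hausdorff_outer_subadditive)
      also have "\<dots> \<le> ?H (Y n) + (\<Sum>i. ?H (R (i + n)))"
        by (intro add_left_mono hausdorff_outer_countably_subadditive)
      finally show ?thesis .
    qed
    have tail: "(\<lambda>n. \<Sum>i. ?H (R (i + n))) \<longlonglongrightarrow> 0"
    proof -
      define g where "g i = enn2real (?H (R i))" for i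
      have fi: "?H (R i) < top" for i using tot by (meson ennreal_suminf_lessD)
      have g: "?H (R i) = ennreal (g i)" "g i \<ge> 0" for i using fi by (auto simp: g_def)
      have sg: "summable g"
        using tot g by (metis (mono_tags, lifting) summable_suminf_not_top less_irrefl suminf_cong)
      have "(\<lambda>n. \<Sum>i. g (i + n)) \<longlonglongrightarrow> 0"
        using suminf_exist_split2[OF sg] .
      then have "(\<lambda>n. ennreal (\<Sum>i. g (i + n))) \<longlonglongrightarrow> ennreal 0" by (rule tendsto_ennrealI)
      moreover have "ennreal (\<Sum>i. g (i + n)) = (\<Sum>i. ?H (R (i + n)))" for n
        using sg g by (subst suminf_ennreal2[symmetric]) (auto simp: summable_iff_shift)
      ultimately show ?thesis by simp
    qed
    have "?H (F \<inter> X) + ?H (X - F) \<le> ?H X + (\<Sum>i. ?H (R (i + n)))" for n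
    proof -
      have "?H (F \<inter> X) + ?H (X - F) \<le> ?H (F \<inter> X) + (?H (Y n) + (\<Sum>i. ?H (R (i + n))))"
        by (intro add_left_mono XF)
      also have "\<dots> \<le> ?H X + (\<Sum>i. ?H (R (i + n)))"
        using Y[of n] by (simp add: add.assoc[symmetric] add_right_mono)
      finally show ?thesis .
    qed
    moreover have "(\<lambda>n. ?H X + (\<Sum>i. ?H (R (i + n)))) \<longlonglongrightarrow> ?H X + 0"
      by (intro tendsto_add tendsto_const tail)
    ultimately show ?thesis
      by (intro tendsto_lowerbound[of "\<lambda>n. ?H X + (\<Sum>i. ?H (R (i + n)))" "?H X" sequentially]) auto
  next
    case False
    then have "?H X = top" by (metis top.not_eq_extremum)
    then show ?thesis by simp
  qed
  have "?H (F \<inter> X) + ?H ((UNIV - F) \<inter> X) = ?H X" for X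
  proof (rule antisym)
    show "?H (F \<inter> X) + ?H ((UNIV - F) \<inter> X) \<le> ?H X"
      using key[of X] by (simp add: Diff_eq Int_commute)
    have "?H X \<le> ?H ((F \<inter> X) \<union> ((UNIV - F) \<inter> X))" by (rule hausdorff_outer_mono) auto
    also have "\<dots> \<le> ?H (F \<inter> X) + ?H ((UNIV - F) \<inter> X)" by (rule hausdorff_outer_subadditive)
    finally show "?H X \<le> ?H (F \<inter> X) + ?H ((UNIV - F) \<inter> X)" .
  qed
  then show ?thesis by (auto simp: lambda_system_def)
qed

lemma hausdorff_measure_space:
  "measure_space UNIV (sets borel) (hausdorff_outer s :: 'a::metric_space set \<Rightarrow> ennreal)"
proof -
  interpret P: sigma_algebra UNIV "UNIV :: 'a set set" using sigma_algebra_Pow[of UNIV] by simp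
  let ?L = "lambda_system UNIV UNIV (hausdorff_outer s) :: 'a set set"
  have L: "measure_space UNIV ?L (hausdorff_outer s)"
    by (rule P.caratheodory_lemma[OF hausdorff_outer_measure_space])
  then interpret L: sigma_algebra UNIV ?L by (simp add: measure_space_def)
  have sub: "sets borel \<subseteq> ?L"
    unfolding borel_eq_closed by (simp, rule L.sigma_sets_subset) (auto intro: closed_in_lambda_system)
  have "positive (sets borel) (hausdorff_outer s :: 'a set \<Rightarrow> ennreal)"
    by (simp add: positive_def)
  with L sub show ?thesis
    using sets.sigma_algebra_axioms[of "borel :: 'a measure"]
    by (auto simp: measure_space_def countably_additive_def)
qed

lemma sets_hausdorff_measure [simp, measurable_cong]: "sets (hausdorff_measure s) = sets borel"
  unfolding hausdorff_measure_def by (metis sets.sets_measure_of_eq space_borel)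

lemma space_hausdorff_measure [simp]: "space (hausdorff_measure s) = UNIV"
  unfolding hausdorff_measure_def by (simp add: space_measure_of_conv)

lemma emeasure_hausdorff_measure:
  assumes "A \<in> sets borel" shows "emeasure (hausdorff_measure s) A = hausdorff_outer s A"
proof (rule emeasure_measure_of[OF hausdorff_measure_def])
  show "sets borel \<subseteq> Pow UNIV" by auto
  show "A \<in> sets (hausdorff_measure s)" using assms by simp
  show "positive (sets (hausdorff_measure s)) (hausdorff_outer s)"
    "countably_additive (sets (hausdorff_measure s)) (hausdorff_outer s)"
    using hausdorff_measure_space[of s] by (auto simp: measure_space_def)
qed

section \<open>Lipschitz images and maps close to the identity\<close>

lemma orthonormal_expansion:
  fixes B :: "'a::euclidean_space set"
  assumes "finite B" "\<And>b. b \<in> B \<Longrightarrow> norm b = 1" "pairwise orthogonal B"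
  shows "b \<in> B \<Longrightarrow> (\<Sum>c\<in>B. f c *\<^sub>R c) \<bullet> b = f b"
    and "norm (\<Sum>c\<in>B. f c *\<^sub>R c) = sqrt (\<Sum>c\<in>B. (f c)\<^sup>2)"
    and "x \<in> span B \<Longrightarrow> (\<Sum>c\<in>B. (x \<bullet> c) *\<^sub>R c) = x"
proof -
  have ip: "c \<bullet> b = (if c = b then 1 else 0)" if "c \<in> B" "b \<in> B" for b c
    using assms that by (auto simp: pairwise_def orthogonal_def dot_square_norm)
  show dot: "(\<Sum>c\<in>B. f c *\<^sub>R c) \<bullet> b = f b" if "b \<in> B" for f b
  proof -
    have "(\<Sum>c\<in>B. f c *\<^sub>R c) \<bullet> b = (\<Sum>c\<in>B. if c = b then f c else 0)"
      unfolding inner_sum_left by (rule sum.cong) (use ip that in auto)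
    also have "\<dots> = f b" using assms(1) that by simp
    finally show ?thesis .
  qed
  have "w \<bullet> (\<Sum>c\<in>B. f c *\<^sub>R c) = (\<Sum>b\<in>B. f b * (w \<bullet> b))" for w
    by (simp add: inner_sum_right)
  from this[of "\<Sum>c\<in>B. f c *\<^sub>R c"]
  have "(\<Sum>c\<in>B. f c *\<^sub>R c) \<bullet> (\<Sum>c\<in>B. f c *\<^sub>R c) = (\<Sum>b\<in>B. f b * ((\<Sum>c\<in>B. f c *\<^sub>R c) \<bullet> b))" .
  also have "\<dots> = (\<Sum>b\<in>B. (f b)\<^sup>2)" by (rule sum.cong) (auto simp: dot power2_eq_square)
  finally show "norm (\<Sum>c\<in>B. f c *\<^sub>R c) = sqrt (\<Sum>c\<in>B. (f c)\<^sup>2)" by (simp add: norm_eq_sqrt_inner)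
  show "(\<Sum>c\<in>B. (x \<bullet> c) *\<^sub>R c) = x" if "x \<in> span B"
  proof -
    obtain u where u: "x = (\<Sum>c\<in>B. u c *\<^sub>R c)" using \<open>x \<in> span B\<close> assms(1) by (auto simp: span_finite)
    show ?thesis unfolding u by (rule sum.cong) (auto simp: dot)
  qed
qed

text \<open>
  The choice is only used for a linear subspace \<open>S\<close>, where these conditions determine the projection.
\<close>

definition orth_proj :: "'a::euclidean_space set \<Rightarrow> 'a \<Rightarrow> 'a" where
  "orth_proj S = (SOME P. linear P \<and> range P \<subseteq> S \<and> (\<forall>x. \<forall>y\<in>S. (x - P x) \<bullet> y = 0))"

lemma orth_proj:
  fixes S :: "'a::euclidean_space set"
  assumes S: "subspace S"
  shows linear_orth_proj: "linear (orth_proj S)"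
    and orth_proj_in: "orth_proj S x \<in> S"
    and orth_proj_orthogonal: "y \<in> S \<Longrightarrow> (x - orth_proj S x) \<bullet> y = 0"
    and orth_proj_id: "y \<in> S \<Longrightarrow> orth_proj S y = y"
    and norm_orth_proj_le: "norm (orth_proj S x) \<le> norm x"
    and orth_proj_nearest: "y \<in> S \<Longrightarrow> dist (orth_proj S x) y \<le> dist x y"
proof -
  obtain B where B: "B \<subseteq> S" "pairwise orthogonal B" "\<And>x. x \<in> B \<Longrightarrow> norm x = 1" "independent B" "span B = S"
    using orthonormal_basis_subspace[OF S] by metis
  have fB: "finite B" using B(4) by (rule independent_imp_finite)
  note E = orthonormal_expansion[OF fB B(3) B(2)]
  have ex: "\<exists>P. linear P \<and> range P \<subseteq> S \<and> (\<forall>x. \<forall>y\<in>S. (x - P x) \<bullet> y = 0)"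
  proof (intro exI conjI allI ballI)
    let ?P = "\<lambda>x. \<Sum>c\<in>B. (x \<bullet> c) *\<^sub>R c"
    show "linear ?P"
      by (auto intro!: linear_compose_sum linearI simp: inner_add_left scaleR_add_left)
    show "range ?P \<subseteq> S" using B(5) by (auto intro!: span_sum span_scale intro: span_base)
    fix x y assume "y \<in> S"
    then have y: "(\<Sum>c\<in>B. (y \<bullet> c) *\<^sub>R c) = y" using E(3) B(5) by auto
    have "(x - ?P x) \<bullet> (\<Sum>c\<in>B. (y \<bullet> c) *\<^sub>R c) = 0"
      unfolding inner_sum_right by (rule sum.neutral) (auto simp: inner_diff_left E(1))
    then show "(x - ?P x) \<bullet> y = 0" using y by simp
  qed
  have *: "linear (orth_proj S) \<and> range (orth_proj S) \<subseteq> S \<and> (\<forall>x. \<forall>y\<in>S. (x - orth_proj S x) \<bullet> y = 0)"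
    unfolding orth_proj_def by (rule someI_ex[OF ex])
  show lin: "linear (orth_proj S)" and inS: "orth_proj S x \<in> S" for x using * by auto
  show ort: "(x - orth_proj S x) \<bullet> y = 0" if "y \<in> S" for x y using * that by auto
  show "orth_proj S y = y" if "y \<in> S"
  proof -
    have "(y - orth_proj S y) \<bullet> (y - orth_proj S y) = 0"
      by (rule ort) (intro subspace_diff S that inS)
    then show ?thesis by simp
  qed
  have near: "dist (orth_proj S x) y \<le> dist x y" if "y \<in> S" for x y
  proof -
    have "(x - orth_proj S x) \<bullet> (orth_proj S x - y) = 0"
      by (rule ort) (intro subspace_diff S that inS)
    then have "orthogonal (x - orth_proj S x) (orth_proj S x - y)" by (simp add: orthogonal_def)
    from norm_add_Pythagorean[OF this] have "(norm (orth_proj S x - y))\<^sup>2 \<le> (norm (x - y))\<^sup>2"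
      by simp
    then show ?thesis by (simp add: dist_norm)
  qed
  then show "y \<in> S \<Longrightarrow> dist (orth_proj S x) y \<le> dist x y" by blast
  show "norm (orth_proj S x) \<le> norm x" using near[of 0 x] S by (simp add: subspace_0)
qed

text \<open>
  The coverings may use balls with centres off the set, where a locally defined map has no
  values.  On a subspace this does no harm: the ball of radius \<open>r\<close> around the projection of \<open>x\<close> to \<open>S\<close> contains \<open>ball x r \<inter> S\<close>, and
  for small radii the projected centres stay in the domain.
\<close>

lemma hausdorff_outer_Lipschitz_uniform:
  fixes f :: "'a::euclidean_space \<Rightarrow> 'b::metric_space"
  assumes S: "subspace S" and c: "c > 0" and d: "d > 0"
    and lip: "\<And>x y. x \<in> S \<inter> O' \<Longrightarrow> y \<in> S \<inter> O' \<Longrightarrow> dist (f x) (f y) \<le> c * dist x y"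
    and Z: "Z \<subseteq> S" "\<And>z. z \<in> Z \<Longrightarrow> ball z d \<subseteq> O'"
  shows "hausdorff_outer s (f ` Z) \<le> ennreal (c powr s) * hausdorff_outer s Z"
proof -
  have pre: "hausdorff_pre s (c * \<epsilon>) (f ` Z) \<le> ennreal (c powr s) * hausdorff_pre s \<epsilon> Z"
    if \<epsilon>: "0 < \<epsilon>" "\<epsilon> \<le> d" for \<epsilon>
  proof -
    have "hausdorff_pre s (c * \<epsilon>) (f ` Z) \<le> ennreal (c powr s) * cover_sum s C" if C: "C \<in> ball_covers \<epsilon> Z" for C
    proof -
      define C' where "C' = {(x, r) \<in> C. ball x r \<inter> Z \<noteq> {}}"
      define h where "h = (\<lambda>(x, r :: real). (f (orth_proj S x), c * r))"
      have cC: "countable C" "C' \<subseteq> C" using C by (auto simp: ball_covers_def C'_def)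
      then have cC': "countable C'" using countable_subset by blast
      have r: "0 < r \<and> r \<le> \<epsilon>" if "(x, r) \<in> C" for x r using C that by (auto simp: ball_covers_def)
      have "h ` C' \<in> ball_covers (c * \<epsilon>) (f ` Z)"
        unfolding ball_covers_def
      proof (intro CollectI conjI)
        show "countable (h ` C')" using cC' by simp
        show "\<forall>(x, r)\<in>h ` C'. 0 < r \<and> r \<le> c * \<epsilon>"
          using r c cC(2) by (fastforce simp: h_def)
        show "f ` Z \<subseteq> (\<Union>(x, r)\<in>h ` C'. ball x r)"
        proof
          fix w assume "w \<in> f ` Z"
          then obtain z where z: "z \<in> Z" "w = f z" by auto
          then obtain x r where xr: "(x, r) \<in> C" "z \<in> ball x r"
            using C unfolding ball_covers_def by fastforce
          then have C'm: "(x, r) \<in> C'" using z by (auto simp: C'_def)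
          let ?p = "orth_proj S x"
          have zS: "z \<in> S" using z Z by auto
          have d1: "dist ?p z \<le> dist x z" by (rule orth_proj_nearest[OF S zS])
          then have "dist ?p z < r" using xr by simp
          moreover then have "?p \<in> ball z d" using r[OF xr(1)] \<epsilon> by (simp add: dist_commute)
          then have "?p \<in> S \<inter> O'" using Z(2)[OF z(1)] orth_proj_in[OF S] by auto
          moreover have "z \<in> S \<inter> O'" using Z(2)[OF z(1)] zS d by (auto simp: subset_iff)
          ultimately have "dist (f ?p) (f z) < c * r" using lip[of ?p z] c
            by (smt (verit) mult_strict_left_mono)
          then have "w \<in> ball (f ?p) (c * r)" using z by simp
          moreover have "(f ?p, c * r) \<in> h ` C'" using C'm by (force simp: h_def)
          ultimately show "w \<in> (\<Union>(x, r)\<in>h ` C'. ball x r)" by blast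
        qed
      qed
      then have "hausdorff_pre s (c * \<epsilon>) (f ` Z) \<le> cover_sum s (h ` C')"
        unfolding hausdorff_pre_def by (rule INF_lower)
      also have "\<dots> \<le> (\<Sum>\<^sub>\<infinity>x\<in>C'. case h x of (x, r) \<Rightarrow> ennreal (r powr s))"
        unfolding cover_sum_def by (rule infsum_ennreal_image_le)
      also have "\<dots> = (\<integral>\<^sup>+x. (case h x of (x, r) \<Rightarrow> ennreal (r powr s)) * indicator C' x \<partial>count_space UNIV)"
        using cC' by (rule infsum_ennreal_eq_nn_integral)
      also have "\<dots> \<le> (\<integral>\<^sup>+x. ennreal (c powr s) * ((case x of (x, r) \<Rightarrow> ennreal (r powr s)) * indicator C x) \<partial>count_space UNIV)"
      proof (rule nn_integral_mono)
        fix x :: "'a \<times> real"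
        show "(case h x of (x, r) \<Rightarrow> ennreal (r powr s)) * indicator C' x
          \<le> ennreal (c powr s) * ((case x of (x, r) \<Rightarrow> ennreal (r powr s)) * indicator C x)"
          using cC(2) r[of "fst x" "snd x"] c
          by (auto simp: h_def split_beta powr_mult ennreal_mult split: split_indicator)
      qed
      also have "\<dots> = ennreal (c powr s) * cover_sum s C"
        unfolding cover_sum_def using cC(1) by (simp add: nn_integral_cmult infsum_ennreal_eq_nn_integral)
      finally show ?thesis .
    qed
    moreover have "a \<le> ennreal k * (INF i\<in>I. g i)" if "k > 0" "\<And>i. i \<in> I \<Longrightarrow> a \<le> ennreal k * g i"
      for a k I and g :: "('a \<times> real) set \<Rightarrow> ennreal"
    proof -
      have k: "ennreal (1 / k) * ennreal k = 1" using that(1) by (simp add: ennreal_mult'[symmetric])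
      have "ennreal (1 / k) * a \<le> g i" if "i \<in> I" for i
        using mult_left_mono[OF \<open>\<And>i. i \<in> I \<Longrightarrow> a \<le> ennreal k * g i\<close>[OF that], of "ennreal (1 / k)"] k
        by (simp add: mult.assoc[symmetric])
      then have "ennreal (1 / k) * a \<le> (INF i\<in>I. g i)" by (rule INF_greatest)
      from mult_left_mono[OF this, of "ennreal k"] k show ?thesis
        by (simp add: mult.assoc[symmetric] mult.commute[of "ennreal k"])
    qed
    ultimately show ?thesis
      unfolding hausdorff_pre_def[of s \<epsilon> Z] using c by simp
  qed
  show ?thesis
  proof (rule hausdorff_outer_leI)
    fix \<epsilon>' :: real assume e: "\<epsilon>' > 0"
    define \<epsilon> where "\<epsilon> = min (\<epsilon>' / c) d"
    have \<epsilon>: "0 < \<epsilon>" "\<epsilon> \<le> d" "c * \<epsilon> \<le> \<epsilon>'" using c d e by (auto simp: \<epsilon>_def min_def field_simps)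
    have "ennreal (unit_ball_vol s) * hausdorff_pre s \<epsilon>' (f ` Z) \<le> ennreal (unit_ball_vol s) * (ennreal (c powr s) * hausdorff_pre s \<epsilon> Z)"
      using pre[OF \<epsilon>(1,2)] hausdorff_pre_antimono[OF \<epsilon>(3), of s "f ` Z"] by (intro mult_left_mono) auto
    also have "\<dots> = ennreal (c powr s) * (ennreal (unit_ball_vol s) * hausdorff_pre s \<epsilon> Z)"
      by (simp add: mult_ac)
    also have "\<dots> \<le> ennreal (c powr s) * hausdorff_outer s Z"
      by (intro mult_left_mono hausdorff_pre_le_outer \<epsilon>) auto
    finally show "ennreal (unit_ball_vol s) * hausdorff_pre s \<epsilon>' (f ` Z) \<le> ennreal (c powr s) * hausdorff_outer s Z" .
  qed
qed

lemma hausdorff_outer_Lipschitz_UNIV: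
  fixes f :: "'a::euclidean_space \<Rightarrow> 'b::metric_space"
  assumes "c > 0" "\<And>x y. dist (f x) (f y) \<le> c * dist x y"
  shows "hausdorff_outer s (f ` Z) \<le> ennreal (c powr s) * hausdorff_outer s Z"
  by (rule hausdorff_outer_Lipschitz_uniform[of UNIV c 1 UNIV]) (use assms in auto)

lemma openin_subspace_borel:
  fixes S :: "'a::euclidean_space set"
  assumes "subspace S" "openin (top_of_set S) W"
  shows "W \<in> sets borel"
  using assms borel_closed[OF closed_subspace[OF assms(1)]] by (auto simp: openin_open)

text \<open>
  A relatively open domain is exhausted by the sets of points whose \<open>1/(n+1)\<close>-ball stays inside; the Borel set
  \<open>Z\<close> is cut into disjoint pieces accordingly.
\<close>

lemma hausdorff_outer_Lipschitz:
  fixes f :: "'a::euclidean_space \<Rightarrow> 'b::metric_space"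
  assumes S: "subspace S" and W: "openin (top_of_set S) W" and c: "c > 0"
    and lip: "\<And>x y. x \<in> W \<Longrightarrow> y \<in> W \<Longrightarrow> dist (f x) (f y) \<le> c * dist x y"
    and Z: "Z \<subseteq> W" "Z \<in> sets borel"
  shows "hausdorff_outer s (f ` Z) \<le> ennreal (c powr s) * hausdorff_outer s Z"
proof -
  obtain V where V: "open V" "W = S \<inter> V" using W by (auto simp: openin_open)
  define D where "D n = {x. ball x (1 / real (Suc n)) \<subseteq> V}" for n
  have Dc: "closed (D n)" for n
  proof -
    have "D n = (if V = UNIV then UNIV else {x. infdist x (- V) \<ge> 1 / real (Suc n)})"
    proof (cases "V = UNIV")
      case False
      then have ne: "- V \<noteq> {}" by auto
      have "ball x e \<subseteq> V \<longleftrightarrow> infdist x (- V) \<ge> e" for x e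
      proof
        assume b: "ball x e \<subseteq> V"
        show "infdist x (- V) \<ge> e" unfolding infdist_notempty[OF ne]
          by (rule cINF_greatest[OF ne]) (use b in \<open>auto simp: subset_iff not_less[symmetric]\<close>)
      next
        assume "infdist x (- V) \<ge> e"
        then show "ball x e \<subseteq> V" using infdist_le[of _ "- V" x] by fastforce
      qed
      then show ?thesis using False by (auto simp: D_def)
    qed (simp add: D_def)
    then show ?thesis by (auto intro!: closed_Collect_le continuous_intros)
  qed
  define Z' where "Z' n = disjointed D n \<inter> Z" for n
  have DV: "(\<Union>n. D n) = V"
  proof
    show "V \<subseteq> (\<Union>n. D n)"
    proof
      fix x assume "x \<in> V"
      then obtain e where "e > 0" "ball x e \<subseteq> V" using V(1) open_contains_ball by blast
      moreover obtain n where "1 / real (Suc n) < e" using \<open>e > 0\<close> nat_approx_posE by blast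
      ultimately have "x \<in> D n" unfolding D_def by (smt (verit) mem_Collect_eq subset_ball subset_trans)
      then show "x \<in> (\<Union>n. D n)" by blast
    qed
  qed (auto simp: D_def subset_iff)
  have ZU: "(\<Union>n. Z' n) = Z"
  proof -
    have "(\<Union>n. Z' n) = (\<Union>n. disjointed D n) \<inter> Z" by (auto simp: Z'_def)
    also have "\<dots> = Z" using Z(1) V DV by (auto simp: UN_disjointed_eq)
    finally show ?thesis .
  qed
  have "range D \<subseteq> sets borel" using Dc by auto
  then have Z'm: "Z' n \<in> sets borel" for n
    unfolding Z'_def using sets.range_disjointed_sets[of D borel] Z(2) by auto
  have dis: "disjoint_family Z'"
    using disjoint_family_disjointed[of D] unfolding disjoint_family_on_def Z'_def by blast
  have "hausdorff_outer s (f ` Z) = hausdorff_outer s (\<Union>n. f ` Z' n)"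
    using ZU by (metis image_UN)
  also have "\<dots> \<le> (\<Sum>n. hausdorff_outer s (f ` Z' n))" by (rule hausdorff_outer_countably_subadditive)
  also have "\<dots> \<le> (\<Sum>n. ennreal (c powr s) * hausdorff_outer s (Z' n))"
  proof (intro suminf_le)
    fix n
    show "hausdorff_outer s (f ` Z' n) \<le> ennreal (c powr s) * hausdorff_outer s (Z' n)"
    proof (rule hausdorff_outer_Lipschitz_uniform[OF S c, where O' = V and d = "1 / real (Suc n)"])
      show "Z' n \<subseteq> S" using Z(1) V by (auto simp: Z'_def)
      show "ball z (1 / real (Suc n)) \<subseteq> V" if "z \<in> Z' n" for z
        using that disjointed_subset[of D n] by (auto simp: Z'_def D_def)
    qed (use lip V in auto)
  qed auto
  also have "\<dots> = ennreal (c powr s) * (\<Sum>n. hausdorff_outer s (Z' n))" by simp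
  also have "(\<Sum>n. hausdorff_outer s (Z' n)) = (\<Sum>n. emeasure (hausdorff_measure s) (Z' n))"
    using Z'm by (simp add: emeasure_hausdorff_measure)
  also have "\<dots> = emeasure (hausdorff_measure s) (\<Union>n. Z' n)"
    by (rule suminf_emeasure) (use Z'm dis in auto)
  also have "\<dots> = hausdorff_outer s Z" using ZU Z(2) by (simp add: emeasure_hausdorff_measure)
  finally show ?thesis .
qed

text \<open>
  The map \<open>h - id\<close> is \<open>\<delta>\<close>-Lipschitz on \<open>W\<close>.  Unlike a bi-Lipschitz bound, this property
  survives an orthogonal projection, and maps with it can be inverted and composed with control of the constant.
\<close>

definition near_id :: "real \<Rightarrow> 'a::real_normed_vector set \<Rightarrow> ('a \<Rightarrow> 'a) \<Rightarrow> bool" where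
  "near_id \<delta> W h \<longleftrightarrow> (\<forall>s\<in>W. \<forall>t\<in>W. norm (h s - h t - (s - t)) \<le> \<delta> * norm (s - t))"

lemma near_id_dist:
  assumes "near_id \<delta> W h" "s \<in> W" "t \<in> W"
  shows "dist (h s) (h t) \<le> (1 + \<delta>) * dist s t" "(1 - \<delta>) * dist s t \<le> dist (h s) (h t)"
proof -
  have "norm (h s - h t - (s - t)) \<le> \<delta> * norm (s - t)" using assms by (auto simp: near_id_def)
  moreover have "norm (h s - h t) \<le> norm (s - t) + norm (h s - h t - (s - t))"
    by (metis add.commute diff_add_cancel norm_triangle_ineq)
  moreover have "norm (s - t) \<le> norm (h s - h t) + norm (h s - h t - (s - t))"
    by (metis norm_minus_commute norm_triangle_sub)
  ultimately show "dist (h s) (h t) \<le> (1 + \<delta>) * dist s t" "(1 - \<delta>) * dist s t \<le> dist (h s) (h t)"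
    by (auto simp: dist_norm algebra_simps)
qed

lemma near_id_inj: "near_id \<delta> W h \<Longrightarrow> \<delta> < 1 \<Longrightarrow> inj_on h W"
  using near_id_dist(2)[of \<delta> W h]
  by (intro inj_onI) (metis dist_eq_0_iff less_iff_diff_less_0 linorder_not_le mult_pos_pos zero_less_dist_iff diff_gt_0_iff_gt)

lemma near_id_continuous: "near_id \<delta> W h \<Longrightarrow> 0 \<le> \<delta> \<Longrightarrow> continuous_on W h"
  by (rule lipschitz_on_continuous_on[of "1 + \<delta>"])
     (auto intro!: lipschitz_onI near_id_dist)

lemma near_id_mono: "near_id \<delta> W h \<Longrightarrow> \<delta> \<le> \<epsilon> \<Longrightarrow> near_id \<epsilon> W h"
  unfolding near_id_def by (meson mult_right_mono norm_ge_zero order_trans)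

lemma near_id_inverse:
  assumes h: "near_id \<delta> W h" and d: "0 \<le> \<delta>" "\<delta> < 1"
  shows "near_id (\<delta> / (1 - \<delta>)) (h ` W) (inv_into W h)"
  unfolding near_id_def
proof (intro ballI)
  fix u v assume "u \<in> h ` W" "v \<in> h ` W"
  then obtain s t where st: "s \<in> W" "t \<in> W" "u = h s" "v = h t" by auto
  then have iv: "inv_into W h u = s" "inv_into W h v = t"
    using near_id_inj[OF h d(2)] by auto
  have "norm (s - t - (h s - h t)) \<le> \<delta> * norm (s - t)"
    using h st by (metis near_id_def norm_minus_commute)
  also have "\<dots> \<le> \<delta> / (1 - \<delta>) * norm (h s - h t)"
  proof -
    have "norm (s - t) \<le> norm (h s - h t) / (1 - \<delta>)"
      using near_id_dist(2)[OF h st(1,2)] d by (simp add: dist_norm field_simps)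
    from mult_left_mono[OF this d(1)] show ?thesis by simp
  qed
  finally show "norm (inv_into W h u - inv_into W h v - (u - v)) \<le> \<delta> / (1 - \<delta>) * norm (u - v)"
    using iv st by simp
qed

lemma near_id_compose:
  assumes f: "near_id \<delta> W f" and g: "near_id \<epsilon> V g" "g ` V \<subseteq> W" and "0 \<le> \<delta>"
  shows "near_id (\<epsilon> + \<delta> * (1 + \<epsilon>)) V (f \<circ> g)"
  unfolding near_id_def
proof (intro ballI)
  fix s t assume st: "s \<in> V" "t \<in> V"
  have "norm (f (g s) - f (g t) - (s - t)) \<le> norm (f (g s) - f (g t) - (g s - g t)) + norm (g s - g t - (s - t))"
    by (metis diff_add_cancel diff_diff_eq2 norm_triangle_ineq add_diff_eq)
  also have "\<dots> \<le> \<delta> * norm (g s - g t) + \<epsilon> * norm (s - t)"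
    using f g st by (intro add_mono) (auto simp: near_id_def image_subset_iff)
  also have "\<delta> * norm (g s - g t) \<le> \<delta> * ((1 + \<epsilon>) * norm (s - t))"
    using near_id_dist(1)[OF g(1) st] assms(4) by (intro mult_left_mono) (auto simp: dist_norm)
  finally show "norm ((f \<circ> g) s - (f \<circ> g) t - (s - t)) \<le> (\<epsilon> + \<delta> * (1 + \<epsilon>)) * norm (s - t)"
    by (simp add: algebra_simps)
qed

text \<open>
  The map is injective and continuous between subspaces of the same dimension, so it is open by invariance of domain.
\<close>

lemma near_id_openin:
  fixes h :: "'a::euclidean_space \<Rightarrow> 'a"
  assumes "subspace S" "openin (top_of_set S) W" "near_id \<delta> W h" "0 \<le> \<delta>" "\<delta> < 1" "h ` W \<subseteq> S"
  shows "openin (top_of_set S) (h ` W)"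
  by (rule invariance_of_domain_subspaces[OF assms(2,1,1)])
     (use assms near_id_inj near_id_continuous in auto)

definition sigma_compact :: "'a::topological_space set \<Rightarrow> bool" where
  "sigma_compact A \<longleftrightarrow> (\<exists>\<K>. countable \<K> \<and> (\<forall>K\<in>\<K>. compact K) \<and> A = \<Union>\<K>)"

lemma sigma_compact_borel: "sigma_compact A \<Longrightarrow> A \<in> sets borel" for A :: "'a::t2_space set"
  unfolding sigma_compact_def by (auto intro!: sets.countable_Union intro: borel_compact)

lemma sigma_compact_image: "sigma_compact A \<Longrightarrow> continuous_on A f \<Longrightarrow> sigma_compact (f ` A)"
proof -
  assume "sigma_compact A" "continuous_on A f"
  then obtain \<K> where K: "countable \<K>" "\<And>K. K \<in> \<K> \<Longrightarrow> compact K" "A = \<Union>\<K>"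
    unfolding sigma_compact_def by blast
  have "\<forall>K'\<in>(`) f ` \<K>. compact K'"
    using K \<open>continuous_on A f\<close> by (auto intro!: compact_continuous_image elim: continuous_on_subset)
  moreover have "f ` A = \<Union>((`) f ` \<K>)" using K(3) by auto
  ultimately show "sigma_compact (f ` A)"
    unfolding sigma_compact_def using K(1) by (intro exI[of _ "(`) f ` \<K>"]) auto
qed

lemma sigma_compact_countable_Union:
  assumes "countable \<A>" "\<And>A. A \<in> \<A> \<Longrightarrow> sigma_compact A"
  shows "sigma_compact (\<Union>\<A>)"
proof -
  have "\<forall>A\<in>\<A>. \<exists>\<K>. countable \<K> \<and> (\<forall>K\<in>\<K>. compact K) \<and> A = \<Union>\<K>"
    using assms(2) unfolding sigma_compact_def by blast
  then obtain k where k: "\<And>A. A \<in> \<A> \<Longrightarrow> countable (k A) \<and> (\<forall>K\<in>k A. compact K) \<and> A = \<Union>(k A)"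
    by metis
  have "\<Union>\<A> = \<Union>(\<Union>A\<in>\<A>. k A)" using k by blast
  then show ?thesis
    unfolding sigma_compact_def using k assms(1)
    by (intro exI[of _ "\<Union>A\<in>\<A>. k A"]) auto
qed

lemma sigma_compact_openin_subspace:
  fixes T :: "'a::euclidean_space set"
  assumes "subspace T" "openin (top_of_set T) W"
  shows "sigma_compact W"
proof -
  obtain V where V: "open V" "W = T \<inter> V" using assms(2) by (auto simp: openin_open)
  obtain D where D: "\<And>n::nat. compact (D n)" "(\<Union>n. D n) = V"
    using open_Union_compact_subsets[OF V(1)] by metis
  have "W = \<Union>(range (\<lambda>n. T \<inter> D n))" using V(2) D(2) by auto
  moreover have "compact (T \<inter> D n)" for n
    using closed_Int_compact[OF closed_subspace[OF assms(1)] D(1)] .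
  ultimately show ?thesis
    unfolding sigma_compact_def by (intro exI[of _ "range (\<lambda>n. T \<inter> D n)"]) auto
qed

text \<open>
  The image of \<open>Z\<close> is the preimage of \<open>Z\<close> under the continuous inverse, whose domain is \<open>\<sigma>\<close>-compact.
\<close>

lemma borel_image_near_id:
  fixes h :: "'a::euclidean_space \<Rightarrow> 'a"
  assumes S: "subspace S" and W: "openin (top_of_set S) W" and h: "near_id \<delta> W h" and d: "0 \<le> \<delta>" "\<delta> < 1"
    and Z: "Z \<subseteq> W" "Z \<in> sets borel"
  shows "h ` Z \<in> sets borel"
proof -
  have W': "h ` W \<in> sets borel"
    by (intro sigma_compact_borel sigma_compact_image sigma_compact_openin_subspace[OF S W] near_id_continuous[OF h d(1)])
  have "continuous_on (h ` W) (inv_into W h)"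
    by (rule near_id_continuous[OF near_id_inverse[OF h d]]) (use d in auto)
  then have "inv_into W h \<in> borel_measurable (restrict_space borel (h ` W))"
    by (rule borel_measurable_continuous_on_restrict)
  from measurable_sets[OF this Z(2)] have "inv_into W h -` Z \<inter> h ` W \<in> sets borel"
    using W' by (simp add: sets_restrict_space_iff space_restrict_space)
  also have "inv_into W h -` Z \<inter> h ` W = h ` Z"
    using near_id_inj[OF h d(2)] Z(1) by (auto simp: image_iff)
  finally show ?thesis .
qed

lemma borel_preimage_near_id:
  fixes f :: "'a::euclidean_space \<Rightarrow> 'a"
  assumes "subspace S" "openin (top_of_set S) W" "near_id \<delta> W f" "0 \<le> \<delta>" "A \<in> sets borel"
  shows "{w \<in> W. f w \<in> A} \<in> sets borel"
proof -
  have W: "W \<in> sets borel" by (rule openin_subspace_borel[OF assms(1,2)])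
  have "f \<in> borel_measurable (restrict_space borel W)"
    by (rule borel_measurable_continuous_on_restrict[OF near_id_continuous[OF assms(3,4)]])
  from measurable_sets[OF this assms(5)] have "f -` A \<inter> W \<in> sets borel"
    using W by (simp add: sets_restrict_space_iff space_restrict_space)
  then show ?thesis by (simp add: vimage_def Int_def conj_commute)
qed

text \<open>
  The second bound needs a Lipschitz map back from \<open>h ` Z\<close>.  Its covering balls have centres
  where the inverse of \<open>h\<close> is not defined; therefore \<open>h ` Z\<close> is first projected to \<open>S\<close>, which does not increase
  its measure, and the composition of \<open>h\<close> with the projection is again close to the identity and has relatively open range.
\<close>

lemma hausdorff_outer_near_id:
  fixes h :: "'a::euclidean_space \<Rightarrow> 'a"
  assumes S: "subspace S" and W: "openin (top_of_set S) W" and h: "near_id \<delta> W h" and d: "0 \<le> \<delta>" "\<delta> < 1"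
    and Z: "Z \<subseteq> W" "Z \<in> sets borel"
  shows "hausdorff_outer s (h ` Z) \<le> ennreal ((1 + \<delta>) powr s) * hausdorff_outer s Z"
    and "hausdorff_outer s Z \<le> ennreal ((1 / (1 - \<delta>)) powr s) * hausdorff_outer s (h ` Z)"
proof -
  show "hausdorff_outer s (h ` Z) \<le> ennreal ((1 + \<delta>) powr s) * hausdorff_outer s Z"
    by (rule hausdorff_outer_Lipschitz[OF S W]) (use d Z near_id_dist[OF h] in auto)
  let ?P = "orth_proj S" and ?g = "orth_proj S \<circ> h"
  interpret P: linear "?P" by (rule linear_orth_proj[OF S])
  have g: "near_id \<delta> W ?g"
    unfolding near_id_def
  proof (intro ballI)
    fix x y assume xy: "x \<in> W" "y \<in> W"
    then have "x \<in> S" "y \<in> S" using W by (auto simp: openin_open)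
    then have "?g x - ?g y - (x - y) = ?P (h x - h y - (x - y))"
      by (simp add: P.diff orth_proj_id[OF S])
    then have "norm (?g x - ?g y - (x - y)) \<le> norm (h x - h y - (x - y))"
      using norm_orth_proj_le[OF S] by simp
    also have "\<dots> \<le> \<delta> * norm (x - y)" using h xy by (simp add: near_id_def)
    finally show "norm (?g x - ?g y - (x - y)) \<le> \<delta> * norm (x - y)" .
  qed
  have gS: "?g ` W \<subseteq> S" using orth_proj_in[OF S] by auto
  let ?k = "inv_into W ?g"
  have "Z = ?k ` (?g ` Z)"
    using near_id_inj[OF g d(2)] Z(1) by (metis inv_into_image_cancel)
  then have "hausdorff_outer s Z = hausdorff_outer s (?k ` (?g ` Z))" by simp
  also have "\<dots> \<le> ennreal ((1 / (1 - \<delta>)) powr s) * hausdorff_outer s (?g ` Z)"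
  proof (rule hausdorff_outer_Lipschitz[OF S near_id_openin[OF S W g d gS]])
    show "?g ` Z \<in> sets borel" by (rule borel_image_near_id[OF S W g d Z])
    fix u v assume "u \<in> ?g ` W" "v \<in> ?g ` W"
    moreover have "1 + \<delta> / (1 - \<delta>) = 1 / (1 - \<delta>)" using d by (simp add: field_simps)
    ultimately show "dist (?k u) (?k v) \<le> 1 / (1 - \<delta>) * dist u v"
      using near_id_dist(1)[OF near_id_inverse[OF g d]] by metis
  qed (use d Z in auto)
  also have "hausdorff_outer s (?g ` Z) \<le> ennreal (1 powr s) * hausdorff_outer s (h ` Z)"
    unfolding image_comp[symmetric]
    by (rule hausdorff_outer_Lipschitz_UNIV)
       (auto simp: dist_norm P.diff[symmetric] norm_orth_proj_le[OF S])
  finally show "hausdorff_outer s Z \<le> ennreal ((1 / (1 - \<delta>)) powr s) * hausdorff_outer s (h ` Z)"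
    by (simp add: mult_left_mono)
qed

section \<open>Hausdorff measure on a linear subspace is Lebesgue measure\<close>

text \<open>
  The proof of the uniqueness of Haar measure: integrate
  \<open>indicator A x * indicator B (y - x)\<close> against \<open>\<mu>\<close> and \<open>\<nu>\<close> in both orders, translating the inner variable each time.
\<close>

lemma translation_invariant_measures_proportional:
  fixes \<mu> \<nu> :: "'a::euclidean_space measure"
  assumes sets [measurable_cong]: "sets \<mu> = sets borel" "sets \<nu> = sets borel"
    and fin: "sigma_finite_measure \<mu>" "sigma_finite_measure \<nu>"
    and T: "subspace T" "AE x in \<mu>. x \<in> T" "AE x in \<nu>. x \<in> T"
    and inv: "\<And>t A. t \<in> T \<Longrightarrow> A \<in> sets borel \<Longrightarrow> emeasure \<mu> ((\<lambda>x. x + t) -` A) = emeasure \<mu> A"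
      "\<And>t A. t \<in> T \<Longrightarrow> A \<in> sets borel \<Longrightarrow> emeasure \<nu> ((\<lambda>x. x + t) -` A) = emeasure \<nu> A"
    and A [measurable]: "A \<in> sets borel" and B [measurable]: "B \<in> sets borel"
  shows "emeasure \<mu> A * emeasure \<nu> B = emeasure \<nu> A * emeasure \<mu> (uminus -` B)"
proof -
  interpret P: pair_sigma_finite \<mu> \<nu> using fin by (simp add: pair_sigma_finite_def)
  have distr: "distr M borel (\<lambda>x. x + t) = M"
    if M: "sets M = sets borel" and "\<And>A. A \<in> sets borel \<Longrightarrow> emeasure M ((\<lambda>x. x + t) -` A) = emeasure M A"
    for M :: "'a measure" and t
  proof (rule measure_eqI)
    fix A assume "A \<in> sets (distr M borel (\<lambda>x. x + t))"
    moreover have "(\<lambda>x. x + t) \<in> measurable M borel" using M by measurable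
    ultimately show "emeasure (distr M borel (\<lambda>x. x + t)) A = emeasure M A"
      using that sets_eq_imp_space_eq[OF M] by (simp add: emeasure_distr)
  qed (simp add: M)
  have shift: "(\<integral>\<^sup>+x. g (x + t) \<partial>M) = (\<integral>\<^sup>+x. g x \<partial>M)"
    if M: "sets M = sets borel" and "\<And>A. A \<in> sets borel \<Longrightarrow> emeasure M ((\<lambda>x. x + t) -` A) = emeasure M A"
     and [measurable]: "g \<in> borel_measurable borel" for M :: "'a measure" and t g
  proof -
    have [measurable]: "(\<lambda>x. x + t) \<in> measurable M borel" using M by measurable
    have "(\<integral>\<^sup>+x. g (x + t) \<partial>M) = (\<integral>\<^sup>+x. g x \<partial>distr M borel (\<lambda>x. x + t))"
      by (simp add: nn_integral_distr)
    then show ?thesis using distr[OF that(1,2)] by simp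
  qed
  have sp: "space \<mu> = UNIV" "space \<nu> = UNIV" using sets sets_eq_imp_space_eq[of \<mu> borel] sets_eq_imp_space_eq[of \<nu> borel] by auto
  have "emeasure \<mu> A * emeasure \<nu> B = (\<integral>\<^sup>+x. indicator A x * emeasure \<nu> B \<partial>\<mu>)"
    by (subst nn_integral_multc) auto
  also have "\<dots> = (\<integral>\<^sup>+x. \<integral>\<^sup>+y. indicator A x * indicator B (y - x) \<partial>\<nu> \<partial>\<mu>)"
  proof (rule nn_integral_cong_AE)
    show "AE x in \<mu>. indicator A x * emeasure \<nu> B = (\<integral>\<^sup>+y. indicator A x * indicator B (y - x) \<partial>\<nu>)"
      using T(2)
    proof eventually_elim
      case (elim x)
      then have "- x \<in> T" using T(1) by (simp add: subspace_neg)
      then have "emeasure \<nu> B = (\<integral>\<^sup>+y. indicator B (y + - x) \<partial>\<nu>)"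
        by (subst shift[OF sets(2) inv(2)]) auto
      then show ?case by (simp add: nn_integral_cmult)
    qed
  qed
  also have "\<dots> = (\<integral>\<^sup>+y. \<integral>\<^sup>+x. indicator A x * indicator B (y - x) \<partial>\<mu> \<partial>\<nu>)"
    by (rule P.Fubini'[symmetric]) measurable
  also have "\<dots> = (\<integral>\<^sup>+y. \<integral>\<^sup>+x. indicator A (x + y) * indicator B (- x) \<partial>\<mu> \<partial>\<nu>)"
  proof (rule nn_integral_cong_AE)
    show "AE y in \<nu>. (\<integral>\<^sup>+x. indicator A x * indicator B (y - x) \<partial>\<mu>) = (\<integral>\<^sup>+x. indicator A (x + y) * indicator B (- x) \<partial>\<mu>)"
      using T(3)
    proof eventually_elim
      case (elim y)
      have "(\<integral>\<^sup>+x. indicator A (x + y) * indicator B (y - (x + y)) \<partial>\<mu>) = (\<integral>\<^sup>+x. indicator A x * indicator B (y - x) \<partial>\<mu>)"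
        by (rule shift[OF sets(1) inv(1)[OF elim]]) auto
      then show ?case by simp
    qed
  qed
  also have "\<dots> = (\<integral>\<^sup>+x. \<integral>\<^sup>+y. indicator A (x + y) * indicator B (- x) \<partial>\<nu> \<partial>\<mu>)"
    by (rule P.Fubini') measurable
  also have "\<dots> = (\<integral>\<^sup>+x. emeasure \<nu> A * indicator (uminus -` B) x \<partial>\<mu>)"
  proof (rule nn_integral_cong_AE)
    show "AE x in \<mu>. (\<integral>\<^sup>+y. indicator A (x + y) * indicator B (- x) \<partial>\<nu>) = emeasure \<nu> A * indicator (uminus -` B) x"
      using T(2)
    proof eventually_elim
      case (elim x)
      have "emeasure \<nu> A = (\<integral>\<^sup>+y. indicator A (y + x) \<partial>\<nu>)"
        by (subst shift[OF sets(2) inv(2)[OF elim]]) auto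
      moreover have "indicator B (- x) = (indicator (uminus -` B) x :: ennreal)" by (simp add: indicator_def)
      ultimately show ?case by (simp add: nn_integral_multc add.commute)
    qed
  qed
  also have "\<dots> = emeasure \<nu> A * emeasure \<mu> (uminus -` B)"
    using measurable_sets[of "uminus :: 'a \<Rightarrow> 'a" borel borel B] by (subst nn_integral_cmult) (auto simp: sets)
  finally show ?thesis .
qed

lemma sigma_finite_of_finite_on_balls:
  fixes \<mu> :: "'a::real_normed_vector measure"
  assumes sets: "sets \<mu> = sets borel" and fin: "\<And>R. emeasure \<mu> (cball 0 R) < top"
  shows "sigma_finite_measure \<mu>"
proof
  let ?C = "range (\<lambda>n. cball (0::'a) (real n))"
  have "x \<in> \<Union>?C" for x :: 'a
  proof -
    obtain n where "norm x \<le> real n" using real_arch_simple by blast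
    then show ?thesis by (intro UnionI[of "cball 0 (real n)"]) auto
  qed
  moreover have "emeasure \<mu> (cball 0 (real n)) \<noteq> \<infinity>" for n
    using fin[of "real n"] by simp
  ultimately show "\<exists>A. countable A \<and> A \<subseteq> sets \<mu> \<and> \<Union>A = space \<mu> \<and> (\<forall>a\<in>A. emeasure \<mu> a \<noteq> \<infinity>)"
    using sets_eq_imp_space_eq[OF sets] by (intro exI[of _ ?C]) (auto simp: sets)
qed

lemma borel_vimage_translation:
  "A \<in> sets borel \<Longrightarrow> (\<lambda>x. x + t) -` A \<in> sets borel" for t :: "'a::real_normed_vector"
  using measurable_sets[of "\<lambda>x. x + t" borel borel A]
  by (simp add: borel_measurable_continuous_onI continuous_intros)

text \<open>
  For an orthonormal set \<open>B\<close> this is Lebesgue measure on \<open>span B\<close>.  A product over a finite index set is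
  used because the dimension of the subspace is not the dimension of a type.
\<close>

definition leb_span :: "'a::euclidean_space set \<Rightarrow> 'a measure" where
  "leb_span B = distr (\<Pi>\<^sub>M b\<in>B. lborel) borel (\<lambda>f. \<Sum>b\<in>B. f b *\<^sub>R b)"

lemma sets_leb_span [simp, measurable_cong]: "sets (leb_span B) = sets borel"
  by (simp add: leb_span_def)

lemma space_leb_span [simp]: "space (leb_span B) = UNIV"
  by (simp add: leb_span_def)

lemma measurable_leb_span_map [measurable]:
  "(\<lambda>f. \<Sum>b\<in>B. f b *\<^sub>R b) \<in> borel_measurable (\<Pi>\<^sub>M b\<in>B. lborel :: real measure)"
  for B :: "'a::euclidean_space set"
  by (intro borel_measurable_sum borel_measurable_scaleR) (auto intro: measurable_component_singleton)

lemma emeasure_leb_span: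
  "A \<in> sets borel \<Longrightarrow> emeasure (leb_span B) A =
     emeasure (\<Pi>\<^sub>M b\<in>B. lborel) ((\<lambda>f. \<Sum>b\<in>B. f b *\<^sub>R b) -` A \<inter> space (\<Pi>\<^sub>M b\<in>B. lborel))"
  by (simp add: leb_span_def emeasure_distr)

locale orthonormal_set =
  fixes B :: "'a::euclidean_space set"
  assumes finite_B [simp]: "finite B" and norm_B: "\<And>b. b \<in> B \<Longrightarrow> norm b = 1"
    and orth_B: "pairwise orthogonal B"
begin

sublocale product_sigma_finite "\<lambda>_::'a. lborel :: real measure"
  by standard

lemma expansion:
  shows "b \<in> B \<Longrightarrow> (\<Sum>c\<in>B. f c *\<^sub>R c) \<bullet> b = f b"
    and "norm (\<Sum>c\<in>B. f c *\<^sub>R c) = sqrt (\<Sum>c\<in>B. (f c)\<^sup>2)"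
    and "x \<in> span B \<Longrightarrow> (\<Sum>c\<in>B. (x \<bullet> c) *\<^sub>R c) = x"
  using orthonormal_expansion[OF finite_B norm_B orth_B] by auto

lemma combination_in_span: "(\<Sum>b\<in>B. f b *\<^sub>R b) \<in> span B"
  by (intro span_sum span_scale span_base)

lemma borel_span [measurable]: "span B \<in> sets borel"
  by (simp add: closed_subspace)

lemma AE_leb_span: "AE x in leb_span B. x \<in> span B"
  unfolding leb_span_def
  by (subst AE_distr_iff) (auto simp: combination_in_span)

lemma leb_span_translation:
  assumes t: "t \<in> span B" and A: "A \<in> sets borel"
  shows "emeasure (leb_span B) ((\<lambda>x. x + t) -` A) = emeasure (leb_span B) A"
proof -
  let ?P = "\<Pi>\<^sub>M b\<in>B. lborel :: real measure"
  let ?g = "\<lambda>f :: 'a \<Rightarrow> real. \<lambda>b\<in>B. t \<bullet> b + f b"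
  have g [measurable]: "?g \<in> measurable ?P ?P"
    by (intro measurable_restrict) (auto intro!: borel_measurable_add measurable_component_singleton)
  have inv: "distr ?P ?P ?g = ?P"
  proof (rule PiM_eqI[OF finite_B])
    fix A :: "'a \<Rightarrow> real set" assume A: "\<And>b. b \<in> B \<Longrightarrow> A b \<in> sets lborel"
    have m: "(+) (t \<bullet> b) -` A b \<in> sets lborel" if "b \<in> B" for b
      using A[OF that] measurable_sets[of "(+) (t \<bullet> b)" lborel borel "A b"] by simp
    have "emeasure (distr ?P ?P ?g) (Pi\<^sub>E B A) = emeasure ?P (?g -` Pi\<^sub>E B A \<inter> space ?P)"
      using A by (subst emeasure_distr) (auto intro!: sets_PiM_I_finite)
    also have "?g -` Pi\<^sub>E B A \<inter> space ?P = Pi\<^sub>E B (\<lambda>b. (+) (t \<bullet> b) -` A b)"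
      by (auto simp: space_PiM PiE_iff)
    also have "emeasure ?P \<dots> = (\<Prod>b\<in>B. emeasure lborel ((+) (t \<bullet> b) -` A b))"
      by (rule emeasure_PiM) (use m in auto)
    also have "\<dots> = (\<Prod>b\<in>B. emeasure lborel (A b))"
    proof (rule prod.cong[OF refl])
      fix b assume b: "b \<in> B"
      have "emeasure lborel (A b) = emeasure (distr lborel borel ((+) (t \<bullet> b))) (A b)"
        by (simp add: lborel_distr_plus)
      also have "\<dots> = emeasure lborel ((+) (t \<bullet> b) -` A b)"
        using A[OF b] by (subst emeasure_distr) auto
      finally show "emeasure lborel ((+) (t \<bullet> b) -` A b) = emeasure lborel (A b)" by simp
    qed
    finally show "emeasure (distr ?P ?P ?g) (Pi\<^sub>E B A) = (\<Prod>b\<in>B. emeasure lborel (A b))" .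
  qed simp
  let ?s = "\<lambda>f. \<Sum>b\<in>B. f b *\<^sub>R b"
  have st: "?s (?g f) = ?s f + t" for f
  proof -
    have "?s (?g f) = ?s f + (\<Sum>b\<in>B. (t \<bullet> b) *\<^sub>R b)"
      by (simp add: scaleR_add_left sum.distrib add.commute)
    then show ?thesis using expansion(3)[OF t] by simp
  qed
  have sA: "?s -` A \<inter> space ?P \<in> sets ?P" using A by measurable
  have tA: "(\<lambda>x. x + t) -` A \<in> sets borel" using A by (rule borel_vimage_translation)
  have "emeasure (leb_span B) A = emeasure ?P (?s -` A \<inter> space ?P)"
    using A by (rule emeasure_leb_span)
  also have "\<dots> = emeasure (distr ?P ?P ?g) (?s -` A \<inter> space ?P)" by (simp add: inv)
  also have "\<dots> = emeasure ?P (?g -` (?s -` A \<inter> space ?P) \<inter> space ?P)"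
    by (rule emeasure_distr[OF g sA])
  also have "?g -` (?s -` A \<inter> space ?P) \<inter> space ?P = ?s -` ((\<lambda>x. x + t) -` A) \<inter> space ?P"
    using st measurable_space[OF g] by auto
  also have "emeasure ?P \<dots> = emeasure (leb_span B) ((\<lambda>x. x + t) -` A)"
    using tA by (rule emeasure_leb_span[symmetric])
  finally show ?thesis by simp
qed

lemma leb_span_cball:
  assumes "p \<in> span B" "r > 0"
  shows "emeasure (leb_span B) (cball p r) = ennreal (unit_ball_vol (real (card B)) * r ^ card B)"
proof -
  have "emeasure (leb_span B) (cball p r) = emeasure (leb_span B) ((\<lambda>x. x + p) -` cball p r)"
    using leb_span_translation[OF assms(1)] by simp
  also have "(\<lambda>x. x + p) -` cball p r = cball 0 r"
    by (auto simp: dist_norm)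
  also have "emeasure (leb_span B) (cball 0 r) =
    emeasure (\<Pi>\<^sub>M b\<in>B. lborel) ({f. sqrt (\<Sum>b\<in>B. (f b)\<^sup>2) \<le> r} \<inter> space (\<Pi>\<^sub>M b\<in>B. lborel))"
    by (subst emeasure_leb_span) (auto simp: expansion(2) intro!: arg_cong2[where f=emeasure])
  also have "\<dots> = ennreal (unit_ball_vol (real (card B)) * r ^ card B)"
    using assms(2) by (rule emeasure_cball_aux[OF finite_B])
  finally show ?thesis .
qed

lemma leb_span_ball:
  assumes p: "p \<in> span B" and r: "r > 0"
  shows "emeasure (leb_span B) (ball p r) = ennreal (unit_ball_vol (real (card B)) * r ^ card B)"
proof (rule antisym)
  have "emeasure (leb_span B) (ball p r) \<le> emeasure (leb_span B) (cball p r)"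
    by (rule emeasure_mono) auto
  then show "emeasure (leb_span B) (ball p r) \<le> ennreal (unit_ball_vol (real (card B)) * r ^ card B)"
    using leb_span_cball[OF assms] by simp
  have "(\<lambda>n. r * (1 - 1 / real (Suc (Suc n)))) \<longlonglongrightarrow> r * (1 - 0)"
    using LIMSEQ_Suc[OF LIMSEQ_inverse_real_of_nat]
    by (intro tendsto_intros) (simp add: inverse_eq_divide)
  then have lim: "(\<lambda>n. ennreal (unit_ball_vol (real (card B)) * (r * (1 - 1 / real (Suc (Suc n)))) ^ card B))
     \<longlonglongrightarrow> ennreal (unit_ball_vol (real (card B)) * r ^ card B)"
    by (intro tendsto_ennrealI tendsto_intros) simp
  have "ennreal (unit_ball_vol (real (card B)) * (r * (1 - 1 / real (Suc (Suc n)))) ^ card B) \<le> emeasure (leb_span B) (ball p r)" for n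
  proof -
    have lt: "0 < r * (1 - 1 / real (Suc (Suc n)))" "r * (1 - 1 / real (Suc (Suc n))) < r"
      using r by (auto intro!: mult_pos_pos)
    have "emeasure (leb_span B) (cball p (r * (1 - 1 / real (Suc (Suc n))))) \<le> emeasure (leb_span B) (ball p r)"
      by (rule emeasure_mono) (use lt in auto)
    then show ?thesis using leb_span_cball[OF p lt(1)] by simp
  qed
  then show "ennreal (unit_ball_vol (real (card B)) * r ^ card B) \<le> emeasure (leb_span B) (ball p r)"
    by (intro LIMSEQ_le_const2[OF lim]) auto
qed

lemma leb_span_sigma_finite: "sigma_finite_measure (leb_span B)"
proof (rule sigma_finite_of_finite_on_balls)
  fix R :: real
  have "emeasure (leb_span B) (cball 0 R) \<le> emeasure (leb_span B) (cball 0 (max R 1))"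
    by (rule emeasure_mono) auto
  also have "\<dots> < top" using leb_span_cball[of 0 "max R 1"] by (simp add: span_zero)
  finally show "emeasure (leb_span B) (cball 0 R) < top" .
qed simp

lemma leb_span_ball_le:
  assumes "r > 0"
  shows "emeasure (leb_span B) (ball x r) \<le> ennreal (unit_ball_vol (real (card B)) * r ^ card B)"
proof -
  have "y \<in> ball (orth_proj (span B) x) r" if "y \<in> span B" "y \<in> ball x r" for y
    using orth_proj_nearest[OF subspace_span that(1), of x] that(2) by auto
  then have "AE y in leb_span B. y \<in> ball x r \<longrightarrow> y \<in> ball (orth_proj (span B) x) r"
    by (intro eventually_mono[OF AE_leb_span]) blast
  then have "emeasure (leb_span B) (ball x r) \<le> emeasure (leb_span B) (ball (orth_proj (span B) x) r)"
    by (rule emeasure_mono_AE) simp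
  also have "\<dots> = ennreal (unit_ball_vol (real (card B)) * r ^ card B)"
    by (rule leb_span_ball[OF orth_proj_in assms]) (rule subspace_span)
  finally show ?thesis .
qed


text \<open>
  A ball of radius \<open>r\<close> meets \<open>span B\<close> in at most the Lebesgue measure of a centred ball, which is the
  weight that the covering sum gives it.
\<close>

lemma leb_span_le_hausdorff:
  assumes A: "A \<in> sets borel"
  shows "emeasure (leb_span B) A \<le> \<H> (card B) A"
proof -
  let ?v = "ennreal (unit_ball_vol (real (card B)))"
  have "emeasure (leb_span B) A \<le> ?v * cover_sum (real (card B)) C" if C: "C \<in> ball_covers 1 A" for C
  proof (cases "C = {}")
    case True
    then show ?thesis using C by (auto simp: ball_covers_def)
  next
    case False
    have cC: "countable C" and pos: "\<And>x r. (x, r) \<in> C \<Longrightarrow> 0 < r"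
      using C by (auto simp: ball_covers_def)
    define U where "U F = (\<Union>(x, r)\<in>F. ball x r)" for F :: "('a \<times> real) set"
    have UF: "emeasure (leb_span B) (U F) \<le> ?v * cover_sum (real (card B)) C" if F: "finite F" "F \<subseteq> C" for F
    proof -
      have "emeasure (leb_span B) (U F) \<le> (\<Sum>c\<in>F. emeasure (leb_span B) (case c of (x, r) \<Rightarrow> ball x r))"
        unfolding U_def using F by (intro emeasure_subadditive_finite) auto
      also have "\<dots> \<le> (\<Sum>c\<in>F. ?v * (case c of (x, r) \<Rightarrow> ennreal (r powr real (card B))))"
      proof (rule sum_mono)
        fix c assume "c \<in> F"
        then obtain x r where c: "c = (x, r)" "0 < r" using F pos by (cases c) auto
        then show "emeasure (leb_span B) (case c of (x, r) \<Rightarrow> ball x r) \<le> ?v * (case c of (x, r) \<Rightarrow> ennreal (r powr real (card B)))"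
          using leb_span_ball_le[OF c(2), of x] by (simp add: powr_realpow ennreal_mult)
      qed
      also have "\<dots> = ?v * (\<Sum>c\<in>F. case c of (x, r) \<Rightarrow> ennreal (r powr real (card B)))"
        by (rule sum_distrib_left[symmetric])
      also have "\<dots> \<le> ?v * cover_sum (real (card B)) C"
        unfolding cover_sum_def using F
        by (subst nonneg_infsum_complete) (auto intro!: mult_left_mono SUP_upper split: prod.split)
      finally show ?thesis .
    qed
    have R: "range (from_nat_into C) = C" using False cC by (rule range_from_nat_into)
    have "A \<subseteq> U C" using C by (auto simp: ball_covers_def U_def)
    also have "U C = (\<Union>n. U (from_nat_into C ` {..<n}))"
    proof -
      have "(\<Union>n. \<Union>i\<in>from_nat_into C ` {..<n}. g i) = (\<Union>i\<in>range (from_nat_into C). g i)" for g :: "('a \<times> real) \<Rightarrow> 'a set"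
        by (auto intro: lessI)
      then show ?thesis using R unfolding U_def by simp
    qed
    finally have "emeasure (leb_span B) A \<le> emeasure (leb_span B) (\<Union>n. U (from_nat_into C ` {..<n}))"
      by (intro emeasure_mono) (auto simp: U_def split: prod.split)
    also have "\<dots> = (SUP n. emeasure (leb_span B) (U (from_nat_into C ` {..<n})))"
    proof (rule SUP_emeasure_incseq[symmetric])
      show "range (\<lambda>n. U (from_nat_into C ` {..<n})) \<subseteq> sets (leb_span B)"
        by (auto simp: U_def split: prod.split)
      show "incseq (\<lambda>n. U (from_nat_into C ` {..<n}))"
        unfolding U_def by (intro monoI UN_mono image_mono) auto
    qed
    also have "\<dots> \<le> ?v * cover_sum (real (card B)) C"
      by (intro SUP_least UF) (use R in auto)
    finally show ?thesis .
  qed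
  note * = this
  have v: "?v * ennreal (1 / unit_ball_vol (real (card B))) = 1"
    using unit_ball_vol_pos[of "real (card B)"] by (simp add: ennreal_mult'[symmetric] del: unit_ball_vol_pos)
  have "ennreal (1 / unit_ball_vol (real (card B))) * emeasure (leb_span B) A \<le> hausdorff_pre (real (card B)) 1 A"
    unfolding hausdorff_pre_def
  proof (rule INF_greatest)
    fix C assume "C \<in> ball_covers 1 A"
    from mult_left_mono[OF *[OF this], of "ennreal (1 / unit_ball_vol (real (card B)))"] v
    show "ennreal (1 / unit_ball_vol (real (card B))) * emeasure (leb_span B) A \<le> cover_sum (real (card B)) C"
      by (simp add: mult.assoc[symmetric] mult.commute[of "ennreal (1 / unit_ball_vol (real (card B)))"])
  qed
  from mult_left_mono[OF this, of ?v] v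
  have "emeasure (leb_span B) A \<le> ?v * hausdorff_pre (real (card B)) 1 A"
    by (simp add: mult.assoc[symmetric])
  also have "\<dots> \<le> \<H> (card B) A" by (rule hausdorff_pre_le_outer) simp
  finally show ?thesis .
qed

definition unit_cube :: "'a set" where
  "unit_cube = {x \<in> span B. \<forall>b\<in>B. 0 \<le> x \<bullet> b \<and> x \<bullet> b < 1}"

lemma borel_unit_cube [measurable]: "unit_cube \<in> sets borel"
proof -
  have "{x \<in> space borel. \<forall>b\<in>B. 0 \<le> x \<bullet> b \<and> x \<bullet> b < 1} \<in> sets borel"
    by (intro sets.sets_Collect_finite_All) auto
  moreover have "unit_cube = span B \<inter> {x \<in> space borel. \<forall>b\<in>B. 0 \<le> x \<bullet> b \<and> x \<bullet> b < 1}"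
    by (auto simp: unit_cube_def)
  ultimately show ?thesis by simp
qed

lemma leb_span_unit_cube: "emeasure (leb_span B) unit_cube = 1"
proof -
  have "(\<lambda>f. \<Sum>b\<in>B. f b *\<^sub>R b) -` unit_cube \<inter> space (\<Pi>\<^sub>M b\<in>B. lborel :: real measure) = Pi\<^sub>E B (\<lambda>_. {0..<1})"
    by (auto simp: space_PiM unit_cube_def expansion(1) combination_in_span PiE_iff)
  then have "emeasure (leb_span B) unit_cube = emeasure (\<Pi>\<^sub>M b\<in>B. lborel) (Pi\<^sub>E B (\<lambda>_. {0..<1::real}))"
    by (simp add: emeasure_leb_span)
  also have "\<dots> = (\<Prod>b\<in>B. emeasure lborel {0..<1::real})"
    by (rule emeasure_PiM) auto
  finally show ?thesis by simp
qed

definition grid :: "nat \<Rightarrow> ('a \<Rightarrow> nat) set" where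
  "grid N = Pi\<^sub>E B (\<lambda>_. {..<N})"

text \<open>
  The midpoint of the cell \<open>g\<close> when \<open>unit_cube\<close> is divided into \<open>N ^ card B\<close> cells.
\<close>

definition grid_point :: "nat \<Rightarrow> ('a \<Rightarrow> nat) \<Rightarrow> 'a" where
  "grid_point N g = (\<Sum>b\<in>B. ((real (g b) + 1 / 2) / real N) *\<^sub>R b)"

lemma finite_grid: "finite (grid N)" and card_grid: "card (grid N) = N ^ card B"
  by (auto simp: grid_def finite_PiE card_PiE)

lemma grid_point_in_span: "grid_point N g \<in> span B"
  unfolding grid_point_def by (rule combination_in_span)

lemma hausdorff_pre_grid_balls:
  assumes "N > 0" "\<rho> > 0" "\<rho> \<le> \<epsilon>" "A \<subseteq> (\<Union>g\<in>grid N. ball (grid_point N g) \<rho>)"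
  shows "hausdorff_pre (real (card B)) \<epsilon> A \<le> ennreal ((real N * \<rho>) ^ card B)"
proof -
  let ?C = "(\<lambda>g. (grid_point N g, \<rho>)) ` grid N"
  have "?C \<in> ball_covers \<epsilon> A"
    using assms finite_grid[of N] by (auto simp: ball_covers_def intro: countable_finite)
  then have "hausdorff_pre (real (card B)) \<epsilon> A \<le> cover_sum (real (card B)) ?C"
    unfolding hausdorff_pre_def by (rule INF_lower)
  also have "\<dots> \<le> infsum (\<lambda>g. ennreal (\<rho> powr real (card B))) (grid N)"
    unfolding cover_sum_def by (rule order_trans[OF infsum_ennreal_image_le]) simp
  also have "\<dots> = of_nat (N ^ card B) * ennreal (\<rho> ^ card B)"
    using finite_grid[of N] assms(2) by (simp add: card_grid powr_realpow)
  also have "\<dots> = ennreal ((real N * \<rho>) ^ card B)"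
    by (simp add: ennreal_of_nat_eq_real_of_nat ennreal_mult'[symmetric] power_mult_distrib)
  finally show ?thesis .
qed

lemma unit_cube_subset_grid_balls:
  assumes N: "N > 0"
  shows "unit_cube \<subseteq> (\<Union>g\<in>grid N. ball (grid_point N g) (real (card B + 1) / real N))"
proof
  fix x assume x: "x \<in> unit_cube"
  define g where "g = (\<lambda>b\<in>B. nat \<lfloor>real N * (x \<bullet> b)\<rfloor>)"
  have gb: "real (g b) \<le> real N * (x \<bullet> b)" "real N * (x \<bullet> b) < real (g b) + 1" if "b \<in> B" for b
  proof -
    have "0 \<le> real N * (x \<bullet> b)" using x that by (auto simp: unit_cube_def)
    then have "real (g b) = of_int \<lfloor>real N * (x \<bullet> b)\<rfloor>" using that by (simp add: g_def)
    then show "real (g b) \<le> real N * (x \<bullet> b)" "real N * (x \<bullet> b) < real (g b) + 1" by linarith+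
  qed
  have "g \<in> grid N"
  proof -
    have "g b < N" if b: "b \<in> B" for b
    proof -
      have "real N * (x \<bullet> b) < real N * 1" using x b N by (intro mult_strict_left_mono) (auto simp: unit_cube_def)
      then show ?thesis using gb(1)[OF b] by simp
    qed
    then show ?thesis by (auto simp: grid_def g_def PiE_iff)
  qed
  moreover have "dist (grid_point N g) x < real (card B + 1) / real N"
  proof -
    have "x = (\<Sum>b\<in>B. (x \<bullet> b) *\<^sub>R b)" using x expansion(3)[of x] by (simp add: unit_cube_def)
    then have "grid_point N g - x = (\<Sum>b\<in>B. ((real (g b) + 1 / 2) / real N - x \<bullet> b) *\<^sub>R b)"
      by (simp add: grid_point_def scaleR_diff_left sum_subtractf)
    then have "dist (grid_point N g) x \<le> (\<Sum>b\<in>B. norm (((real (g b) + 1 / 2) / real N - x \<bullet> b) *\<^sub>R b))"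
      by (simp only: dist_norm norm_sum)
    also have "\<dots> \<le> (\<Sum>b\<in>B. 1 / real N)"
    proof (rule sum_mono)
      fix b assume b: "b \<in> B"
      have "\<bar>(real (g b) + 1 / 2) / real N - x \<bullet> b\<bar> = \<bar>(real (g b) + 1 / 2) - real N * (x \<bullet> b)\<bar> / real N"
      proof -
        have "(real (g b) + 1 / 2) / real N - x \<bullet> b = ((real (g b) + 1 / 2) - real N * (x \<bullet> b)) / real N"
          using N by (simp add: diff_divide_distrib)
        then show ?thesis by (simp only: abs_divide abs_of_nat)
      qed
      also have "\<dots> \<le> 1 / real N" using gb[OF b] N by (intro divide_right_mono) auto
      finally show "norm (((real (g b) + 1 / 2) / real N - x \<bullet> b) *\<^sub>R b) \<le> 1 / real N"
        by (simp add: norm_B[OF b])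
    qed
    also have "\<dots> < real (card B + 1) / real N" using N by (simp add: field_simps)
    finally show ?thesis .
  qed
  ultimately show "x \<in> (\<Union>g\<in>grid N. ball (grid_point N g) (real (card B + 1) / real N))" by auto
qed

lemma hausdorff_unit_cube_finite: "\<H> (card B) unit_cube < top"
proof -
  have "\<H> (card B) unit_cube \<le>
     ennreal (unit_ball_vol (real (card B))) * ennreal ((real (card B + 1)) ^ card B)"
  proof (rule hausdorff_outer_leI, rule mult_left_mono)
    fix \<epsilon> :: real assume e: "\<epsilon> > 0"
    obtain N :: nat where N: "real (card B + 1) / \<epsilon> < real N" using reals_Archimedean2 by blast
    then have N0: "N > 0" using e by (metis divide_nonneg_pos not_gr_zero not_le of_nat_0 of_nat_0_le_iff)
    have "hausdorff_pre (real (card B)) \<epsilon> unit_cube \<le> ennreal ((real N * (real (card B + 1) / real N)) ^ card B)"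
      by (rule hausdorff_pre_grid_balls[OF N0 _ _ unit_cube_subset_grid_balls[OF N0]])
         (use N N0 e in \<open>auto simp: field_simps\<close>)
    then show "hausdorff_pre (real (card B)) \<epsilon> unit_cube \<le> ennreal ((real (card B + 1)) ^ card B)"
      using N0 by simp
  qed simp
  also have "\<dots> < top" by (simp add: ennreal_mult_less_top)
  finally show ?thesis .
qed

lemma hausdorff_cball_span_finite: "\<H> (card B) (span B \<inter> cball 0 R) < top"
proof -
  \<comment> \<open>an affine image of the unit cube that contains the ball\<close>
  define n where "n = max R 1"
  have n: "n \<ge> R" "n \<ge> 1" by (auto simp: n_def)
  define e where "e = (\<Sum>b\<in>B. 1 *\<^sub>R b)"
  have eb: "e \<bullet> b = 1" if "b \<in> B" for b unfolding e_def using expansion(1)[OF that, of "\<lambda>_. 1"] by simp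
  have eS: "e \<in> span B" unfolding e_def by (rule combination_in_span)
  define f where "f q = (4 * n) *\<^sub>R q - (2 * n) *\<^sub>R e" for q
  have "span B \<inter> cball 0 R \<subseteq> f ` unit_cube"
  proof
    fix x assume x: "x \<in> span B \<inter> cball 0 R"
    let ?q = "(1 / (4 * n)) *\<^sub>R (x + (2 * n) *\<^sub>R e)"
    have "?q \<in> unit_cube"
      unfolding unit_cube_def
    proof (intro CollectI conjI ballI)
      show "?q \<in> span B" using x eS by (intro span_scale span_add) auto
      fix b assume b: "b \<in> B"
      have "\<bar>x \<bullet> b\<bar> \<le> norm x * norm b" by (rule Cauchy_Schwarz_ineq2)
      then have "\<bar>x \<bullet> b\<bar> \<le> n" using x n norm_B[OF b] by simp
      then show "0 \<le> ?q \<bullet> b" "?q \<bullet> b < 1" using n by (auto simp: inner_add_left eb[OF b] field_simps)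
    qed
    moreover have "x = f ?q" using n by (simp add: f_def)
    ultimately show "x \<in> f ` unit_cube" by blast
  qed
  then have "\<H> (card B) (span B \<inter> cball 0 R) \<le> \<H> (card B) (f ` unit_cube)"
    by (rule hausdorff_outer_mono)
  also have "\<dots> \<le> ennreal ((4 * n) powr real (card B)) * \<H> (card B) unit_cube"
    by (rule hausdorff_outer_Lipschitz_UNIV)
       (use n in \<open>auto simp: f_def dist_norm scaleR_diff_right[symmetric]\<close>)
  also have "\<dots> < top" using hausdorff_unit_cube_finite by (simp add: ennreal_mult_less_top)
  finally show ?thesis .
qed

end

lemma hausdorff_outer_translation: "hausdorff_outer s ((\<lambda>x. x + t) ` A) = hausdorff_outer s A"
  for t :: "'a::euclidean_space"
proof (rule antisym)
  have *: "hausdorff_outer s ((\<lambda>x. x + t) ` A) \<le> hausdorff_outer s A" for t and A :: "'a set"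
    using hausdorff_outer_Lipschitz_UNIV[of 1 "\<lambda>x. x + t" s A] by simp
  show "hausdorff_outer s ((\<lambda>x. x + t) ` A) \<le> hausdorff_outer s A" by (rule *)
  have "A = (\<lambda>x. x + - t) ` (\<lambda>x. x + t) ` A" by (auto simp: image_image)
  then show "hausdorff_outer s A \<le> hausdorff_outer s ((\<lambda>x. x + t) ` A)"
    using *[of "- t" "(\<lambda>x. x + t) ` A"] by simp
qed

context orthonormal_set
begin

text \<open>
  Both measures are invariant under translations by vectors of \<open>span B\<close>.
\<close>

lemma hausdorff_proportional_leb_span:
  assumes A: "A \<in> sets borel"
  shows "\<H> (card B) (span B \<inter> A) = emeasure (leb_span B) A * \<H> (card B) unit_cube"
proof -
  let ?H = "hausdorff_measure (real (card B)) :: 'a measure"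
  define \<mu> where "\<mu> = density ?H (indicator (span B))"
  have sets: "sets \<mu> = sets borel" by (simp add: \<mu>_def)
  have em: "emeasure \<mu> A = \<H> (card B) (span B \<inter> A)" if "A \<in> sets borel" for A
    unfolding \<mu>_def using that by (subst emeasure_restricted) (auto simp: emeasure_hausdorff_measure)
  have AE: "AE x in \<mu>. x \<in> span B"
    unfolding \<mu>_def by (subst AE_density) (auto intro!: AE_I2 split: split_indicator_asm)
  have sf: "sigma_finite_measure \<mu>"
    using hausdorff_cball_span_finite by (intro sigma_finite_of_finite_on_balls sets) (simp add: em)
  have inv: "emeasure \<mu> ((\<lambda>x. x + t) -` A) = emeasure \<mu> A" if t: "t \<in> span B" and A: "A \<in> sets borel" for t A
  proof -
    have tA: "(\<lambda>x. x + t) -` A \<in> sets borel" using A by (rule borel_vimage_translation)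
    have "(\<lambda>x. x + t) ` (span B \<inter> (\<lambda>x. x + t) -` A) = span B \<inter> A"
    proof (intro equalityI subsetI)
      fix y assume "y \<in> span B \<inter> A"
      then have "y - t \<in> span B \<inter> (\<lambda>x. x + t) -` A" "y = y - t + t" using t by (auto intro: span_diff)
      then show "y \<in> (\<lambda>x. x + t) ` (span B \<inter> (\<lambda>x. x + t) -` A)" by blast
    qed (use t in \<open>auto intro: span_add\<close>)
    then show ?thesis
      using hausdorff_outer_translation[of "real (card B)" t "span B \<inter> (\<lambda>x. x + t) -` A"] tA A by (simp add: em)
  qed
  have uniq: "emeasure \<mu> A * emeasure (leb_span B) C = emeasure (leb_span B) A * emeasure \<mu> (uminus -` C)"
    if "A \<in> sets borel" "C \<in> sets borel" for A C
    by (rule translation_invariant_measures_proportional[where T = "span B"])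
       (use sets sf leb_span_sigma_finite AE AE_leb_span inv leb_span_translation that in auto)
  have Q: "span B \<inter> unit_cube = unit_cube" by (auto simp: unit_cube_def)
  have "emeasure \<mu> (uminus -` unit_cube) = emeasure \<mu> unit_cube"
    using uniq[OF borel_unit_cube borel_unit_cube] by (simp add: leb_span_unit_cube)
  moreover have "emeasure \<mu> unit_cube = \<H> (card B) unit_cube"
    using em[OF borel_unit_cube] Q by simp
  ultimately show ?thesis
    using uniq[OF A borel_unit_cube] em[OF A] by (simp add: leb_span_unit_cube)
qed

text \<open>
  Let \<open>c\<close> be the value; \<open>1 \<le> c\<close> holds by comparison with Lebesgue measure.  The balls inscribed
  in the cells of a grid fill a fraction \<open>\<theta>\<close> of the cube, the same for every grid, and they cover
  themselves with exactly their Lebesgue measure as covering sum.  The rest of the cube costs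
  at most \<open>c * (1 - \<theta>)\<close>.  So \<open>c \<le> \<theta> + c * (1 - \<theta>)\<close>, which forces \<open>c \<le> 1\<close>.
\<close>

lemma hausdorff_unit_cube: "\<H> (card B) unit_cube = 1"
proof -
  define c where "c = enn2real (\<H> (card B) unit_cube)"
  have c: "\<H> (card B) unit_cube = ennreal c" "c \<ge> 0"
    using hausdorff_unit_cube_finite by (auto simp: c_def)
  have c1: "c \<ge> 1"
    using leb_span_le_hausdorff[OF borel_unit_cube] leb_span_unit_cube c by (simp add: ennreal_ge_1)
  \<comment> \<open>total Lebesgue measure of the inscribed balls of radius \<open>1 / (2 * N)\<close>, for any \<open>N\<close>\<close>
  define \<theta> where "\<theta> = unit_ball_vol (real (card B)) / 2 ^ card B"
  have \<theta>0: "\<theta> > 0" using unit_ball_vol_pos[of "real (card B)"] by (simp add: \<theta>_def)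
  have main: "ennreal (unit_ball_vol (real (card B))) * hausdorff_pre (real (card B)) \<epsilon> unit_cube \<le> ennreal (\<theta> + c * (1 - \<theta>)) \<and> \<theta> \<le> 1"
    if e: "\<epsilon> > 0" for \<epsilon>
  proof -
    obtain N :: nat where N: "1 / (2 * \<epsilon>) < real N" using reals_Archimedean2 by blast
    have "0 < 1 / (2 * \<epsilon>)" using e by simp
    then have N0: "N > 0" using N by (metis less_trans of_nat_0_less_iff)
    define r where "r = 1 / (2 * real N)"
    have r: "r > 0" "r \<le> \<epsilon>" using N N0 e by (auto simp: r_def field_simps)
    define D where "D = (\<Union>g\<in>grid N. ball (grid_point N g) r)"
    have Dm [measurable]: "D \<in> sets borel" unfolding D_def by (intro borel_open open_UN) auto
    have gp: "grid_point N g \<bullet> b = (real (g b) + 1 / 2) / real N" if "b \<in> B" for g b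
      unfolding grid_point_def by (rule expansion(1)[OF that])
    have disj: "disjoint_family_on (\<lambda>g. ball (grid_point N g) r) (grid N)"
    proof (unfold disjoint_family_on_def, intro ballI impI)
      fix g g' assume g: "g \<in> grid N" "g' \<in> grid N" "g \<noteq> g'"
      then obtain b where b: "b \<in> B" "g b \<noteq> g' b" unfolding grid_def by (meson PiE_ext)
      have "1 / real N \<le> \<bar>real (g b) - real (g' b)\<bar> / real N"
        using b N0 by (intro divide_right_mono) auto
      also have "\<dots> = \<bar>(grid_point N g - grid_point N g') \<bullet> b\<bar>"
      proof -
        have "(grid_point N g - grid_point N g') \<bullet> b = (real (g b) - real (g' b)) / real N"
          by (simp add: inner_diff_left gp[OF b(1)] diff_divide_distrib[symmetric])
        then show ?thesis by (simp only: abs_divide abs_of_nat)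
      qed
      also have "\<dots> \<le> norm (grid_point N g - grid_point N g') * norm b" by (rule Cauchy_Schwarz_ineq2)
      finally have "2 * r \<le> dist (grid_point N g) (grid_point N g')"
        using norm_B[OF b(1)] by (simp add: dist_norm r_def)
      then have "dist (grid_point N g) x \<ge> r \<or> dist (grid_point N g') x \<ge> r" for x
        using dist_triangle2[of "grid_point N g" "grid_point N g'" x] by linarith
      then show "ball (grid_point N g) r \<inter> ball (grid_point N g') r = {}" by (force simp: not_le[symmetric])
    qed
    have "emeasure (leb_span B) D = (\<Sum>g\<in>grid N. emeasure (leb_span B) (ball (grid_point N g) r))"
      unfolding D_def using disj finite_grid by (intro sum_emeasure[symmetric]) auto
    also have "\<dots> = of_nat (N ^ card B) * ennreal (unit_ball_vol (real (card B)) * r ^ card B)"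
      using leb_span_ball[OF grid_point_in_span r(1)] by (simp add: card_grid)
    also have "\<dots> = ennreal \<theta>"
      using N0 by (simp add: ennreal_of_nat_eq_real_of_nat ennreal_mult'[symmetric] \<theta>_def r_def power_mult_distrib power_divide field_simps)
    finally have Dt: "emeasure (leb_span B) D = ennreal \<theta>" .
    have inQ: "x \<in> unit_cube" if x: "x \<in> span B" "x \<in> D" for x
    proof -
      obtain g where g: "g \<in> grid N" "dist (grid_point N g) x < r" using x by (auto simp: D_def)
      have "0 \<le> x \<bullet> b \<and> x \<bullet> b < 1" if b: "b \<in> B" for b
      proof -
        have "\<bar>(grid_point N g - x) \<bullet> b\<bar> \<le> norm (grid_point N g - x) * norm b" by (rule Cauchy_Schwarz_ineq2)
        then have "\<bar>(real (g b) + 1 / 2) / real N - x \<bullet> b\<bar> < 1 / (2 * real N)"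
          using g(2) norm_B[OF b] by (simp add: dist_norm inner_diff_left gp[OF b] r_def)
        moreover have "(real (g b) + 1 / 2) / real N = real (g b) / real N + 1 / (2 * real N)"
          using N0 by (simp add: field_simps)
        ultimately have "real (g b) / real N < x \<bullet> b \<and> x \<bullet> b < real (g b) / real N + 2 * (1 / (2 * real N))"
          by (simp only: abs_less_iff) linarith
        moreover have "real (g b) / real N + 2 * (1 / (2 * real N)) = (real (g b) + 1) / real N"
          using N0 by (simp add: field_simps)
        moreover have "(real (g b) + 1) / real N \<le> 1" using g(1) b N0 by (auto simp: grid_def field_simps PiE_iff)
        moreover have "0 \<le> real (g b) / real N" by simp
        ultimately show ?thesis by linarith
      qed
      then show ?thesis using x by (simp add: unit_cube_def)
    qed
    have "emeasure (leb_span B) (unit_cube \<inter> D) = emeasure (leb_span B) D"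
      by (rule emeasure_eq_AE) (use AE_leb_span inQ in \<open>auto elim: eventually_mono\<close>)
    moreover have "emeasure (leb_span B) (unit_cube \<inter> D) + emeasure (leb_span B) (unit_cube - D) = emeasure (leb_span B) unit_cube"
      by (subst plus_emeasure) (auto intro: arg_cong2[where f=emeasure])
    ultimately have sum: "ennreal \<theta> + emeasure (leb_span B) (unit_cube - D) = 1"
      by (simp add: Dt leb_span_unit_cube)
    then have "ennreal \<theta> \<le> 1" by (metis le_iff_add)
    then have \<theta>1: "\<theta> \<le> 1" by (simp add: ennreal_le_1)
    have "ennreal \<theta> + emeasure (leb_span B) (unit_cube - D) = ennreal \<theta> + ennreal (1 - \<theta>)"
      using sum \<theta>0 \<theta>1 by (simp add: ennreal_plus[symmetric] del: ennreal_plus)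
    then have rest: "emeasure (leb_span B) (unit_cube - D) = ennreal (1 - \<theta>)"
      by (simp add: ennreal_add_left_cancel)
    have "span B \<inter> (unit_cube - D) = unit_cube - D" by (auto simp: unit_cube_def)
    then have Hrest: "\<H> (card B) (unit_cube - D) = ennreal (c * (1 - \<theta>))"
      using hausdorff_proportional_leb_span[of "unit_cube - D"] rest c \<theta>1 by (simp add: ennreal_mult mult.commute)
    let ?v = "ennreal (unit_ball_vol (real (card B)))"
    have "hausdorff_pre (real (card B)) \<epsilon> unit_cube \<le> hausdorff_pre (real (card B)) \<epsilon> (D \<union> (unit_cube - D))"
      by (rule hausdorff_pre_mono) auto
    also have "\<dots> \<le> hausdorff_pre (real (card B)) \<epsilon> D + hausdorff_pre (real (card B)) \<epsilon> (unit_cube - D)"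
      by (rule hausdorff_pre_subadditive)
    also have "\<dots> \<le> ennreal ((real N * r) ^ card B) + hausdorff_pre (real (card B)) \<epsilon> (unit_cube - D)"
      by (intro add_right_mono hausdorff_pre_grid_balls[OF N0 r]) (simp add: D_def)
    finally have "?v * hausdorff_pre (real (card B)) \<epsilon> unit_cube \<le>
       ?v * (ennreal ((real N * r) ^ card B) + hausdorff_pre (real (card B)) \<epsilon> (unit_cube - D))"
      by (rule mult_left_mono) simp
    also have "\<dots> = ennreal \<theta> + ?v * hausdorff_pre (real (card B)) \<epsilon> (unit_cube - D)"
      using N0 by (simp add: distrib_left ennreal_mult'[symmetric] \<theta>_def r_def power_divide)
    also have "\<dots> \<le> ennreal \<theta> + ennreal (c * (1 - \<theta>))"
      using hausdorff_pre_le_outer[OF e, of "real (card B)" "unit_cube - D"] by (simp add: Hrest add_left_mono)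
    also have "\<dots> = ennreal (\<theta> + c * (1 - \<theta>))" using \<theta>0 \<theta>1 c by simp
    finally show ?thesis using \<theta>1 by blast
  qed
  have "ennreal c \<le> ennreal (\<theta> + c * (1 - \<theta>))"
    unfolding c(1)[symmetric] using main by (intro hausdorff_outer_leI) blast
  moreover have "0 \<le> \<theta> + c * (1 - \<theta>)" using main[of 1] \<theta>0 c(2) by simp
  ultimately have "c \<le> \<theta> + c * (1 - \<theta>)" by simp
  then have "\<theta> * c \<le> \<theta> * 1" by (simp add: algebra_simps)
  then have "c \<le> 1" using \<theta>0 by simp
  then show ?thesis using c c1 by simp
qed

lemma hausdorff_eq_leb_span:
  assumes "A \<in> sets borel"
  shows "\<H> (card B) (span B \<inter> A) = emeasure (leb_span B) A"
  using hausdorff_proportional_leb_span[OF assms] hausdorff_unit_cube by simp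

end

section \<open>Area factors of linear maps and the linear coarea formula\<close>

lemma subspace_orthonormal_basis:
  fixes T :: "'a::euclidean_space set"
  assumes "subspace T"
  obtains B where "orthonormal_set B" "span B = T" "card B = dim T"
proof -
  obtain B where B: "B \<subseteq> T" "pairwise orthogonal B" "\<And>x. x \<in> B \<Longrightarrow> norm x = 1" "independent B" "card B = dim T" "span B = T"
    using orthonormal_basis_subspace[OF assms] by metis
  then have "orthonormal_set B" by unfold_locales (auto simp: independent_imp_finite)
  with B show ?thesis using that by blast
qed

lemma (in orthonormal_set) density_hausdorff_span:
  "density (hausdorff_measure (real (card B))) (indicator (span B)) = leb_span B"
proof (rule measure_eqI)
  fix A assume "A \<in> sets (density (hausdorff_measure (real (card B))) (indicator (span B)))"
  then have A: "A \<in> sets borel" by simp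
  show "emeasure (density (hausdorff_measure (real (card B))) (indicator (span B))) A = emeasure (leb_span B) A"
    using A by (subst emeasure_restricted) (auto simp: emeasure_hausdorff_measure hausdorff_eq_leb_span[symmetric])
qed simp

lemma (in orthonormal_set) dim_span_B: "dim (span B) = card B"
proof -
  have "0 \<notin> B" using norm_B by force
  then have "independent B" using pairwise_orthogonal_independent[OF orth_B] by blast
  then show ?thesis using dim_eq_card_independent[of B] by (simp add: dim_span)
qed

lemma hausdorff_bounded_subspace_finite:
  fixes T :: "'a::euclidean_space set"
  assumes "subspace T" "A \<subseteq> T" "bounded A"
  shows "\<H> (dim T) A < top"
proof -
  obtain B where B: "orthonormal_set B" "span B = T" "card B = dim T"
    using subspace_orthonormal_basis[OF assms(1)] .
  interpret orthonormal_set B by fact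
  obtain R where "\<forall>x\<in>A. norm x \<le> R" using assms(3) by (auto simp: bounded_iff)
  then have "A \<subseteq> cball 0 R" by auto
  then have "\<H> (dim T) A \<le> \<H> (dim T) (span B \<inter> cball 0 R)"
    using assms B by (intro hausdorff_outer_mono) auto
  then show ?thesis using hausdorff_cball_span_finite[of R] B by (auto intro: le_less_trans)
qed

lemma hausdorff_open_subspace_pos:
  fixes T :: "'a::euclidean_space set"
  assumes T: "subspace T" and W: "openin (top_of_set T) W" "W \<noteq> {}"
  shows "\<H> (dim T) W > 0"
proof -
  obtain B where B: "orthonormal_set B" "span B = T" "card B = dim T"
    using subspace_orthonormal_basis[OF T] .
  interpret orthonormal_set B by fact
  obtain V where V: "open V" "W = T \<inter> V" using W by (auto simp: openin_open)
  obtain p where p: "p \<in> T" "p \<in> V" using W V by auto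
  obtain r where r: "r > 0" "ball p r \<subseteq> V" using V p open_contains_ball by blast
  have "0 < ennreal (unit_ball_vol (real (card B)) * r ^ card B)"
    using r by simp
  also have "\<dots> = emeasure (leb_span B) (ball p r)"
    using leb_span_ball[OF _ r(1)] p B by simp
  also have "\<dots> = \<H> (dim T) (span B \<inter> ball p r)"
    using hausdorff_eq_leb_span[of "ball p r"] B by simp
  also have "\<dots> \<le> \<H> (dim T) W"
    using r V B by (intro hausdorff_outer_mono) auto
  finally show ?thesis .
qed

lemma orthonormal_set_Basis: "orthonormal_set (Basis :: 'a::euclidean_space set)"
proof
  show "norm b = 1" if "b \<in> Basis" for b :: 'a using that by simp
  show "pairwise orthogonal (Basis :: 'a set)"
    unfolding pairwise_def orthogonal_def using inner_not_same_Basis by blast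
qed simp

lemma hausdorff_measure_DIM_eq_lborel:
  "hausdorff_measure (real DIM('a)) = (lborel :: 'a::euclidean_space measure)"
proof -
  have "indicator (span (Basis :: 'a set)) = (\<lambda>_. 1 :: ennreal)" by (simp add: fun_eq_iff)
  moreover have "density (hausdorff_measure (real DIM('a))) (indicator (span (Basis :: 'a set))) = leb_span Basis"
    by (rule orthonormal_set.density_hausdorff_span[OF orthonormal_set_Basis])
  ultimately have "hausdorff_measure (real DIM('a)) = leb_span (Basis :: 'a set)"
    by (simp only: density_1)
  also have "\<dots> = lborel"
    unfolding leb_span_def by (rule lborel_eq[symmetric])
  finally show ?thesis .
qed

lemma hausdorff_outer_0_singleton [simp]: "hausdorff_outer 0 {x :: 'a::euclidean_space} = 1"
proof -
  interpret orthonormal_set "{} :: 'a set" by standard auto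
  have "unit_cube = {0}" by (auto simp: unit_cube_def)
  then have "hausdorff_outer 0 {0 :: 'a} = 1" using hausdorff_unit_cube by simp
  then show ?thesis using hausdorff_outer_translation[of 0 x "{0}"] by simp
qed

lemma linear_Lipschitz:
  fixes L :: "'a::euclidean_space \<Rightarrow> 'b::euclidean_space"
  assumes "linear L"
  obtains c where "c > 0" "\<And>x y. dist (L x) (L y) \<le> c * dist x y"
proof -
  obtain c where "c > 0" "\<And>x. norm (L x) \<le> c * norm x"
    using linear_bounded_pos[OF assms] by blast
  then show ?thesis using that by (metis dist_norm linear_diff[OF assms])
qed

text \<open>
  Pulling \<open>\<H>\<close> on \<open>L ` T\<close> back by \<open>L\<close> gives a translation invariant measure on \<open>T\<close>, which is therefore a
  multiple of \<open>\<H>\<close> on \<open>T\<close>.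
\<close>

lemma hausdorff_linear_image:
  fixes L :: "'a::euclidean_space \<Rightarrow> 'b::euclidean_space"
  assumes L: "linear L" and T: "subspace T" and inj: "inj_on L T"
  obtains J :: real where "J > 0"
    "\<And>A. A \<in> sets borel \<Longrightarrow> A \<subseteq> T \<Longrightarrow> \<H> (dim T) (L ` A) = ennreal J * \<H> (dim T) A"
    "\<And>A. A \<in> sets borel \<Longrightarrow> A \<subseteq> T \<Longrightarrow> L ` A \<in> sets borel"
proof -
  let ?m = "real (dim T)"
  interpret L: linear L by fact
  obtain K where K: "range K \<subseteq> T" "linear K" "\<And>x. x \<in> T \<Longrightarrow> K (L x) = x"
    using linear_exists_left_inverse_on[OF L T inj] by blast
  interpret K: linear K by fact
  obtain B where B: "orthonormal_set B" "span B = T" "card B = dim T"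
    using subspace_orthonormal_basis[OF T] .
  interpret orthonormal_set B by fact
  obtain c where c: "c > 0" "\<And>x y. dist (L x) (L y) \<le> c * dist x y" using linear_Lipschitz[OF L] by blast
  obtain d where d: "d > 0" "\<And>x y. dist (K x) (K y) \<le> d * dist x y" using linear_Lipschitz[OF K(2)] by blast
  have Kb [measurable]: "K \<in> borel_measurable borel"
    by (intro borel_measurable_continuous_onI linear_continuous_on linear_conv_bounded_linear[THEN iffD1] K)
  have LT: "subspace (L ` T)" using linear_subspace_image[OF L T] .
  have LTb [measurable]: "L ` T \<in> sets borel" using LT by (intro borel_closed closed_subspace)
  have im: "L ` (T \<inter> A) = L ` T \<inter> K -` A" for A using K by auto
  have bor: "L ` A \<in> sets borel" if "A \<in> sets borel" "A \<subseteq> T" for A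
  proof -
    have "L ` A = L ` T \<inter> K -` A" using im[of A] that by (simp add: Int_absorb1)
    then show ?thesis using measurable_sets[OF Kb that(1)] by simp
  qed
  define \<nu> where "\<nu> = distr (density (hausdorff_measure ?m) (indicator (L ` T))) borel K"
  have sets: "sets \<nu> = sets borel" by (simp add: \<nu>_def)
  have em: "emeasure \<nu> A = hausdorff_outer ?m (L ` (T \<inter> A))" if A: "A \<in> sets borel" for A
  proof -
    have "emeasure \<nu> A = emeasure (density (hausdorff_measure ?m) (indicator (L ` T))) (K -` A)"
      unfolding \<nu>_def using A by (subst emeasure_distr) auto
    also have "\<dots> = emeasure (hausdorff_measure ?m) (L ` T \<inter> K -` A)"
      using measurable_sets[OF Kb A] by (subst emeasure_restricted) auto
    also have "\<dots> = hausdorff_outer ?m (L ` T \<inter> K -` A)"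
      using measurable_sets[OF Kb A] by (simp add: emeasure_hausdorff_measure)
    finally show ?thesis by (simp add: im)
  qed
  have AE: "AE x in \<nu>. x \<in> span B"
    unfolding \<nu>_def using K(1) B(2) closed_subspace[OF T] by (subst AE_distr_iff) auto
  have fin: "emeasure \<nu> A < top" if "A \<in> sets borel" "bounded A" for A
  proof -
    have "emeasure \<nu> A \<le> ennreal (c powr ?m) * hausdorff_outer ?m (T \<inter> A)"
      unfolding em[OF that(1)] by (rule hausdorff_outer_Lipschitz_UNIV[OF c])
    also have "\<dots> < top"
      using hausdorff_bounded_subspace_finite[OF T, of "T \<inter> A"] that by (simp add: ennreal_mult_less_top bounded_Int)
    finally show ?thesis .
  qed
  have sf: "sigma_finite_measure \<nu>"
    by (intro sigma_finite_of_finite_on_balls sets fin) auto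
  have inv: "emeasure \<nu> ((\<lambda>x. x + t) -` A) = emeasure \<nu> A" if t: "t \<in> span B" and A: "A \<in> sets borel" for t A
  proof -
    have tA: "(\<lambda>x. x + t) -` A \<in> sets borel" using A by (rule borel_vimage_translation)
    have tT: "t \<in> T" using t B by simp
    have "(\<lambda>x. x + L t) ` L ` (T \<inter> (\<lambda>x. x + t) -` A) = L ` (T \<inter> A)"
    proof (intro equalityI subsetI)
      fix y assume "y \<in> L ` (T \<inter> A)"
      then obtain x where x: "x \<in> T" "x \<in> A" "y = L x" by auto
      then have "x - t \<in> T \<inter> (\<lambda>x. x + t) -` A" "y = L (x - t) + L t"
        using tT T by (auto simp: L.diff intro: subspace_diff)
      then show "y \<in> (\<lambda>x. x + L t) ` L ` (T \<inter> (\<lambda>x. x + t) -` A)" by blast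
    next
      fix y assume "y \<in> (\<lambda>x. x + L t) ` L ` (T \<inter> (\<lambda>x. x + t) -` A)"
      then obtain x where x: "x \<in> T" "x + t \<in> A" "y = L (x + t)" by (auto simp: L.add)
      then show "y \<in> L ` (T \<inter> A)" using tT T by (auto intro: subspace_add)
    qed
    then show ?thesis
      using hausdorff_outer_translation[of ?m "L t" "L ` (T \<inter> (\<lambda>x. x + t) -` A)"] tA A by (simp add: em)
  qed
  have uniq: "emeasure \<nu> A * emeasure (leb_span B) C = emeasure (leb_span B) A * emeasure \<nu> (uminus -` C)"
    if "A \<in> sets borel" "C \<in> sets borel" for A C
    by (rule translation_invariant_measures_proportional[where T = "span B"])
       (use sets sf leb_span_sigma_finite AE AE_leb_span inv leb_span_translation that in auto)
  define J where "J = enn2real (emeasure \<nu> unit_cube)"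
  have bQ: "bounded unit_cube"
  proof -
    have "norm x \<le> real (card B)" if "x \<in> unit_cube" for x
    proof -
      have "x = (\<Sum>b\<in>B. (x \<bullet> b) *\<^sub>R b)" using that expansion(3)[of x] by (simp add: unit_cube_def)
      then have "norm x \<le> (\<Sum>b\<in>B. norm ((x \<bullet> b) *\<^sub>R b))" by (metis norm_sum)
      also have "\<dots> \<le> (\<Sum>b\<in>B. 1)" by (rule sum_mono) (use that norm_B in \<open>auto simp: unit_cube_def\<close>)
      finally show ?thesis by simp
    qed
    then show ?thesis by (auto simp: bounded_iff)
  qed
  have J: "emeasure \<nu> unit_cube = ennreal J"
    using fin[OF borel_unit_cube bQ] by (simp add: J_def)
  have QT: "T \<inter> unit_cube = unit_cube" using B by (auto simp: unit_cube_def)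
  \<comment> \<open>if \<open>J\<close> were 0, the Lipschitz map \<open>K\<close> would carry the null set \<open>L ` unit_cube\<close> onto the cube\<close>
  have "J \<noteq> 0"
  proof
    assume "J = 0"
    then have "hausdorff_outer ?m (L ` unit_cube) = 0" using J em[OF borel_unit_cube] QT by simp
    moreover have "unit_cube = K ` L ` unit_cube" using QT K(3) by (force simp: image_image)
    ultimately have "hausdorff_outer ?m unit_cube \<le> ennreal (d powr ?m) * 0"
      using hausdorff_outer_Lipschitz_UNIV[OF d, of ?m "L ` unit_cube"] by simp
    then show False using hausdorff_unit_cube B by simp
  qed
  moreover have "J \<ge> 0" by (simp add: J_def)
  ultimately have J0: "J > 0" by simp
  have J': "emeasure \<nu> (uminus -` unit_cube) = ennreal J"
    using uniq[OF borel_unit_cube borel_unit_cube] J by (simp add: leb_span_unit_cube)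
  have "hausdorff_outer ?m (L ` A) = ennreal J * hausdorff_outer ?m A" if A: "A \<in> sets borel" "A \<subseteq> T" for A
  proof -
    have TA: "T \<inter> A = A" using A by auto
    then have "hausdorff_outer ?m A = emeasure (leb_span B) A"
      using hausdorff_eq_leb_span[OF A(1)] B by simp
    moreover have "hausdorff_outer ?m (L ` A) = emeasure \<nu> A" using em[OF A(1)] TA by simp
    ultimately show ?thesis
      using uniq[OF A(1) borel_unit_cube] J' by (simp add: leb_span_unit_cube mult.commute)
  qed
  then show ?thesis using that J0 bor by blast
qed

lemma leb_span_Un:
  assumes B: "orthonormal_set (B \<union> C)" "B \<inter> C = {}" and A: "A \<in> sets borel"
  shows "emeasure (leb_span (B \<union> C)) A = (\<integral>\<^sup>+u. emeasure (leb_span C) ((\<lambda>v. u + v) -` A) \<partial>leb_span B)"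
    and "(\<lambda>u. emeasure (leb_span C) ((\<lambda>v. u + v) -` A)) \<in> borel_measurable borel"
proof -
  interpret BC: orthonormal_set "B \<union> C" by fact
  interpret C: orthonormal_set C
  proof
    show "pairwise orthogonal C" using BC.orth_B by (rule pairwise_subset) simp
  qed (use BC.finite_B BC.norm_B in auto)
  interpret sC: sigma_finite_measure "leb_span C" by (rule C.leb_span_sigma_finite)
  have fin: "finite B" "finite C" using BC.finite_B by auto
  show meas: "(\<lambda>u. emeasure (leb_span C) ((\<lambda>v. u + v) -` A)) \<in> borel_measurable borel"
  proof (rule sC.measurable_emeasure)
    have "(\<lambda>x :: 'a \<times> 'a. fst x + snd x) \<in> measurable (borel \<Otimes>\<^sub>M leb_span C) borel" by measurable
    from measurable_sets[OF this A]
    show "{x \<in> space (borel \<Otimes>\<^sub>M leb_span C). snd x \<in> (\<lambda>v. fst x + v) -` A} \<in> sets (borel \<Otimes>\<^sub>M leb_span C)"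
      by (simp add: vimage_def Int_def conj_commute)
  qed simp
  let ?sum = "\<lambda>D (f :: 'a \<Rightarrow> real). \<Sum>b\<in>D. f b *\<^sub>R b"
  let ?P = "\<lambda>D. \<Pi>\<^sub>M b\<in>D. lborel :: real measure"
  have mer: "?sum (B \<union> C) (merge B C (x, y)) = ?sum B x + ?sum C y" for x y
  proof -
    have "?sum (B \<union> C) (merge B C (x, y)) = ?sum B (merge B C (x, y)) + ?sum C (merge B C (x, y))"
      using fin B(2) by (rule sum.union_disjoint)
    also have "?sum B (merge B C (x, y)) = ?sum B x" by (rule sum.cong) (auto simp: merge_def)
    also have "?sum C (merge B C (x, y)) = ?sum C y" by (rule sum.cong) (use B(2) in \<open>auto simp: merge_def\<close>)
    finally show ?thesis .
  qed
  have Am: "?sum (B \<union> C) -` A \<inter> space (?P (B \<union> C)) \<in> sets (?P (B \<union> C))"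
    using A by measurable
  have "emeasure (leb_span (B \<union> C)) A = emeasure (?P (B \<union> C)) (?sum (B \<union> C) -` A \<inter> space (?P (B \<union> C)))"
    using A by (rule emeasure_leb_span)
  also have "\<dots> = (\<integral>\<^sup>+x. emeasure (?P C) ((\<lambda>y. merge B C (x, y)) -` (?sum (B \<union> C) -` A \<inter> space (?P (B \<union> C))) \<inter> space (?P C)) \<partial>?P B)"
    by (rule BC.emeasure_fold_integral[OF B(2) fin Am])
  also have "\<dots> = (\<integral>\<^sup>+x. emeasure (leb_span C) ((\<lambda>v. ?sum B x + v) -` A) \<partial>?P B)"
  proof (rule nn_integral_cong)
    fix x assume x: "x \<in> space (?P B)"
    have "(\<lambda>v. ?sum B x + v) -` A \<in> sets borel" using measurable_sets[of "\<lambda>v. ?sum B x + v" borel borel A] A by simp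
    then have "emeasure (leb_span C) ((\<lambda>v. ?sum B x + v) -` A) = emeasure (?P C) (?sum C -` ((\<lambda>v. ?sum B x + v) -` A) \<inter> space (?P C))"
      by (rule emeasure_leb_span)
    also have "?sum C -` ((\<lambda>v. ?sum B x + v) -` A) \<inter> space (?P C) =
       (\<lambda>y. merge B C (x, y)) -` (?sum (B \<union> C) -` A \<inter> space (?P (B \<union> C))) \<inter> space (?P C)"
      using x measurable_space[OF measurable_merge, of "(x, _)" B "\<lambda>_. lborel" C] by (auto simp: mer space_pair_measure)
    finally show "emeasure (?P C) ((\<lambda>y. merge B C (x, y)) -` (?sum (B \<union> C) -` A \<inter> space (?P (B \<union> C))) \<inter> space (?P C)) =
       emeasure (leb_span C) ((\<lambda>v. ?sum B x + v) -` A)" by simp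
  qed
  also have "\<dots> = (\<integral>\<^sup>+u. emeasure (leb_span C) ((\<lambda>v. u + v) -` A) \<partial>leb_span B)"
    unfolding leb_span_def[of B] using meas by (subst nn_integral_distr) auto
  finally show "emeasure (leb_span (B \<union> C)) A = (\<integral>\<^sup>+u. emeasure (leb_span C) ((\<lambda>v. u + v) -` A) \<partial>leb_span B)" .
qed

text \<open>
  Orthonormal bases of \<open>N\<close> and \<open>K\<close> together form one of \<open>T\<close>, so this is Fubini's theorem for a product of Lebesgue measures.
\<close>

lemma hausdorff_Fubini:
  fixes T N K :: "'a::euclidean_space set"
  assumes sub: "subspace T" "subspace N" "subspace K" "N \<subseteq> T" "K \<subseteq> T"
    and orth: "\<And>u v. u \<in> N \<Longrightarrow> v \<in> K \<Longrightarrow> u \<bullet> v = 0"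
    and dec: "\<And>t. t \<in> T \<Longrightarrow> \<exists>u\<in>N. \<exists>v\<in>K. t = u + v"
  shows "dim T = dim N + dim K"
    and "A \<in> sets borel \<Longrightarrow> (\<lambda>u. \<H> (dim K) {v \<in> K. u + v \<in> A}) \<in> borel_measurable borel"
    and "A \<in> sets borel \<Longrightarrow> A \<subseteq> T \<Longrightarrow> \<H> (dim T) A =
      (\<integral>\<^sup>+u. \<H> (dim K) {v \<in> K. u + v \<in> A} * indicator N u \<partial>hausdorff_measure (real (dim N)))"
proof -
  obtain B where B: "orthonormal_set B" "span B = N" "card B = dim N"
    using subspace_orthonormal_basis[OF sub(2)] .
  obtain C where C: "orthonormal_set C" "span C = K" "card C = dim K"
    using subspace_orthonormal_basis[OF sub(3)] .
  interpret B: orthonormal_set B by fact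
  interpret C: orthonormal_set C by fact
  have BC0: "b \<bullet> c = 0" if "b \<in> B" "c \<in> C" for b c
    using orth that B(2) C(2) span_base by blast
  have disj: "B \<inter> C = {}"
  proof (rule ccontr)
    assume "B \<inter> C \<noteq> {}"
    then obtain b where "b \<in> B" "b \<in> C" by auto
    then show False using BC0[of b b] B.norm_B[of b] by (simp add: dot_square_norm)
  qed
  have on: "orthonormal_set (B \<union> C)"
  proof
    show "pairwise orthogonal (B \<union> C)"
      using B.orth_B C.orth_B BC0 unfolding pairwise_def orthogonal_def by (metis UnE inner_commute)
  qed (use B.norm_B C.norm_B in auto)
  interpret BC: orthonormal_set "B \<union> C" by fact
  have sp: "span (B \<union> C) = T"
  proof
    show "span (B \<union> C) \<subseteq> T"
      using B(2) C(2) sub span_superset by (intro span_minimal) blast+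
    show "T \<subseteq> span (B \<union> C)"
    proof
      fix t assume "t \<in> T"
      then obtain u v where "u \<in> span B" "v \<in> span C" "t = u + v" using dec B C by blast
      then show "t \<in> span (B \<union> C)"
        by (metis span_add span_mono Un_upper1 Un_upper2 subsetD)
    qed
  qed
  have cBC: "card (B \<union> C) = dim T" using BC.dim_span_B sp by simp
  then show "dim T = dim N + dim K" using card_Un_disjoint[OF B.finite_B C.finite_B disj] B C by simp
  have vA: "(\<lambda>v. u + v) -` A \<in> sets borel" if "A \<in> sets borel" for A :: "'a set" and u
  proof -
    have "(\<lambda>v. u + v) \<in> borel_measurable borel" by measurable
    from measurable_sets[OF this that] show ?thesis by simp
  qed
  have eq: "\<H> (dim K) {v \<in> K. u + v \<in> A} = emeasure (leb_span C) ((\<lambda>v. u + v) -` A)"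
    if "A \<in> sets borel" for A u
  proof -
    have "{v \<in> K. u + v \<in> A} = span C \<inter> (\<lambda>v. u + v) -` A" using C by auto
    then show ?thesis using C.hausdorff_eq_leb_span[OF vA[OF that]] C by simp
  qed
  show meas: "(\<lambda>u. \<H> (dim K) {v \<in> K. u + v \<in> A}) \<in> borel_measurable borel" if "A \<in> sets borel" for A
    using leb_span_Un(2)[OF on disj that] by (simp add: eq[OF that])
  show "\<H> (dim T) A =
      (\<integral>\<^sup>+u. \<H> (dim K) {v \<in> K. u + v \<in> A} * indicator N u \<partial>hausdorff_measure (real (dim N)))"
    if A: "A \<in> sets borel" "A \<subseteq> T" for A
  proof -
    have "T \<inter> A = A" using A by auto
    then have "\<H> (dim T) A = emeasure (leb_span (B \<union> C)) A"
      using BC.hausdorff_eq_leb_span[OF A(1)] sp cBC by simp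
    also have "\<dots> = (\<integral>\<^sup>+u. \<H> (dim K) {v \<in> K. u + v \<in> A} \<partial>leb_span B)"
      using leb_span_Un(1)[OF on disj A(1)] by (simp add: eq[OF A(1)])
    also have "\<dots> = (\<integral>\<^sup>+u. \<H> (dim K) {v \<in> K. u + v \<in> A} \<partial>density (hausdorff_measure (real (dim N))) (indicator N))"
      using B.density_hausdorff_span B by simp
    also have "\<dots> = (\<integral>\<^sup>+u. \<H> (dim K) {v \<in> K. u + v \<in> A} * indicator N u \<partial>hausdorff_measure (real (dim N)))"
      using meas[OF A(1)] borel_closed[OF closed_subspace[OF sub(2)]]
      by (subst nn_integral_density) (auto simp: mult.commute)
    finally show ?thesis .
  qed
qed

text \<open>
  On the orthogonal complement \<open>N\<close> of the kernel, \<open>L\<close> is injective and has the same image as on \<open>T\<close>;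
  the factor of \<open>L\<close> on \<open>N\<close> will turn out to be the tangential Jacobian.
\<close>

lemma kernel_complement:
  fixes L :: "'a::euclidean_space \<Rightarrow> 'b::euclidean_space"
  assumes T: "subspace T" and L: "linear L"
  defines "K \<equiv> {t \<in> T. L t = 0}"
  defines "N \<equiv> {t \<in> T. \<forall>k\<in>K. t \<bullet> k = 0}"
  shows "subspace K" "subspace N" "inj_on L N" "L ` N = L ` T" "dim N = dim (L ` T)" "dim T = dim N + dim K"
    "\<And>t. t \<in> T \<Longrightarrow> t - orth_proj K t \<in> N" "\<And>t. L (t - orth_proj K t) = L t"
proof -
  interpret L: linear L by fact
  show K: "subspace K"
    unfolding K_def using subspace_0[OF T] subspace_add[OF T] subspace_scale[OF T] L.zero L.add L.scale
    by (intro subspaceI CollectI conjI) auto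
  show N: "subspace N"
    unfolding N_def using subspace_0[OF T] subspace_add[OF T] subspace_scale[OF T]
    by (intro subspaceI CollectI conjI) (auto simp: inner_add_left)
  have KT: "K \<subseteq> T" unfolding K_def by blast
  show pN: "t - orth_proj K t \<in> N" if "t \<in> T" for t
    using that orth_proj_orthogonal[OF K, of _ t] orth_proj_in[OF K, of t] KT T
    by (auto simp: N_def intro!: subspace_diff)
  show LN: "L (t - orth_proj K t) = L t" for t
    using orth_proj_in[OF K, of t] by (simp add: L.diff K_def)
  show "inj_on L N"
  proof (rule inj_onI)
    fix x y assume xy: "x \<in> N" "y \<in> N" "L x = L y"
    then have d: "x - y \<in> N" using N by (simp add: subspace_diff)
    moreover have "x - y \<in> K" using d xy by (auto simp: K_def N_def L.diff)
    ultimately have "(x - y) \<bullet> (x - y) = 0" by (auto simp: N_def)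
    then show "x = y" by simp
  qed
  then have dimN: "dim N = dim (L ` N)" by (intro dim_image_eq[symmetric] L) (simp add: span_eq_iff[THEN iffD2, OF N])
  show im: "L ` N = L ` T"
  proof
    show "L ` T \<subseteq> L ` N" using pN LN by (metis image_eqI image_subsetI)
    show "L ` N \<subseteq> L ` T" unfolding N_def by blast
  qed
  show "dim N = dim (L ` T)" using dimN im by simp
  show "dim T = dim N + dim K"
  proof (rule hausdorff_Fubini(1)[OF T N K _ KT])
    show "N \<subseteq> T" by (auto simp: N_def)
    show "u \<bullet> v = 0" if "u \<in> N" "v \<in> K" for u v using that by (auto simp: N_def)
    show "\<exists>u\<in>N. \<exists>v\<in>K. t = u + v" if "t \<in> T" for t
      using pN[OF that] orth_proj_in[OF K, of t] by (metis diff_add_cancel)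
  qed
qed

text \<open>
  The fibres of \<open>L\<close> in \<open>T\<close> are the translates of the kernel \<open>K\<close> by points of \<open>N\<close>.  Fubini's theorem on \<open>T = N + K\<close>
  integrates over \<open>N\<close>, and the factor \<open>J\<close> of \<open>L\<close> on \<open>N\<close> transports this integral to the target.
\<close>

lemma hausdorff_linear_coarea:
  fixes L :: "'a::euclidean_space \<Rightarrow> 'b::euclidean_space"
  assumes T: "subspace T" and L: "linear L" and onto: "L ` T = UNIV"
  defines "K \<equiv> {t \<in> T. L t = 0}"
  defines "N \<equiv> {t \<in> T. \<forall>k\<in>K. t \<bullet> k = 0}"
  assumes J: "\<And>A. A \<in> sets borel \<Longrightarrow> A \<subseteq> N \<Longrightarrow> \<H> (dim N) (L ` A) = ennreal J * \<H> (dim N) A"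
    and A: "A \<in> sets borel" "A \<subseteq> T"
  shows "(\<lambda>y. \<H> (dim T - DIM('b)) {t \<in> A. L t = y}) \<in> borel_measurable borel"
    and "(\<integral>\<^sup>+y. \<H> (dim T - DIM('b)) {t \<in> A. L t = y} \<partial>lborel) = ennreal J * \<H> (dim T) A"
proof -
  interpret L: linear L by fact
  note kc = kernel_complement[OF T L, folded K_def, folded N_def]
  have dN: "dim N = DIM('b)" using kc(5) onto by simp
  have dK: "dim T - DIM('b) = dim K" using kc(6) dN by simp
  have NT: "N \<subseteq> T" and KT: "K \<subseteq> T" by (auto simp: N_def K_def)
  obtain S where S: "range S \<subseteq> N" "linear S" "\<And>x. x \<in> N \<Longrightarrow> S (L x) = x"
    using linear_exists_left_inverse_on[OF L kc(2,3)] by blast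
  have LS: "L (S y) = y" for y
  proof -
    obtain x where "x \<in> N" "L x = y" using kc(4) onto by (metis UNIV_I imageE)
    then show ?thesis using S(3) by auto
  qed
  have Sb [measurable]: "S \<in> borel_measurable borel"
    by (intro borel_measurable_continuous_onI linear_continuous_on linear_conv_bounded_linear[THEN iffD1] S)
  have Nb [measurable]: "N \<in> sets borel" using kc(2) by (simp add: closed_subspace)
  define g where "g u = \<H> (dim K) {v \<in> K. u + v \<in> A}" for u
  have dec: "\<exists>u\<in>N. \<exists>v\<in>K. t = u + v" if "t \<in> T" for t
    using kc(7)[OF that] orth_proj_in[OF kc(1), of t] by (metis diff_add_cancel)
  have orth: "u \<bullet> v = 0" if "u \<in> N" "v \<in> K" for u v using that by (auto simp: N_def)
  have F: "(\<lambda>u. \<H> (dim K) {v \<in> K. u + v \<in> A}) \<in> borel_measurable borel"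
    "\<H> (dim T) A =
      (\<integral>\<^sup>+u. \<H> (dim K) {v \<in> K. u + v \<in> A} * indicator N u \<partial>hausdorff_measure (real (dim N)))"
    using hausdorff_Fubini(2,3)[of T N K A] T kc(1,2) NT KT orth dec A by blast+
  have g [measurable]: "g \<in> borel_measurable borel" unfolding g_def by (rule F(1))
  have eq: "\<H> (dim T - DIM('b)) {t \<in> A. L t = y} = g (S y)" for y
  proof -
    have "{t \<in> A. L t = y} = (\<lambda>v. v + S y) ` {v \<in> K. S y + v \<in> A}"
    proof (intro equalityI subsetI)
      fix t assume t: "t \<in> {t \<in> A. L t = y}"
      have "S y \<in> T" using S(1) NT by blast
      then have "t - S y \<in> {v \<in> K. S y + v \<in> A}"
        using t A(2) T LS by (auto simp: K_def L.diff intro!: subspace_diff)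
      then show "t \<in> (\<lambda>v. v + S y) ` {v \<in> K. S y + v \<in> A}" by (intro image_eqI[of _ _ "t - S y"]) auto
    next
      fix t assume "t \<in> (\<lambda>v. v + S y) ` {v \<in> K. S y + v \<in> A}"
      then obtain v where v: "v \<in> K" "S y + v \<in> A" "t = v + S y" by blast
      have "L v = 0" using v(1) unfolding K_def by blast
      then show "t \<in> {t \<in> A. L t = y}" using v by (simp add: L.add LS add.commute)
    qed
    then show ?thesis by (simp add: g_def dK hausdorff_outer_translation)
  qed
  show "(\<lambda>y. \<H> (dim T - DIM('b)) {t \<in> A. L t = y}) \<in> borel_measurable borel"
    unfolding eq by measurable
  have push: "distr lborel borel S = density (hausdorff_measure (real (dim N))) (\<lambda>x. ennreal J * indicator N x)"
  proof (rule measure_eqI)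
    fix C assume "C \<in> sets (distr lborel borel S)"
    then have C [measurable]: "C \<in> sets borel" by simp
    have "S -` C = L ` (N \<inter> C)"
    proof (intro equalityI subsetI)
      fix y assume "y \<in> S -` C"
      then show "y \<in> L ` (N \<inter> C)" using S(1) by (intro image_eqI[of _ _ "S y"]) (auto simp: LS)
    next
      fix y assume "y \<in> L ` (N \<inter> C)"
      then show "y \<in> S -` C" using S(3) by auto
    qed
    moreover have "S -` C \<in> sets borel" using measurable_sets[OF Sb C] by simp
    ultimately have "emeasure (distr lborel borel S) C = \<H> (dim N) (L ` (N \<inter> C))"
      by (simp add: emeasure_distr dN hausdorff_measure_DIM_eq_lborel[symmetric] emeasure_hausdorff_measure)
    also have "\<dots> = ennreal J * \<H> (dim N) (N \<inter> C)" by (rule J) auto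
    also have "\<dots> = emeasure (density (hausdorff_measure (real (dim N))) (\<lambda>x. ennreal J * indicator N x)) C"
      by (subst emeasure_density)
         (auto simp: mult.assoc indicator_inter_arith[symmetric] nn_integral_cmult emeasure_hausdorff_measure)
    finally show "emeasure (distr lborel borel S) C = emeasure (density (hausdorff_measure (real (dim N))) (\<lambda>x. ennreal J * indicator N x)) C" .
  qed simp
  have "(\<integral>\<^sup>+y. \<H> (dim T - DIM('b)) {t \<in> A. L t = y} \<partial>lborel) = (\<integral>\<^sup>+u. g u \<partial>distr lborel borel S)"
    unfolding eq by (simp add: nn_integral_distr)
  also have "\<dots> = (\<integral>\<^sup>+u. ennreal J * (g u * indicator N u) \<partial>hausdorff_measure (real (dim N)))"
    unfolding push by (subst nn_integral_density) (auto intro!: nn_integral_cong simp: mult_ac)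
  also have "\<dots> = ennreal J * (\<integral>\<^sup>+u. g u * indicator N u \<partial>hausdorff_measure (real (dim N)))"
    by (subst nn_integral_cmult) auto
  also have "\<dots> = ennreal J * \<H> (dim T) A"
    unfolding g_def by (subst F(2)) simp
  finally show "(\<integral>\<^sup>+y. \<H> (dim T - DIM('b)) {t \<in> A. L t = y} \<partial>lborel) = ennreal J * \<H> (dim T) A" .
qed

section \<open>The tangential Jacobian as an area factor\<close>

lemma compact_sum_segments:
  fixes B :: "'a::real_normed_vector set"
  assumes "finite B"
  shows "compact {\<Sum>b\<in>B. c b *\<^sub>R b | c. \<forall>b\<in>B. 0 \<le> c b \<and> c b \<le> (1::real)}"
  using assms
proof (induction B rule: finite_induct)
  case empty
  then show ?case by simp
next
  case (insert b B)
  let ?P = "\<lambda>B. {\<Sum>b\<in>B. c b *\<^sub>R b | c. \<forall>b\<in>B. 0 \<le> c b \<and> c b \<le> (1::real)}"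
  let ?S = "(\<lambda>t. t *\<^sub>R b) ` {0..1::real}"
  have S: "compact ?S" by (intro compact_continuous_image continuous_intros) auto
  have "?P (insert b B) = {x + y | x y. x \<in> ?S \<and> y \<in> ?P B}"
  proof (intro equalityI subsetI)
    fix z assume "z \<in> ?P (insert b B)"
    then obtain c where c: "z = (\<Sum>b\<in>insert b B. c b *\<^sub>R b)" "\<forall>b\<in>insert b B. 0 \<le> c b \<and> c b \<le> 1" by blast
    then have "z = c b *\<^sub>R b + (\<Sum>b\<in>B. c b *\<^sub>R b)" using insert by simp
    moreover have "c b *\<^sub>R b \<in> ?S" "(\<Sum>b\<in>B. c b *\<^sub>R b) \<in> ?P B" using c(2) by auto
    ultimately show "z \<in> {x + y | x y. x \<in> ?S \<and> y \<in> ?P B}" by blast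
  next
    fix z assume "z \<in> {x + y | x y. x \<in> ?S \<and> y \<in> ?P B}"
    then obtain t c where c: "z = t *\<^sub>R b + (\<Sum>b\<in>B. c b *\<^sub>R b)" "\<forall>b\<in>B. 0 \<le> c b \<and> c b \<le> 1" "0 \<le> t" "t \<le> 1" by auto
    let ?c = "c(b := t)"
    have "(\<Sum>b\<in>B. c b *\<^sub>R b) = (\<Sum>b\<in>B. ?c b *\<^sub>R b)" by (rule sum.cong) (use insert in auto)
    then have "z = (\<Sum>b\<in>insert b B. ?c b *\<^sub>R b)" using c insert by simp
    then show "z \<in> ?P (insert b B)" using c by fastforce
  qed
  then show ?case using compact_sums[OF S insert.IH] by simp
qed

text \<open>
  Positivity: if a parallelepiped were a null set, then so would be its span, which is a countable union of affine images of it.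
\<close>

lemma parallelepiped_measure:
  fixes T :: "'a::euclidean_space set"
  assumes T: "subspace T" and P: "P \<in> parallelepipeds r T"
  shows "P \<subseteq> T" "compact P" "0 < \<H> r P" "\<H> r P < top"
proof -
  obtain a B where aB: "P = {a + (\<Sum>b\<in>B. c b *\<^sub>R b) | c. \<forall>b\<in>B. 0 \<le> c b \<and> c b \<le> 1}"
    "a \<in> T" "B \<subseteq> T" "independent B" "card B = r"
    using P by (auto simp: parallelepipeds_def)
  have fB: "finite B" using aB(4) by (rule independent_imp_finite)
  define P0 where "P0 = {\<Sum>b\<in>B. c b *\<^sub>R b | c. \<forall>b\<in>B. 0 \<le> c b \<and> c b \<le> (1::real)}"
  have PP0: "P = (\<lambda>x. x + a) ` P0" unfolding aB(1) P0_def by (auto simp: add.commute)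
  have P0c: "compact P0" unfolding P0_def by (rule compact_sum_segments[OF fB])
  have P0s: "P0 \<subseteq> span B" unfolding P0_def by (auto intro!: span_sum span_scale intro: span_base)
  have sT: "span B \<subseteq> T" using aB(3) T by (rule span_minimal)
  show "P \<subseteq> T" using P0s sT aB(2) T unfolding PP0 by (auto intro!: subspace_add)
  show "compact P" unfolding PP0 by (intro compact_continuous_image continuous_intros P0c)
  have dB: "dim (span B) = r" using aB(4,5) by (simp add: dim_span dim_eq_card_independent)
  have H: "\<H> r P = \<H> r P0"
    unfolding PP0 by (rule hausdorff_outer_translation)
  show "\<H> r P < top"
    using hausdorff_bounded_subspace_finite[OF subspace_span P0s] P0c dB by (simp add: H compact_imp_bounded)
  show "0 < \<H> r P"
  proof (rule ccontr)
    assume "\<not> 0 < \<H> r P"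
    then have 0: "\<H> r P0 = 0" using H by simp
    \<comment> \<open>\<open>f n\<close> maps \<open>P0\<close> onto the combinations with coefficients in \<open>[-(n+1), n+1]\<close>\<close>
    define f where "f n x = (2 * real (Suc n)) *\<^sub>R x - real (Suc n) *\<^sub>R (\<Sum>b\<in>B. b)" for n x
    have f0: "\<H> r (f n ` P0) = 0" for n
    proof -
      have "\<H> r (f n ` P0) \<le> ennreal ((2 * real (Suc n)) powr real r) * \<H> r P0"
        by (rule hausdorff_outer_Lipschitz_UNIV) (auto simp: f_def dist_norm scaleR_diff_right[symmetric])
      then show ?thesis using 0 by simp
    qed
    have "span B \<subseteq> (\<Union>n. f n ` P0)"
    proof
      fix x assume "x \<in> span B"
      then obtain u where u: "x = (\<Sum>b\<in>B. u b *\<^sub>R b)" using fB by (auto simp: span_finite)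
      obtain n where n: "(\<Sum>b\<in>B. \<bar>u b\<bar>) \<le> real n" using real_arch_simple by blast
      define N where "N = real (Suc n)"
      have N: "N > 0" by (simp add: N_def)
      have ub: "\<bar>u b\<bar> \<le> N" if "b \<in> B" for b
        using member_le_sum[of b B "\<lambda>b. \<bar>u b\<bar>"] that fB n by (auto simp: N_def)
      let ?c = "\<lambda>b. (u b + N) / (2 * N)"
      have inP0: "(\<Sum>b\<in>B. ?c b *\<^sub>R b) \<in> P0"
        unfolding P0_def using ub N by (fastforce simp: field_simps abs_le_iff)
      have "f n (\<Sum>b\<in>B. ?c b *\<^sub>R b) = x"
      proof -
        have "f n (\<Sum>b\<in>B. ?c b *\<^sub>R b) = (\<Sum>b\<in>B. (2 * N * ?c b - N) *\<^sub>R b)"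
        proof -
          have "f n y = (2 * N) *\<^sub>R y - N *\<^sub>R (\<Sum>b\<in>B. b)" for y by (simp only: f_def N_def)
          then show ?thesis
            by (simp only: scaleR_sum_right sum_subtractf[symmetric] scaleR_diff_left scaleR_scaleR)
        qed
        also have "\<dots> = x" unfolding u using N by (intro sum.cong) auto
        finally show ?thesis .
      qed
      then have "x \<in> f n ` P0" using inP0 by (rule image_eqI[OF sym])
      then show "x \<in> (\<Union>n. f n ` P0)" by blast
    qed
    then have "\<H> r (span B) \<le> \<H> r (\<Union>n. f n ` P0)" by (rule hausdorff_outer_mono)
    also have "\<dots> \<le> (\<Sum>n. \<H> r (f n ` P0))" by (rule hausdorff_outer_countably_subadditive)
    also have "\<dots> = 0" by (simp add: f0)
    finally have "\<H> r (span B) = 0" by simp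
    moreover have "span B \<noteq> {}" using span_zero by blast
    ultimately show False
      using hausdorff_open_subspace_pos[OF subspace_span, of B "span B"] dB by simp
  qed
qed

text \<open>
  Subtracting the kernel component does not change the image of a parallelepiped and does not
  increase its measure, so no ratio exceeds \<open>J\<close>; a parallelepiped inside \<open>N\<close> attains it.
\<close>

lemma tangential_jacobian_dim_eq:
  fixes E :: "'a::euclidean_space set" and \<phi> :: "'a \<Rightarrow> 'b::euclidean_space" and x :: 'a
  defines "T \<equiv> tangent_space E x"
  defines "L \<equiv> frechet_derivative \<phi> (at x)"
  defines "K \<equiv> {t \<in> T. L t = 0}"
  defines "N \<equiv> {t \<in> T. \<forall>k\<in>K. t \<bullet> k = 0}"
  assumes T: "subspace T" and L: "linear L" and r: "dim (L ` T) = r" and J0: "J \<ge> 0"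
    and J: "\<And>A. A \<in> sets borel \<Longrightarrow> A \<subseteq> N \<Longrightarrow> \<H> r (L ` A) = ennreal J * \<H> r A"
  shows "tangential_jacobian_dim r E \<phi> x = ennreal J"
proof -
  note kc = kernel_complement[OF T L, folded K_def, folded N_def]
  have NT: "N \<subseteq> T" unfolding N_def by blast
  have cL: "continuous_on S L" for S
    using L by (simp add: linear_continuous_on linear_conv_bounded_linear)
  interpret p: linear "orth_proj K" by (rule linear_orth_proj[OF kc(1)])
  have ratio: "emeasure (hausdorff_measure (real r)) (tangential_jacobian E \<phi> x ` P) / emeasure (hausdorff_measure (real r)) P
      = \<H> r (L ` P) / \<H> r P" if P: "P \<in> parallelepipeds r T" for P
  proof -
    note pm = parallelepiped_measure[OF T P]
    have "tangential_jacobian E \<phi> x ` P = L ` P"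
      using pm(1) unfolding tangential_jacobian_def T_def L_def by (intro image_cong) auto
    moreover have "compact (L ` P)" using pm(2) cL by (intro compact_continuous_image)
    ultimately show ?thesis using pm(2) by (simp add: emeasure_hausdorff_measure borel_compact)
  qed
  show ?thesis
    unfolding tangential_jacobian_dim_def T_def[symmetric]
  proof (rule antisym)
    show "(SUP P\<in>parallelepipeds r T. emeasure (hausdorff_measure (real r)) (tangential_jacobian E \<phi> x ` P) / emeasure (hausdorff_measure (real r)) P) \<le> ennreal J"
    proof (rule SUP_least)
      fix P assume P: "P \<in> parallelepipeds r T"
      note pm = parallelepiped_measure[OF T P]
      let ?q = "\<lambda>t. t - orth_proj K t"
      have "L ` P = L ` ?q ` P" by (simp add: image_image kc(8))
      also have "\<H> r \<dots> = ennreal J * \<H> r (?q ` P)"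
      proof (rule J)
        show "?q ` P \<subseteq> N" using kc(7) pm(1) by auto
        have "continuous_on P ?q"
          by (intro continuous_intros linear_continuous_on p.linear_axioms[unfolded linear_conv_bounded_linear])
        then show "?q ` P \<in> sets borel" using pm(2) by (intro borel_compact compact_continuous_image)
      qed
      also have "\<dots> \<le> ennreal J * (ennreal (1 powr real r) * \<H> r P)"
      proof (intro mult_left_mono hausdorff_outer_Lipschitz_UNIV)
        fix x y :: 'a
        have "(x - y - orth_proj K (x - y)) \<bullet> orth_proj K (x - y) = 0"
          by (rule orth_proj_orthogonal[OF kc(1) orth_proj_in[OF kc(1)]])
        then have "norm (x - y) ^ 2 = norm (x - y - orth_proj K (x - y)) ^ 2 + norm (orth_proj K (x - y)) ^ 2"
          using norm_add_Pythagorean[of "x - y - orth_proj K (x - y)" "orth_proj K (x - y)"] by (simp add: orthogonal_def)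
        then have "norm (x - y - orth_proj K (x - y)) ^ 2 \<le> norm (x - y) ^ 2"
          using zero_le_power2[of "norm (orth_proj K (x - y))"] by linarith
        then have "norm (x - y - orth_proj K (x - y)) \<le> norm (x - y)"
          using norm_ge_zero by (rule power2_le_imp_le)
        moreover have "?q x - ?q y = x - y - orth_proj K (x - y)"
          by (simp add: p.diff)
        ultimately show "dist (?q x) (?q y) \<le> 1 * dist x y"
          by (simp only: dist_norm mult_1)
      qed auto
      finally have "\<H> r (L ` P) / \<H> r P \<le> ennreal J * \<H> r P / \<H> r P"
        by (intro divide_right_mono_ennreal) simp
      also have "\<dots> = ennreal J"
        using pm(3,4) by (simp add: ennreal_mult_divide_eq)
      finally show "emeasure (hausdorff_measure (real r)) (tangential_jacobian E \<phi> x ` P) / emeasure (hausdorff_measure (real r)) P \<le> ennreal J"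
        by (simp add: ratio[OF P])
    qed
    obtain B where B: "B \<subseteq> N" "independent B" "N \<subseteq> span B" "card B = dim N" using basis_exists[of N] by blast
    define P where "P = {0 + (\<Sum>b\<in>B. c b *\<^sub>R b) | c. \<forall>b\<in>B. 0 \<le> c b \<and> c b \<le> (1::real)}"
    have "dim N = r" using kc(5) r by simp
    then have PN: "P \<in> parallelepipeds r N"
      unfolding parallelepipeds_def P_def using B subspace_0[OF kc(2)] by blast
    then have PT: "P \<in> parallelepipeds r T"
      unfolding parallelepipeds_def using NT by blast
    note pm = parallelepiped_measure[OF kc(2) PN]
    have "ennreal J = ennreal J * \<H> r P / \<H> r P"
      using pm(3,4) by (simp add: ennreal_mult_divide_eq)
    also have "\<dots> = \<H> r (L ` P) / \<H> r P"
      using J[of P] pm by (simp add: borel_compact)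
    finally show "ennreal J \<le> (SUP P\<in>parallelepipeds r T. emeasure (hausdorff_measure (real r)) (tangential_jacobian E \<phi> x ` P) / emeasure (hausdorff_measure (real r)) P)"
      using ratio[OF PT] by (intro SUP_upper2[OF PT]) simp
  qed
qed

section \<open>From local approximation to an exact integral formula\<close>

lemma ennreal_le_of_factor_le:
  fixes a b :: ennreal
  assumes "\<And>c::real. c > 1 \<Longrightarrow> a \<le> ennreal (c ^ p) * b"
  shows "a \<le> b"
proof -
  have "(\<lambda>n. (1 + inverse (real (Suc n))) ^ p) \<longlonglongrightarrow> (1 + 0) ^ p"
    by (intro tendsto_intros LIMSEQ_inverse_real_of_nat)
  then have "(\<lambda>n. ennreal ((1 + inverse (real (Suc n))) ^ p)) \<longlonglongrightarrow> ennreal 1"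
    by (intro tendsto_ennrealI) simp
  then have lim: "(\<lambda>n. ennreal ((1 + inverse (real (Suc n))) ^ p) * b) \<longlonglongrightarrow> ennreal 1 * b" if "b < top"
    using that ennreal_tendsto_cmult[of b _ "ennreal 1" sequentially] by (simp add: mult.commute[of _ b])
  show ?thesis
  proof (cases "b < top")
    case True
    have "a \<le> ennreal ((1 + inverse (real (Suc n))) ^ p) * b" for n
      by (rule assms) simp
    then show ?thesis using LIMSEQ_le_const[OF lim[OF True]] by auto
  next
    case False
    then have "b = top" by (metis top.not_eq_extremum)
    then show ?thesis by simp
  qed
qed

text \<open>
  The function \<open>g\<close> is the infimum of the functions \<open>c\<^sub>n\<^sup>p \<cdot> F\<^sub>n\<close> for a sequence \<open>c\<^sub>n\<close> that decreases to 1.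
\<close>

lemma borel_measurable_approx_factor:
  fixes g :: "'y \<Rightarrow> ennreal"
  assumes "\<And>c::real. c > 1 \<Longrightarrow> \<exists>F\<in>borel_measurable M. \<forall>y\<in>space M. F y \<le> ennreal (c ^ p) * g y \<and> g y \<le> ennreal (c ^ p) * F y"
  shows "g \<in> borel_measurable M"
proof -
  have "\<exists>F\<in>borel_measurable M. \<forall>y\<in>space M. F y \<le> ennreal ((1 + inverse (real (Suc n))) ^ p) * g y \<and> g y \<le> ennreal ((1 + inverse (real (Suc n))) ^ p) * F y" for n
    by (rule assms) simp
  then obtain F where F [measurable]: "\<And>n. F n \<in> borel_measurable M"
    and Fg: "\<And>n y. y \<in> space M \<Longrightarrow> F n y \<le> ennreal ((1 + inverse (real (Suc n))) ^ p) * g y"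
      "\<And>n y. y \<in> space M \<Longrightarrow> g y \<le> ennreal ((1 + inverse (real (Suc n))) ^ p) * F n y"
    by metis
  let ?G = "\<lambda>y. INF n. ennreal ((1 + inverse (real (Suc n))) ^ p) * F n y"
  have meas: "?G \<in> borel_measurable M"
    by measurable
  have eq: "?G y = g y" if y: "y \<in> space M" for y
  proof (rule antisym)
    show "g y \<le> (INF n. ennreal ((1 + inverse (real (Suc n))) ^ p) * F n y)"
      by (rule INF_greatest) (rule Fg(2)[OF y])
    show "(INF n. ennreal ((1 + inverse (real (Suc n))) ^ p) * F n y) \<le> g y"
    proof (rule ennreal_le_of_factor_le[where p = "2 * p"])
      fix c :: real assume c: "c > 1"
      obtain n where n: "inverse (real (Suc n)) < c - 1" using reals_Archimedean[of "c - 1"] c by auto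
      have "(INF n. ennreal ((1 + inverse (real (Suc n))) ^ p) * F n y) \<le> ennreal ((1 + inverse (real (Suc n))) ^ p) * F n y"
        by (rule INF_lower) simp
      also have "\<dots> \<le> ennreal ((1 + inverse (real (Suc n))) ^ p) * (ennreal ((1 + inverse (real (Suc n))) ^ p) * g y)"
        by (intro mult_left_mono Fg y) simp
      also have "\<dots> \<le> ennreal (c ^ p) * (ennreal (c ^ p) * g y)"
        using n by (intro mult_mono ennreal_leI power_mono) auto
      also have "\<dots> = ennreal (c ^ (2 * p)) * g y"
        using c by (simp add: mult.assoc[symmetric] ennreal_mult[symmetric] power_add[symmetric] mult_2)
      finally show "(INF n. ennreal ((1 + inverse (real (Suc n))) ^ p) * F n y) \<le> ennreal (c ^ (2 * p)) * g y" .
    qed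
  qed
  show ?thesis using meas measurable_cong[OF eq] by (rule iffD1[rotated])
qed

lemma ennreal_mult_le_trans:
  fixes x y z :: ennreal
  assumes "x \<le> ennreal a * y" "y \<le> ennreal b * z" "0 \<le> a" "0 \<le> b"
  shows "x \<le> ennreal (a * b) * z"
proof -
  have "x \<le> ennreal a * (ennreal b * z)" using assms by (meson mult_left_mono order_trans zero_le)
  then show ?thesis using assms by (simp add: ennreal_mult mult.assoc)
qed

text \<open>
  Think of \<open>\<kappa> y\<close> as the size of a fibre over \<open>y\<close> and of \<open>a\<close> as the total size.  The measurability of \<open>\<kappa>\<close> is itself a consequence of such
  approximations, so the approximate equality of \<open>a\<close> with the integral of \<open>\<kappa>\<close> is expressed through a measurable \<open>F\<close>.
\<close>

definition coarea_approx :: "real \<Rightarrow> 'y measure \<Rightarrow> ('y \<Rightarrow> ennreal) \<Rightarrow> ennreal \<Rightarrow> bool" where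
  "coarea_approx c Q \<kappa> a \<longleftrightarrow> (\<exists>F\<in>borel_measurable Q.
     (\<forall>y\<in>space Q. F y \<le> ennreal c * \<kappa> y \<and> \<kappa> y \<le> ennreal c * F y) \<and>
     (\<integral>\<^sup>+y. F y \<partial>Q) \<le> ennreal c * a \<and> a \<le> ennreal c * (\<integral>\<^sup>+y. F y \<partial>Q))"

text \<open>
  If the coarea formula holds near every point with an error factor \<open>c\<close>, for every \<open>c > 1\<close>, and with a
  constant \<open>J x\<close>, then it holds exactly with the function \<open>J\<close> as weight.  Comparing the approximations
  at two neighbouring points on a common set of positive finite measure shows that \<open>J\<close> varies locally
  by at most a factor \<open>c\<^sup>4\<close>; countably many neighbourhoods cover \<open>E\<close>, and on a partition subordinate to them the
  approximations add up.
\<close>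

lemma coarea_local_to_global:
  fixes E :: "'a::second_countable_topology set" and \<mu> :: "'a measure" and Q :: "'y measure"
    and k :: "'y \<Rightarrow> 'a measure" and J :: "'a \<Rightarrow> ennreal"
  assumes sets [measurable_cong]: "sets \<mu> = sets borel" "\<And>y. sets (k y) = sets borel"
    and E [measurable]: "E \<in> sets borel"
    and loc: "\<And>x c. x \<in> E \<Longrightarrow> c > 1 \<Longrightarrow> \<exists>U. open U \<and> x \<in> U \<and>
      (\<forall>A\<in>sets borel. A \<subseteq> E \<inter> U \<longrightarrow> coarea_approx c Q (\<lambda>y. emeasure (k y) A) (J x * emeasure \<mu> A))"
    and pos: "\<And>x U. x \<in> E \<Longrightarrow> open U \<Longrightarrow> x \<in> U \<Longrightarrow>
      \<exists>A\<in>sets borel. A \<subseteq> E \<inter> U \<and> 0 < emeasure \<mu> A \<and> emeasure \<mu> A < top"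
  shows "(\<lambda>x. J x * indicator E x) \<in> borel_measurable borel"
    and "\<And>A. A \<in> sets borel \<Longrightarrow> A \<subseteq> E \<Longrightarrow> (\<lambda>y. emeasure (k y) A) \<in> borel_measurable Q"
    and "\<And>A. A \<in> sets borel \<Longrightarrow> A \<subseteq> E \<Longrightarrow>
      (\<integral>\<^sup>+y. emeasure (k y) A \<partial>Q) = (\<integral>\<^sup>+x. J x * indicator A x \<partial>\<mu>)"
proof -
  define good where "good c x U \<longleftrightarrow> open U \<and> x \<in> U \<and>
      (\<forall>A\<in>sets borel. A \<subseteq> E \<inter> U \<longrightarrow> coarea_approx c Q (\<lambda>y. emeasure (k y) A) (J x * emeasure \<mu> A))" for c x U
  have goodD: "coarea_approx c Q (\<lambda>y. emeasure (k y) A) (J x * emeasure \<mu> A)"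
    if "good c x U" "A \<in> sets borel" "A \<subseteq> E \<inter> U" for c x U A
    using that(1) unfolding good_def using that(2,3) by (elim conjE) meson
  have good_open: "open U" "x \<in> U" if "good c x U" for c x U
    using that unfolding good_def by simp_all
  have ex_good: "\<exists>U. good c x U" if "x \<in> E" "c > 1" for c x
    using loc[OF that] unfolding good_def .
  have comp1: "J x \<le> ennreal (c ^ 4) * J x'"
    if c: "c > 1" and A: "A \<in> sets borel" "A \<subseteq> E \<inter> (U \<inter> U')" "0 < emeasure \<mu> A" "emeasure \<mu> A < top"
      and U: "good c x U" and U': "good c x' U'" for c x x' A U U'
  proof -
    have AU: "A \<subseteq> E \<inter> U" "A \<subseteq> E \<inter> U'" using A(2) by auto
    obtain F where F: "F \<in> borel_measurable Q"
      "\<And>y. y \<in> space Q \<Longrightarrow> F y \<le> ennreal c * emeasure (k y) A"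
      "\<And>y. y \<in> space Q \<Longrightarrow> emeasure (k y) A \<le> ennreal c * F y"
      "(\<integral>\<^sup>+y. F y \<partial>Q) \<le> ennreal c * (J x * emeasure \<mu> A)"
      "J x * emeasure \<mu> A \<le> ennreal c * (\<integral>\<^sup>+y. F y \<partial>Q)"
      using goodD[OF U A(1) AU(1)] unfolding coarea_approx_def by blast
    obtain F' where F': "F' \<in> borel_measurable Q"
      "\<And>y. y \<in> space Q \<Longrightarrow> F' y \<le> ennreal c * emeasure (k y) A"
      "\<And>y. y \<in> space Q \<Longrightarrow> emeasure (k y) A \<le> ennreal c * F' y"
      "(\<integral>\<^sup>+y. F' y \<partial>Q) \<le> ennreal c * (J x' * emeasure \<mu> A)"
      "J x' * emeasure \<mu> A \<le> ennreal c * (\<integral>\<^sup>+y. F' y \<partial>Q)"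
      using goodD[OF U' A(1) AU(2)] unfolding coarea_approx_def by blast
    have c0: "0 \<le> c" using c by simp
    have "(\<integral>\<^sup>+y. F y \<partial>Q) \<le> (\<integral>\<^sup>+y. ennreal (c * c) * F' y \<partial>Q)"
      by (rule nn_integral_mono) (rule ennreal_mult_le_trans[OF F(2) F'(3) c0 c0])
    also have "\<dots> = ennreal (c * c) * (\<integral>\<^sup>+y. F' y \<partial>Q)" using F'(1) by (rule nn_integral_cmult)
    finally have "(\<integral>\<^sup>+y. F y \<partial>Q) \<le> ennreal (c * c) * (\<integral>\<^sup>+y. F' y \<partial>Q)" .
    from ennreal_mult_le_trans[OF F(5) ennreal_mult_le_trans[OF this F'(4)]]
    have "J x * emeasure \<mu> A \<le> ennreal (c * (c * c * c)) * (J x' * emeasure \<mu> A)" using c0 by simp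
    also have "c * (c * c * c) = c ^ 4" by (simp add: power4_eq_xxxx)
    finally have "emeasure \<mu> A * J x \<le> emeasure \<mu> A * (ennreal (c ^ 4) * J x')" by (simp add: mult_ac)
    then show ?thesis using A(3,4) by (subst (asm) ennreal_mult_le_mult_iff) auto
  qed
  have comp: "J x \<le> ennreal (c ^ 4) * J x' \<and> J x' \<le> ennreal (c ^ 4) * J x"
    if h: "c > 1" "good c x U" "x \<in> E" "x' \<in> E \<inter> U" for c x x' U
  proof -
    obtain U' where U': "good c x' U'" using ex_good h by blast
    then have "open (U \<inter> U')" "x' \<in> U \<inter> U'" using h good_open[OF h(2)] good_open[OF U'] by auto
    then obtain A where A: "A \<in> sets borel" "A \<subseteq> E \<inter> (U \<inter> U')" "0 < emeasure \<mu> A" "emeasure \<mu> A < top"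
      using pos[of x' "U \<inter> U'"] h by blast
    then have A': "A \<subseteq> E \<inter> (U' \<inter> U)" by auto
    show ?thesis using comp1[OF h(1) A h(2) U'] comp1[OF h(1) A(1) A' A(3,4) U' h(2)] by blast
  qed
  have part: "\<exists>(D :: nat \<Rightarrow> 'a set) z U. (\<forall>i. D i \<in> sets borel) \<and> disjoint_family D \<and> (\<Union>i. D i) = E \<and>
      (\<forall>i. D i \<subseteq> E \<inter> U i) \<and> (\<forall>i. z i \<in> E \<and> good c (z i) (U i))" if "c > 1" "E \<noteq> {}" for c
  proof -
    define V where "V x = (SOME U. good c x U)" for x
    have V: "good c x (V x)" if "x \<in> E" for x
      unfolding V_def by (rule someI_ex[OF ex_good[OF that \<open>c > 1\<close>]])
    obtain \<F> where \<F>: "\<F> \<subseteq> V ` E" "countable \<F>" "\<Union>\<F> = \<Union>(V ` E)"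
      using Lindelof[of "V ` E"] good_open(1)[OF V] by auto
    obtain X where X: "countable X" "X \<subseteq> E" "\<F> = V ` X"
      using \<F>(1,2) by (metis countable_subset_image)
    have XE: "E \<subseteq> \<Union>(V ` X)" using \<F>(3) X good_open(2)[OF V] by auto
    then have Xne: "X \<noteq> {}" using \<open>E \<noteq> {}\<close> by auto
    define z where "z = from_nat_into X"
    have rz: "range z = X" unfolding z_def using Xne X(1) by (rule range_from_nat_into)
    define D where "D i = E \<inter> disjointed (\<lambda>i. V (z i)) i" for i
    have zE: "z i \<in> E" for i using rz X(2) by auto
    have "range (\<lambda>i. V (z i)) \<subseteq> sets borel" using good_open(1)[OF V[OF zE]] by auto
    then have "D i \<in> sets borel" for i
      unfolding D_def using sets.range_disjointed_sets[of "\<lambda>i. V (z i)" borel] by auto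
    moreover have "disjoint_family D"
      using disjoint_family_disjointed[of "\<lambda>i. V (z i)"] unfolding disjoint_family_on_def D_def by blast
    moreover have "(\<Union>i. D i) = E"
    proof -
      have "(\<Union>i. D i) = E \<inter> (\<Union>i. disjointed (\<lambda>i. V (z i)) i)" by (auto simp: D_def)
      also have "\<dots> = E \<inter> (\<Union>i. V (z i))" by (simp add: UN_disjointed_eq)
      also have "\<dots> = E" using XE rz by auto
      finally show ?thesis .
    qed
    moreover have "D i \<subseteq> E \<inter> V (z i)" for i using disjointed_subset[of "\<lambda>i. V (z i)" i] by (auto simp: D_def)
    moreover have "z i \<in> E \<and> good c (z i) (V (z i))" for i using zE V by simp
    ultimately show ?thesis
      by - (rule exI[of _ D], rule exI[of _ z], rule exI[of _ "\<lambda>i. V (z i)"], intro conjI allI, simp_all)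
  qed
  show Jm: "(\<lambda>x. J x * indicator E x) \<in> borel_measurable borel"
  proof (rule borel_measurable_approx_factor[where p = 4])
    fix c :: real assume c: "c > 1"
    show "\<exists>F\<in>borel_measurable borel. \<forall>x\<in>space borel. F x \<le> ennreal (c ^ 4) * (J x * indicator E x) \<and>
        J x * indicator E x \<le> ennreal (c ^ 4) * F x"
    proof (cases "E = {}")
      case True
      then show ?thesis by (intro bexI[of _ "\<lambda>_. 0"]) auto
    next
      case False
      obtain D z U where D: "\<And>i::nat. D i \<in> sets borel" "disjoint_family D" "(\<Union>i. D i) = E"
        "\<And>i. D i \<subseteq> E \<inter> U i" "\<And>i. z i \<in> E" "\<And>i. good c (z i) (U i)"
        using part[OF c False] by blast
      let ?F = "\<lambda>x. \<Sum>i. J (z i) * indicator (D i) x"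
      have F: "?F \<in> borel_measurable borel" using D(1) by measurable
      have "?F x \<le> ennreal (c ^ 4) * (J x * indicator E x) \<and> J x * indicator E x \<le> ennreal (c ^ 4) * ?F x" for x
      proof (cases "x \<in> E")
        case True
        then obtain j where j: "x \<in> D j" using D(3) by auto
        have "?F x = (\<Sum>i\<in>{j}. J (z i) * indicator (D i) x)"
        proof (rule suminf_finite)
          fix i assume "i \<notin> {j}"
          then have "x \<notin> D i" using D(2) j unfolding disjoint_family_on_def by blast
          then show "J (z i) * indicator (D i) x = 0" by simp
        qed simp
        then have "?F x = J (z j)" using j by simp
        moreover have "x \<in> E \<inter> U j" using D(4) j by blast
        ultimately show ?thesis using comp[OF c D(6) D(5), of x j] True by simp
      next
        case False
        then have "x \<notin> D i" for i using D(3) by auto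
        then show ?thesis using False by simp
      qed
      then show ?thesis by (intro bexI[OF _ F] ballI)
    qed
  qed
  have main: "coarea_approx (c ^ 5) Q (\<lambda>y. emeasure (k y) A) (\<integral>\<^sup>+x. J x * indicator A x \<partial>\<mu>)"
    if c: "c > 1" and A: "A \<in> sets borel" "A \<subseteq> E" for c A
  proof (cases "E = {}")
    case True
    then have "A = {}" using A by auto
    then show ?thesis unfolding coarea_approx_def by (intro bexI[of _ "\<lambda>_. 0"]) auto
  next
    case False
    obtain D z U where D: "\<And>i::nat. D i \<in> sets borel" "disjoint_family D" "(\<Union>i. D i) = E"
      "\<And>i. D i \<subseteq> E \<inter> U i" "\<And>i. z i \<in> E" "\<And>i. good c (z i) (U i)"
      using part[OF c False] by blast
    define A' where "A' i = A \<inter> D i" for i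
    have A': "A' i \<in> sets borel" "A' i \<subseteq> E \<inter> U i" for i
      using A(1) D(1)[of i] D(4)[of i] by (auto simp: A'_def)
    have A'd: "disjoint_family A'" using D(2) unfolding disjoint_family_on_def A'_def by blast
    have A'U: "(\<Union>i. A' i) = A" using A(2) D(3) by (auto simp: A'_def)
    have "coarea_approx c Q (\<lambda>y. emeasure (k y) (A' i)) (J (z i) * emeasure \<mu> (A' i))" for i
      by (rule goodD[OF D(6) A'])
    then obtain F where Fm [measurable]: "\<And>i. F i \<in> borel_measurable Q"
      and F1: "\<And>i y. y \<in> space Q \<Longrightarrow> F i y \<le> ennreal c * emeasure (k y) (A' i)"
      and F2: "\<And>i y. y \<in> space Q \<Longrightarrow> emeasure (k y) (A' i) \<le> ennreal c * F i y"
      and F3: "\<And>i. (\<integral>\<^sup>+y. F i y \<partial>Q) \<le> ennreal c * (J (z i) * emeasure \<mu> (A' i))"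
      and F4: "\<And>i. J (z i) * emeasure \<mu> (A' i) \<le> ennreal c * (\<integral>\<^sup>+y. F i y \<partial>Q)"
      unfolding coarea_approx_def by metis
    have kA: "(\<Sum>i. emeasure (k y) (A' i)) = emeasure (k y) A" for y
      using A' A'd A'U by (subst suminf_emeasure) (auto simp: sets)
    have JA: "(\<lambda>x. J x * indicator A x) \<in> borel_measurable borel" if "A \<in> sets borel" "A \<subseteq> E" for A
    proof -
      have "(\<lambda>x. J x * indicator A x) = (\<lambda>x. (J x * indicator E x) * indicator A x)"
        using that(2) by (auto simp: fun_eq_iff split: split_indicator)
      then show ?thesis using Jm that(1) by simp
    qed
    have JA': "(\<lambda>x. J x * indicator (A' i) x) \<in> borel_measurable borel" for i
      using A'[of i] by (intro JA) auto
    have c0: "0 \<le> c" "0 \<le> c ^ 4" using c by auto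
    \<comment> \<open>on each piece \<open>J\<close> is constant up to the factor \<open>c\<^sup>4\<close>\<close>
    have near: "x \<in> A' i \<Longrightarrow> J x \<le> ennreal (c ^ 4) * J (z i) \<and> J (z i) \<le> ennreal (c ^ 4) * J x" for x i
      using comp[OF c D(6) D(5), of x i] A'(2)[of i] by blast
    have i1: "(\<integral>\<^sup>+x. J x * indicator (A' i) x \<partial>\<mu>) \<le> ennreal (c ^ 4) * (J (z i) * emeasure \<mu> (A' i))" for i
    proof -
      have "(\<integral>\<^sup>+x. J x * indicator (A' i) x \<partial>\<mu>) \<le> (\<integral>\<^sup>+x. (ennreal (c ^ 4) * J (z i)) * indicator (A' i) x \<partial>\<mu>)"
        using near by (intro nn_integral_mono) (auto split: split_indicator)
      also have "\<dots> = (ennreal (c ^ 4) * J (z i)) * emeasure \<mu> (A' i)"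
        using A'(1)[of i] by (subst nn_integral_cmult_indicator) (auto simp: sets)
      finally show ?thesis by (simp add: mult.assoc)
    qed
    have i2: "J (z i) * emeasure \<mu> (A' i) \<le> ennreal (c ^ 4) * (\<integral>\<^sup>+x. J x * indicator (A' i) x \<partial>\<mu>)" for i
    proof -
      have "J (z i) * emeasure \<mu> (A' i) = (\<integral>\<^sup>+x. J (z i) * indicator (A' i) x \<partial>\<mu>)"
        using A'(1)[of i] by (subst nn_integral_cmult_indicator) (auto simp: sets)
      also have "\<dots> \<le> (\<integral>\<^sup>+x. ennreal (c ^ 4) * (J x * indicator (A' i) x) \<partial>\<mu>)"
        using near by (intro nn_integral_mono) (auto split: split_indicator)
      also have "\<dots> = ennreal (c ^ 4) * (\<integral>\<^sup>+x. J x * indicator (A' i) x \<partial>\<mu>)"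
        using JA'[of i] by (subst nn_integral_cmult) (auto simp: sets cong: measurable_cong_sets)
      finally show ?thesis .
    qed
    have sumJ: "(\<Sum>i. \<integral>\<^sup>+x. J x * indicator (A' i) x \<partial>\<mu>) = (\<integral>\<^sup>+x. J x * indicator A x \<partial>\<mu>)"
    proof -
      have "(\<Sum>i. \<integral>\<^sup>+x. J x * indicator (A' i) x \<partial>\<mu>) = (\<integral>\<^sup>+x. (\<Sum>i. J x * indicator (A' i) x) \<partial>\<mu>)"
        using JA' by (intro nn_integral_suminf[symmetric]) (auto cong: measurable_cong_sets simp: sets)
      also have "\<dots> = (\<integral>\<^sup>+x. J x * indicator A x \<partial>\<mu>)"
        using suminf_indicator[OF A'd] by (simp add: A'U)
      finally show ?thesis .
    qed
    let ?F = "\<lambda>y. \<Sum>i. F i y"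
    have iF: "(\<integral>\<^sup>+y. ?F y \<partial>Q) = (\<Sum>i. \<integral>\<^sup>+y. F i y \<partial>Q)" by (rule nn_integral_suminf) measurable
    have c5: "ennreal c \<le> ennreal (c ^ 5)" using c by (intro ennreal_leI self_le_power) auto
    show ?thesis
      unfolding coarea_approx_def
    proof (intro bexI[of _ ?F] conjI ballI)
      fix y assume y: "y \<in> space Q"
      have "?F y \<le> (\<Sum>i. ennreal c * emeasure (k y) (A' i))" by (intro suminf_le F1 y) auto
      also have "\<dots> = ennreal c * emeasure (k y) A" by (simp add: kA)
      also have "\<dots> \<le> ennreal (c ^ 5) * emeasure (k y) A" by (intro mult_right_mono c5) simp
      finally show "?F y \<le> ennreal (c ^ 5) * emeasure (k y) A" .
      have "(\<Sum>i. emeasure (k y) (A' i)) \<le> (\<Sum>i. ennreal c * F i y)" by (intro suminf_le F2 y) auto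
      then have "emeasure (k y) A \<le> ennreal c * ?F y" by (simp add: kA)
      also have "\<dots> \<le> ennreal (c ^ 5) * ?F y" by (intro mult_right_mono c5) simp
      finally show "emeasure (k y) A \<le> ennreal (c ^ 5) * ?F y" .
    next
      have "(\<integral>\<^sup>+y. F i y \<partial>Q) \<le> ennreal (c ^ 5) * (\<integral>\<^sup>+x. J x * indicator (A' i) x \<partial>\<mu>)" for i
        using ennreal_mult_le_trans[OF F3 i2 c0, of i] by (simp add: power_Suc[symmetric] del: power_Suc)
      then have "(\<Sum>i. \<integral>\<^sup>+y. F i y \<partial>Q) \<le> (\<Sum>i. ennreal (c ^ 5) * (\<integral>\<^sup>+x. J x * indicator (A' i) x \<partial>\<mu>))"
        by (intro suminf_le) auto
      then show "(\<integral>\<^sup>+y. ?F y \<partial>Q) \<le> ennreal (c ^ 5) * (\<integral>\<^sup>+x. J x * indicator A x \<partial>\<mu>)"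
        by (simp add: iF sumJ)
      have "(\<integral>\<^sup>+x. J x * indicator (A' i) x \<partial>\<mu>) \<le> ennreal (c ^ 5) * (\<integral>\<^sup>+y. F i y \<partial>Q)" for i
        using ennreal_mult_le_trans[OF i1 F4 c0(2,1), of i] by (simp add: power_Suc2[symmetric] del: power_Suc)
      then have "(\<Sum>i. \<integral>\<^sup>+x. J x * indicator (A' i) x \<partial>\<mu>) \<le> (\<Sum>i. ennreal (c ^ 5) * (\<integral>\<^sup>+y. F i y \<partial>Q))"
        by (intro suminf_le) auto
      then show "(\<integral>\<^sup>+x. J x * indicator A x \<partial>\<mu>) \<le> ennreal (c ^ 5) * (\<integral>\<^sup>+y. ?F y \<partial>Q)"
        by (simp add: iF sumJ)
    qed measurable
  qed
  show km: "(\<lambda>y. emeasure (k y) A) \<in> borel_measurable Q" if A: "A \<in> sets borel" "A \<subseteq> E" for A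
  proof (rule borel_measurable_approx_factor[where p = 5])
    fix c :: real assume "c > 1"
    then obtain F where F: "F \<in> borel_measurable Q"
      "\<And>y. y \<in> space Q \<Longrightarrow> F y \<le> ennreal (c ^ 5) * emeasure (k y) A"
      "\<And>y. y \<in> space Q \<Longrightarrow> emeasure (k y) A \<le> ennreal (c ^ 5) * F y"
      using main[OF _ A] unfolding coarea_approx_def by blast
    then show "\<exists>F\<in>borel_measurable Q. \<forall>y\<in>space Q.
        F y \<le> ennreal (c ^ 5) * emeasure (k y) A \<and> emeasure (k y) A \<le> ennreal (c ^ 5) * F y"
      by (intro bexI[OF _ F(1)]) simp
  qed
  show "(\<integral>\<^sup>+y. emeasure (k y) A \<partial>Q) = (\<integral>\<^sup>+x. J x * indicator A x \<partial>\<mu>)" if A: "A \<in> sets borel" "A \<subseteq> E" for A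
  proof (rule antisym; rule ennreal_le_of_factor_le[where p = 10])
    fix c :: real assume c: "c > 1"
    have c0: "0 \<le> c ^ 5" and c10: "c ^ 5 * c ^ 5 = c ^ 10" using c by (auto simp: power_add[symmetric])
    obtain F where F: "F \<in> borel_measurable Q" "\<And>y. y \<in> space Q \<Longrightarrow> F y \<le> ennreal (c ^ 5) * emeasure (k y) A"
       "\<And>y. y \<in> space Q \<Longrightarrow> emeasure (k y) A \<le> ennreal (c ^ 5) * F y"
       "(\<integral>\<^sup>+y. F y \<partial>Q) \<le> ennreal (c ^ 5) * (\<integral>\<^sup>+x. J x * indicator A x \<partial>\<mu>)"
       "(\<integral>\<^sup>+x. J x * indicator A x \<partial>\<mu>) \<le> ennreal (c ^ 5) * (\<integral>\<^sup>+y. F y \<partial>Q)"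
      using main[OF c A] unfolding coarea_approx_def by blast
    have "(\<integral>\<^sup>+y. emeasure (k y) A \<partial>Q) \<le> (\<integral>\<^sup>+y. ennreal (c ^ 5) * F y \<partial>Q)" by (rule nn_integral_mono) (rule F(3))
    also have "\<dots> = ennreal (c ^ 5) * (\<integral>\<^sup>+y. F y \<partial>Q)" using F(1) by (rule nn_integral_cmult)
    finally show "(\<integral>\<^sup>+y. emeasure (k y) A \<partial>Q) \<le> ennreal (c ^ 10) * (\<integral>\<^sup>+x. J x * indicator A x \<partial>\<mu>)"
      using ennreal_mult_le_trans[OF _ F(4) c0 c0] c10 by metis
    have "(\<integral>\<^sup>+y. F y \<partial>Q) \<le> (\<integral>\<^sup>+y. ennreal (c ^ 5) * emeasure (k y) A \<partial>Q)" by (rule nn_integral_mono) (rule F(2))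
    also have "\<dots> = ennreal (c ^ 5) * (\<integral>\<^sup>+y. emeasure (k y) A \<partial>Q)" using km[OF A] by (rule nn_integral_cmult)
    finally show "(\<integral>\<^sup>+x. J x * indicator A x \<partial>\<mu>) \<le> ennreal (c ^ 10) * (\<integral>\<^sup>+y. emeasure (k y) A \<partial>Q)"
      using ennreal_mult_le_trans[OF F(5) _ c0 c0] c10 by metis
  qed
qed

text \<open>
  The passage from sets \<open>A\<close> to functions \<open>g\<close>, by induction on the construction of measurable functions.
\<close>

lemma coarea_nn_integral:
  fixes E :: "'a::topological_space set" and \<mu> :: "'a measure" and Q :: "'y measure"
    and k :: "'y \<Rightarrow> 'a measure" and J :: "'a \<Rightarrow> ennreal"
  assumes sets [measurable_cong]: "sets \<mu> = sets borel" "\<And>y. sets (k y) = sets borel"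
    and E [measurable]: "E \<in> sets borel"
    and J [measurable]: "(\<lambda>x. J x * indicator E x) \<in> borel_measurable borel"
    and k: "\<And>A. A \<in> sets borel \<Longrightarrow> A \<subseteq> E \<Longrightarrow> (\<lambda>y. emeasure (k y) A) \<in> borel_measurable Q"
    and int: "\<And>A. A \<in> sets borel \<Longrightarrow> A \<subseteq> E \<Longrightarrow> (\<integral>\<^sup>+y. emeasure (k y) A \<partial>Q) = (\<integral>\<^sup>+x. J x * indicator A x \<partial>\<mu>)"
    and g: "g \<in> borel_measurable borel"
  shows "(\<lambda>y. \<integral>\<^sup>+x. g x * indicator E x \<partial>k y) \<in> borel_measurable Q \<and>
    (\<integral>\<^sup>+y. (\<integral>\<^sup>+x. g x * indicator E x \<partial>k y) \<partial>Q) = (\<integral>\<^sup>+x. g x * (J x * indicator E x) \<partial>\<mu>)"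
  using g
proof (induction rule: borel_measurable_induct)
  case (cong f g)
  then show ?case by (simp add: fun_eq_iff)
next
  case (set A)
  then have [measurable]: "A \<in> sets borel" by simp
  have 1: "(\<integral>\<^sup>+x. indicator A x * indicator E x \<partial>k y) = emeasure (k y) (A \<inter> E)" for y
    by (simp add: indicator_inter_arith[symmetric] sets)
  have 2: "indicator A x * (J x * indicator E x) = J x * indicator (A \<inter> E) x" for x
    by (simp split: split_indicator)
  show ?case using k[of "A \<inter> E"] int[of "A \<inter> E"] by (simp add: 1 2)
next
  case (mult u c)
  then have [measurable]: "u \<in> borel_measurable borel" by simp
  have 1: "(\<integral>\<^sup>+x. c * u x * indicator E x \<partial>k y) = c * (\<integral>\<^sup>+x. u x * indicator E x \<partial>k y)" for y
    by (simp add: mult.assoc nn_integral_cmult)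
  have 2: "(\<integral>\<^sup>+x. c * u x * (J x * indicator E x) \<partial>\<mu>) = c * (\<integral>\<^sup>+x. u x * (J x * indicator E x) \<partial>\<mu>)"
    by (simp add: mult.assoc nn_integral_cmult)
  have m: "(\<lambda>y. \<integral>\<^sup>+x. u x * indicator E x \<partial>k y) \<in> borel_measurable Q" using mult by blast
  then have "(\<lambda>y. c * (\<integral>\<^sup>+x. u x * indicator E x \<partial>k y)) \<in> borel_measurable Q" by measurable
  then show ?case using mult m by (simp add: 1 2 nn_integral_cmult)
next
  case (add u v)
  then have [measurable]: "u \<in> borel_measurable borel" "v \<in> borel_measurable borel" by simp_all
  have 1: "(\<integral>\<^sup>+x. (v x + u x) * indicator E x \<partial>k y) = (\<integral>\<^sup>+x. v x * indicator E x \<partial>k y) + (\<integral>\<^sup>+x. u x * indicator E x \<partial>k y)" for y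
    by (simp add: distrib_right nn_integral_add)
  have 2: "(\<integral>\<^sup>+x. (v x + u x) * (J x * indicator E x) \<partial>\<mu>) = (\<integral>\<^sup>+x. v x * (J x * indicator E x) \<partial>\<mu>) + (\<integral>\<^sup>+x. u x * (J x * indicator E x) \<partial>\<mu>)"
    by (simp add: distrib_right nn_integral_add)
  have m: "(\<lambda>y. \<integral>\<^sup>+x. u x * indicator E x \<partial>k y) \<in> borel_measurable Q"
    "(\<lambda>y. \<integral>\<^sup>+x. v x * indicator E x \<partial>k y) \<in> borel_measurable Q" using add by blast+
  then have "(\<lambda>y. (\<integral>\<^sup>+x. v x * indicator E x \<partial>k y) + (\<integral>\<^sup>+x. u x * indicator E x \<partial>k y)) \<in> borel_measurable Q"
    by (intro borel_measurable_add)
  then show ?case using add m by (simp add: 1 2 nn_integral_add)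
next
  case (seq U)
  then have [measurable]: "\<And>i. U i \<in> borel_measurable borel" by simp
  have inc: "incseq (\<lambda>i x. U i x * h x)" for h :: "'a \<Rightarrow> ennreal"
    using \<open>incseq U\<close> by (auto simp: incseq_def le_fun_def intro!: mult_right_mono)
  have ap: "(SUP i. U i) x = (SUP i. U i x)" for x by (simp add: image_comp)
  have 1: "(\<integral>\<^sup>+x. (SUP i. U i x) * indicator E x \<partial>k y) = (SUP i. \<integral>\<^sup>+x. U i x * indicator E x \<partial>k y)" for y
    using inc by (subst nn_integral_monotone_convergence_SUP[symmetric]) (auto simp: SUP_mult_right_ennreal image_comp)
  have 2: "(\<integral>\<^sup>+x. (SUP i. U i x) * (J x * indicator E x) \<partial>\<mu>) = (SUP i. \<integral>\<^sup>+x. U i x * (J x * indicator E x) \<partial>\<mu>)"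
    using inc by (subst nn_integral_monotone_convergence_SUP[symmetric]) (auto simp: SUP_mult_right_ennreal image_comp)
  have m: "(\<lambda>y. \<integral>\<^sup>+x. U i x * indicator E x \<partial>k y) \<in> borel_measurable Q" for i using seq by blast
  have inc2: "incseq (\<lambda>i y. \<integral>\<^sup>+x. U i x * indicator E x \<partial>k y)"
    using inc by (auto simp: incseq_def le_fun_def intro!: nn_integral_mono)
  have "(\<integral>\<^sup>+y. (SUP i. \<integral>\<^sup>+x. U i x * indicator E x \<partial>k y) \<partial>Q) = (SUP i. \<integral>\<^sup>+y. (\<integral>\<^sup>+x. U i x * indicator E x \<partial>k y) \<partial>Q)"
    using inc2 m by (intro nn_integral_monotone_convergence_SUP) auto
  moreover have "(\<lambda>y. SUP i. \<integral>\<^sup>+x. U i x * indicator E x \<partial>k y) \<in> borel_measurable Q"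
    using m by measurable
  ultimately show ?case using seq.IH by (simp only: ap 1 2)
qed

section \<open>Tangent spaces and charts of a submanifold\<close>

text \<open>
  Continuity of the derivative makes the linear approximation at \<open>p\<close> uniform for pairs of points
  near \<open>p\<close>.  This is what puts charts in the form \<open>near_id\<close>.
\<close>

lemma C1_strict_derivative:
  fixes f :: "'a::euclidean_space \<Rightarrow> 'b::euclidean_space"
  assumes U: "open U" and f': "continuous_on U f'"
    and der: "\<And>x. x \<in> U \<Longrightarrow> (f has_derivative blinfun_apply (f' x)) (at x)"
    and p: "p \<in> U" and \<eta>: "\<eta> > 0"
  obtains \<rho> where "\<rho> > 0" "ball p \<rho> \<subseteq> U"
    "\<And>a b. a \<in> ball p \<rho> \<Longrightarrow> b \<in> ball p \<rho> \<Longrightarrow> norm (f a - f b - blinfun_apply (f' p) (a - b)) \<le> \<eta> * norm (a - b)"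
proof -
  obtain r1 where r1: "r1 > 0" "ball p r1 \<subseteq> U" using U p open_contains_ball by blast
  have "continuous (at p) f'" using f' U p by (simp add: continuous_on_eq_continuous_at)
  then obtain r2 where r2: "r2 > 0" "\<And>y. dist y p < r2 \<Longrightarrow> dist (f' y) (f' p) < \<eta>"
    using \<eta> unfolding continuous_at_eps_delta by blast
  define \<rho> where "\<rho> = min r1 r2"
  have \<rho>: "\<rho> > 0" "ball p \<rho> \<subseteq> U" using r1 r2 by (auto simp: \<rho>_def)
  moreover have "norm (f a - f b - blinfun_apply (f' p) (a - b)) \<le> \<eta> * norm (a - b)"
    if "a \<in> ball p \<rho>" "b \<in> ball p \<rho>" for a b
  proof -
    have "norm (f a - f b - blinfun_apply (f' p) (a - b)) \<le> norm (a - b) * \<eta>"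
    proof (rule differentiable_bound_linearization[where S = "ball p \<rho>"])
      fix t :: real assume "t \<in> {0..1}"
      moreover have "b + t *\<^sub>R (a - b) = (1 - t) *\<^sub>R b + t *\<^sub>R a" by (simp add: algebra_simps)
      ultimately show "b + t *\<^sub>R (a - b) \<in> ball p \<rho>"
        using convexD_alt[OF convex_ball that(2,1), of t] by simp
    next
      fix x assume x: "x \<in> ball p \<rho>"
      show "(f has_derivative blinfun_apply (f' x)) (at x within ball p \<rho>)"
        using der x \<rho>(2) by (meson has_derivative_at_withinI subsetD)
      have "onorm (blinfun_apply (f' x) - blinfun_apply (f' p)) = norm (f' x - f' p)"
        by (simp add: norm_blinfun.rep_eq minus_blinfun.rep_eq fun_diff_def)
      also have "\<dots> \<le> \<eta>" using r2(2)[of x] x by (simp add: dist_norm \<rho>_def norm_minus_commute)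
      finally show "onorm (blinfun_apply (f' x) - blinfun_apply (f' p)) \<le> \<eta>" .
    qed (use \<rho> in auto)
    then show ?thesis by (simp add: mult.commute)
  qed
  ultimately show ?thesis using that by blast
qed

text \<open>
  If \<open>\<Psi>\<close> is a local inverse of a straightening \<open>\<Phi>\<close> onto the subspace \<open>S\<close>, and \<open>D\<close> and \<open>C\<close> are the
  derivatives of \<open>\<Psi>\<close> and \<open>\<Phi>\<close>, then the tangent space is \<open>D ` S\<close>, and \<open>t \<mapsto> \<Psi> (p + C t)\<close> is a chart defined on it whose
  derivative at 0 is the inclusion.
\<close>

lemma submanifold_tangent_chart:
  fixes E :: "'a::euclidean_space set"
  assumes E: "C1_submanifold m E" and x: "x \<in> E"
  shows "subspace (tangent_space E x)" "dim (tangent_space E x) = m"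
    and "\<And>\<delta> V. \<delta> > 0 \<Longrightarrow> open V \<Longrightarrow> x \<in> V \<Longrightarrow>
      \<exists>W f. openin (top_of_set (tangent_space E x)) W \<and> 0 \<in> W \<and> f 0 = x \<and> near_id \<delta> W f \<and>
        f ` W \<subseteq> V \<and> openin (top_of_set E) (f ` W)"
proof -
  obtain U and V :: "'a set" and \<Phi> \<Psi> S where c: "x \<in> U" "C1_map_on U \<Phi>" "C1_map_on V \<Psi>" "homeomorphism U V \<Phi> \<Psi>"
     and S: "subspace S" "dim S = m" and US: "\<Phi> ` (U \<inter> E) = V \<inter> S"
    using bspec[OF E[unfolded C1_submanifold_def] x] by blast
  obtain \<Phi>' where P: "open U" "continuous_on U \<Phi>'" "\<And>x. x \<in> U \<Longrightarrow> (\<Phi> has_derivative blinfun_apply (\<Phi>' x)) (at x)"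
    using c(2) unfolding C1_map_on_def by blast
  obtain \<Psi>' where Q: "open V" "continuous_on V \<Psi>'" "\<And>x. x \<in> V \<Longrightarrow> (\<Psi> has_derivative blinfun_apply (\<Psi>' x)) (at x)"
    using c(3) unfolding C1_map_on_def by blast
  have h: "\<And>u. u \<in> U \<Longrightarrow> \<Psi> (\<Phi> u) = u" "\<And>v. v \<in> V \<Longrightarrow> \<Phi> (\<Psi> v) = v" "\<And>u. u \<in> U \<Longrightarrow> \<Phi> u \<in> V" "\<And>v. v \<in> V \<Longrightarrow> \<Psi> v \<in> U"
    "continuous_on U \<Phi>" "continuous_on V \<Psi>"
    using c(4) unfolding homeomorphism_def by auto
  have \<Psi>E: "\<Psi> v \<in> E" if "v \<in> V" "v \<in> S" for v
  proof -
    have "v \<in> \<Phi> ` (U \<inter> E)" using US that by simp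
    then obtain u where "u \<in> U" "u \<in> E" "v = \<Phi> u" by (elim imageE IntE)
    then show ?thesis using h(1) by simp
  qed
  have \<Phi>S: "\<Phi> u \<in> S" if "u \<in> U" "u \<in> E" for u
  proof -
    have "\<Phi> u \<in> \<Phi> ` (U \<inter> E)" using that by (intro imageI IntI)
    then show ?thesis using US by simp
  qed
  define p where "p = \<Phi> x"
  have p: "p \<in> V" "p \<in> S" "\<Psi> p = x" using h(1,3) c(1) \<Phi>S x by (auto simp: p_def)
  define C where "C = blinfun_apply (\<Phi>' x)"
  define D where "D = blinfun_apply (\<Psi>' p)"
  have C: "(\<Phi> has_derivative C) (at x)" unfolding C_def by (rule P(3)[OF c(1)])
  have D: "(\<Psi> has_derivative D) (at p)" unfolding D_def by (rule Q(3)[OF p(1)])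
  interpret C: linear C using C by (rule has_derivative_linear)
  interpret D: linear D using D by (rule has_derivative_linear)
  have DC: "D (C v) = v" for v
  proof -
    have "(\<Psi> \<circ> \<Phi> has_derivative D \<circ> C) (at x)"
      using C D by (intro diff_chain_at) (auto simp: p_def)
    moreover have "(\<Psi> \<circ> \<Phi> has_derivative id) (at x)"
      by (rule has_derivative_transform_within_open[OF has_derivative_id P(1) c(1)]) (simp add: h(1))
    ultimately show ?thesis by (metis has_derivative_unique comp_apply id_apply)
  qed
  have CD: "C (D v) = v" for v
  proof -
    have "(\<Phi> \<circ> \<Psi> has_derivative C \<circ> D) (at p)"
      using C D p by (intro diff_chain_at) auto
    moreover have "(\<Phi> \<circ> \<Psi> has_derivative id) (at p)"
      by (rule has_derivative_transform_within_open[OF has_derivative_id Q(1) p(1)]) (simp add: h(2))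
    ultimately show ?thesis by (metis has_derivative_unique comp_apply id_apply)
  qed
  have T: "tangent_space E x = D ` S"
  proof (intro equalityI subsetI)
    fix v assume "v \<in> tangent_space E x"
    then obtain \<gamma> \<epsilon> where g: "0 < \<epsilon>" "\<gamma> ` {-\<epsilon><..<\<epsilon>} \<subseteq> E" "\<gamma> 0 = x" "(\<gamma> has_vector_derivative v) (at 0)"
      unfolding tangent_space_def by blast
    \<comment> \<open>\<open>q\<close> vanishes exactly on \<open>S\<close>, hence along \<open>\<Phi> \<circ> \<gamma>\<close>, so it annihilates the derivative of that curve\<close>
    define q where "q y = y - orth_proj S y" for y
    interpret pS: linear "orth_proj S" by (rule linear_orth_proj[OF S(1)])
    have q: "bounded_linear q" unfolding q_def
      using pS.linear_axioms by (intro bounded_linear_sub bounded_linear_ident) (simp add: linear_conv_bounded_linear)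
    have "(\<gamma> has_derivative (\<lambda>t. t *\<^sub>R v)) (at 0)" using g(4) by (simp add: has_vector_derivative_def)
    moreover have "(\<Phi> has_derivative C) (at (\<gamma> 0))" using C g(3) by simp
    ultimately have "(\<Phi> \<circ> \<gamma> has_derivative C \<circ> (\<lambda>t. t *\<^sub>R v)) (at 0)" by (rule diff_chain_at)
    then have d1: "(q \<circ> (\<Phi> \<circ> \<gamma>) has_derivative q \<circ> (C \<circ> (\<lambda>t. t *\<^sub>R v))) (at 0)"
      by (rule diff_chain_at) (rule bounded_linear_imp_has_derivative[OF q])
    have "continuous (at 0) \<gamma>" using g(4) by (rule has_vector_derivative_continuous)
    then have "(\<gamma> \<longlongrightarrow> x) (at 0)" using g(3) by (simp add: continuous_at)
    then have "\<forall>\<^sub>F t in at 0. \<gamma> t \<in> U" using P(1) c(1) by (rule topological_tendstoD)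
    then obtain r where r: "r > 0" "\<And>t. t \<noteq> 0 \<Longrightarrow> dist t 0 < r \<Longrightarrow> \<gamma> t \<in> U"
      unfolding eventually_at by blast
    have z: "(q \<circ> (\<Phi> \<circ> \<gamma>)) t = 0" if "t \<in> ball 0 (min r \<epsilon>)" for t
    proof -
      have "\<gamma> t \<in> U" using r(2)[of t] that g(3) c(1) by (cases "t = 0") auto
      moreover have "\<gamma> t \<in> E" using g(2) that by (auto simp: abs_less_iff image_subset_iff)
      ultimately have "\<Phi> (\<gamma> t) \<in> S" by (rule \<Phi>S)
      then show ?thesis by (simp add: q_def orth_proj_id[OF S(1)])
    qed
    have "((\<lambda>t. 0) has_derivative (\<lambda>t. 0)) (at (0::real))" by simp
    then have d0: "(q \<circ> (\<Phi> \<circ> \<gamma>) has_derivative (\<lambda>t. 0)) (at 0)"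
      by (rule has_derivative_transform_within_open[where s = "ball 0 (min r \<epsilon>)"]) (use z r g in auto)
    have "q \<circ> (C \<circ> (\<lambda>t. t *\<^sub>R v)) = (\<lambda>t. 0)" using d1 d0 by (rule has_derivative_unique)
    from fun_cong[OF this, of 1] have "q (C v) = 0" by simp
    then have "C v \<in> S" using orth_proj_in[OF S(1), of "C v"] by (simp add: q_def)
    then show "v \<in> D ` S" by (intro image_eqI[of _ _ "C v"]) (simp_all add: DC)
  next
    fix v assume "v \<in> D ` S"
    then obtain s where s: "s \<in> S" "v = D s" by auto
    obtain r where r: "r > 0" "ball p r \<subseteq> V" using Q(1) p(1) open_contains_ball by blast
    define \<epsilon> where "\<epsilon> = r / (norm s + 1)"
    have e: "\<epsilon> > 0" using r by (simp add: \<epsilon>_def add_nonneg_pos)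
    have inV: "p + t *\<^sub>R s \<in> V" if "t \<in> {-\<epsilon><..<\<epsilon>}" for t
    proof -
      have "\<bar>t\<bar> * norm s \<le> \<epsilon> * norm s" using that by (intro mult_right_mono) auto
      also have "\<dots> < \<epsilon> * (norm s + 1)" using e by simp
      also have "\<dots> = r" using r by (simp add: \<epsilon>_def add_nonneg_eq_0_iff)
      finally show ?thesis using r(2) by (auto simp: dist_norm subset_iff)
    qed
    have der: "((\<lambda>t. \<Psi> (p + t *\<^sub>R s)) has_vector_derivative blinfun_apply (\<Psi>' (p + t *\<^sub>R s)) s) (at t)" if "t \<in> {-\<epsilon><..<\<epsilon>}" for t
    proof -
      have 1: "((\<lambda>t. p + t *\<^sub>R s) has_derivative (\<lambda>h. h *\<^sub>R s)) (at t)"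
        by (auto intro!: derivative_eq_intros)
      have "((\<lambda>t. \<Psi> (p + t *\<^sub>R s)) has_derivative (\<lambda>h. blinfun_apply (\<Psi>' (p + t *\<^sub>R s)) (h *\<^sub>R s))) (at t)"
        by (rule has_derivative_compose[OF 1 Q(3)[OF inV[OF that]]])
      then show ?thesis by (simp add: has_vector_derivative_def blinfun.scaleR_right)
    qed
    have "continuous_on {-\<epsilon><..<\<epsilon>} (\<lambda>t. blinfun_apply (\<Psi>' (p + t *\<^sub>R s)) s)"
      using inV by (intro continuous_intros continuous_on_compose2[OF Q(2)]) auto
    then have "(\<lambda>t. \<Psi> (p + t *\<^sub>R s)) C1_differentiable_on {-\<epsilon><..<\<epsilon>}"
      unfolding C1_differentiable_on_def
      by (intro exI[of _ "\<lambda>t. blinfun_apply (\<Psi>' (p + t *\<^sub>R s)) s"] conjI ballI der)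
    moreover have "(\<lambda>t. \<Psi> (p + t *\<^sub>R s)) ` {-\<epsilon><..<\<epsilon>} \<subseteq> E"
    proof
      fix y assume "y \<in> (\<lambda>t. \<Psi> (p + t *\<^sub>R s)) ` {-\<epsilon><..<\<epsilon>}"
      then obtain t where t: "t \<in> {-\<epsilon><..<\<epsilon>}" "y = \<Psi> (p + t *\<^sub>R s)" by (elim imageE)
      have "p + t *\<^sub>R s \<in> S" using p(2) s(1) S(1) by (intro subspace_add subspace_scale)
      then show "y \<in> E" using t \<Psi>E[OF inV[OF t(1)]] by simp
    qed
    moreover have "((\<lambda>t. \<Psi> (p + t *\<^sub>R s)) has_vector_derivative v) (at 0)"
      using der[of 0] e s by (simp add: D_def)
    moreover have "\<Psi> (p + 0 *\<^sub>R s) = x" using p by simp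
    ultimately show "v \<in> tangent_space E x" unfolding tangent_space_def using e
      by (intro CollectI exI[of _ "\<lambda>t. \<Psi> (p + t *\<^sub>R s)"] exI[of _ \<epsilon>] conjI)
  qed
  have injD: "inj D" using CD by (metis injI)
  show "subspace (tangent_space E x)" unfolding T using linear_subspace_image[OF D.linear_axioms S(1)] .
  have "dim (D ` S) = dim S"
    using injD by (intro dim_image_eq D.linear_axioms) (auto intro: inj_on_subset)
  then show "dim (tangent_space E x) = m" using T S(2) by simp
  show "\<exists>W f. openin (top_of_set (tangent_space E x)) W \<and> 0 \<in> W \<and> f 0 = x \<and> near_id \<delta> W f \<and>
        f ` W \<subseteq> O' \<and> openin (top_of_set E) (f ` W)" if "\<delta> > 0" "open O'" "x \<in> O'" for \<delta> O'
  proof -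
    obtain K where K: "K > 0" "\<And>v. norm (C v) \<le> K * norm v"
      using linear_bounded_pos[OF C.linear_axioms] by blast
    have "\<delta> / K > 0" using \<open>\<delta> > 0\<close> K by simp
    then obtain \<rho>1 where r1: "\<rho>1 > 0" "ball p \<rho>1 \<subseteq> V"
      "\<And>a b. a \<in> ball p \<rho>1 \<Longrightarrow> b \<in> ball p \<rho>1 \<Longrightarrow> norm (\<Psi> a - \<Psi> b - D (a - b)) \<le> \<delta> / K * norm (a - b)"
      unfolding D_def using C1_strict_derivative[OF Q p(1)] by blast
    have "continuous (at p) \<Psi>" using h(6) Q(1) p(1) by (simp add: continuous_on_eq_continuous_at)
    then have "(\<Psi> \<longlongrightarrow> x) (at p)" using p(3) by (simp add: continuous_at)
    then have "\<forall>\<^sub>F y in at p. \<Psi> y \<in> O'" using that(2,3) by (rule topological_tendstoD)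
    then obtain \<rho>2 where r2: "\<rho>2 > 0" "\<And>y. y \<noteq> p \<Longrightarrow> dist y p < \<rho>2 \<Longrightarrow> \<Psi> y \<in> O'"
      unfolding eventually_at by blast
    define \<rho> where "\<rho> = min \<rho>1 \<rho>2"
    have \<rho>: "\<rho> > 0" "ball p \<rho> \<subseteq> V" using r1 r2 by (auto simp: \<rho>_def)
    have rO: "\<Psi> y \<in> O'" if "y \<in> ball p \<rho>" for y
      using r2(2)[of y] that p(3) \<open>x \<in> O'\<close> by (cases "y = p") (auto simp: \<rho>_def dist_commute)
    define W where "W = D ` S \<inter> {t. norm (C t) < \<rho>}"
    define f where "f t = \<Psi> (p + C t)" for t
    have cC: "continuous_on UNIV C" using C.linear_axioms by (simp add: linear_continuous_on linear_conv_bounded_linear)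
    have W1: "openin (top_of_set (D ` S)) W"
      unfolding W_def by (intro openin_open_Int open_Collect_less continuous_intros cC)
    have "0 \<in> D ` S" using subspace_0[OF linear_subspace_image[OF D.linear_axioms S(1)]] .
    then have W2: "0 \<in> W" unfolding W_def using \<rho> by (simp add: C.zero)
    have W3: "f 0 = x" using p by (simp add: f_def C.zero)
    have inb: "p + C t \<in> ball p \<rho>" if "t \<in> W" for t using that by (simp add: W_def dist_norm)
    have W4: "near_id \<delta> W f"
      unfolding near_id_def
    proof (intro ballI)
      fix s t assume st: "s \<in> W" "t \<in> W"
      have "p + C s \<in> ball p \<rho>1" "p + C t \<in> ball p \<rho>1" using inb st by (auto simp: \<rho>_def)
      then have "norm (f s - f t - D (p + C s - (p + C t))) \<le> \<delta> / K * norm (p + C s - (p + C t))"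
        unfolding f_def by (rule r1(3))
      also have "p + C s - (p + C t) = C (s - t)" by (simp add: C.diff)
      also have "\<delta> / K * norm (C (s - t)) \<le> \<delta> / K * (K * norm (s - t))"
        using K \<open>\<delta> > 0\<close> by (intro mult_left_mono) auto
      finally show "norm (f s - f t - (s - t)) \<le> \<delta> * norm (s - t)" using K by (simp add: DC)
    qed
    have W5: "f ` W \<subseteq> O'" using inb rO by (auto simp: f_def)
    have "f ` W = E \<inter> (U \<inter> \<Phi> -` ball p \<rho>)"
    proof (intro equalityI subsetI)
      fix y assume "y \<in> f ` W"
      then obtain s where s: "s \<in> S" "D s \<in> W" "y = f (D s)" by (auto simp: W_def)
      have b: "p + s \<in> ball p \<rho>" using inb[OF s(2)] by (simp add: CD)
      then have "p + s \<in> V" using \<rho>(2) by blast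
      moreover have "y = \<Psi> (p + s)" using s by (simp add: f_def CD)
      moreover have "p + s \<in> S" using s(1) p(2) S(1) by (simp add: subspace_add)
      ultimately show "y \<in> E \<inter> (U \<inter> \<Phi> -` ball p \<rho>)" using \<Psi>E h b by auto
    next
      fix y assume y: "y \<in> E \<inter> (U \<inter> \<Phi> -` ball p \<rho>)"
      then have "\<Phi> y - p \<in> S" using \<Phi>S p(2) S(1) by (auto intro: subspace_diff)
      moreover have "norm (\<Phi> y - p) < \<rho>" using y by (simp add: dist_norm norm_minus_commute)
      ultimately have "D (\<Phi> y - p) \<in> W" by (simp add: W_def CD)
      moreover have "y = f (D (\<Phi> y - p))" using y h(1) by (simp add: f_def CD)
      ultimately show "y \<in> f ` W" by blast
    qed
    moreover have "open (U \<inter> \<Phi> -` ball p \<rho>)"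
      using continuous_open_preimage[OF h(5) P(1), of "ball p \<rho>"] by simp
    ultimately have W6: "openin (top_of_set E) (f ` W)" by (metis openin_open)
    show ?thesis using W1 W2 W3 W4 W5 W6 T by auto
  qed
qed

text \<open>
  Charts have \<open>\<sigma>\<close>-compact range, and countably many of them cover \<open>E\<close>.  It follows that \<open>E\<close> and \<open>\<phi> ` E\<close>
  are Borel sets.
\<close>

lemma submanifold_sigma_compact:
  fixes E :: "'a::euclidean_space set"
  assumes E: "C1_submanifold m E"
  shows "sigma_compact E"
proof -
  have "\<exists>A. openin (top_of_set E) A \<and> x \<in> A \<and> sigma_compact A" if x: "x \<in> E" for x
  proof -
    note ch = submanifold_tangent_chart[OF E x]
    obtain W f where W: "openin (top_of_set (tangent_space E x)) W" "0 \<in> W" "f 0 = x" "near_id 1 W f" "openin (top_of_set E) (f ` W)"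
      using ch(3)[of 1 UNIV] by auto
    have "sigma_compact (f ` W)"
      by (intro sigma_compact_image sigma_compact_openin_subspace[OF ch(1) W(1)] near_id_continuous[OF W(4)]) simp
    then show ?thesis using W by blast
  qed
  then obtain A where A: "\<And>x. x \<in> E \<Longrightarrow> openin (top_of_set E) (A x) \<and> x \<in> A x \<and> sigma_compact (A x)" by metis
  obtain \<F> where F: "\<F> \<subseteq> A ` E" "countable \<F>" "\<Union>\<F> = \<Union>(A ` E)"
    using Lindelof_openin[of "A ` E" E] A by blast
  have "\<Union>(A ` E) = E" using A openin_imp_subset by blast
  moreover have "sigma_compact (\<Union>\<F>)"
    using F(1) A by (intro sigma_compact_countable_Union[OF F(2)]) blast
  ultimately show ?thesis using F(3) by simp
qed

lemma submanifold_small_positive_set: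
  fixes E :: "'a::euclidean_space set"
  assumes E: "C1_submanifold m E" and x: "x \<in> E" and V: "open V" "x \<in> V"
  shows "\<exists>A\<in>sets borel. A \<subseteq> E \<inter> V \<and> 0 < \<H> m A \<and> \<H> m A < top"
proof -
  note ch = submanifold_tangent_chart[OF E x]
  let ?T = "tangent_space E x"
  obtain W f where W: "openin (top_of_set ?T) W" "0 \<in> W" "near_id (1/2) W f" "f ` W \<subseteq> V" "openin (top_of_set E) (f ` W)"
    using ch(3)[of "1/2", OF _ V] by auto
  define Z where "Z = W \<inter> ball 0 1"
  have Z: "openin (top_of_set ?T) Z" "Z \<subseteq> W" "Z \<noteq> {}"
    using W(1,2) by (auto simp: Z_def intro: openin_Int_open)
  have Zb: "Z \<in> sets borel" by (rule openin_subspace_borel[OF ch(1) Z(1)])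
  have ZT: "Z \<subseteq> ?T" "bounded Z" using openin_imp_subset[OF Z(1)] by (auto simp: Z_def intro: bounded_subset[OF bounded_ball])
  note H = hausdorff_outer_near_id[OF ch(1) W(1,3) _ _ Z(2) Zb, of "real m", simplified]
  have "\<H> m Z < top"
    using hausdorff_bounded_subspace_finite[OF ch(1) ZT] ch(2) by simp
  then have "\<H> m (f ` Z) < top"
    using H(1) by (auto simp: ennreal_mult_less_top intro: le_less_trans)
  moreover have "\<H> m Z > 0"
    using hausdorff_open_subspace_pos[OF ch(1) Z(1,3)] ch(2) by simp
  then have "\<H> m (f ` Z) > 0"
    using H(2) by (cases "\<H> m (f ` Z) = 0") (auto simp: zero_less_iff_neq_zero)
  moreover have "f ` Z \<in> sets borel" by (rule borel_image_near_id[OF ch(1) W(1,3) _ _ Z(2) Zb]) auto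
  moreover have "f ` Z \<subseteq> E \<inter> V" using Z(2) W(4) openin_imp_subset[OF W(5)] by auto
  ultimately show ?thesis by blast
qed

section \<open>Local area and coarea estimates\<close>

lemma exists_small_distortion:
  fixes c :: real
  assumes "c > 1"
  obtains \<delta> where "0 < \<delta>" "\<delta> < 1"
    "\<And>j::nat. j \<le> m \<Longrightarrow> (1 + \<delta>) powr real j \<le> c \<and> (1 / (1 - \<delta>)) powr real j \<le> c"
proof -
  have "((\<lambda>\<delta>. (1 / (1 - \<delta>)) ^ m) \<longlongrightarrow> (1 / (1 - 0)) ^ m) (at_right (0::real))"
    by (intro tendsto_intros) auto
  then have "((\<lambda>\<delta>. (1 / (1 - \<delta>)) ^ m) \<longlongrightarrow> 1) (at_right (0::real))" by simp
  then have "\<forall>\<^sub>F \<delta> in at_right (0::real). (1 / (1 - \<delta>)) ^ m < c"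
    using assms by (rule order_tendstoD(2))
  then obtain b where b: "b > 0" "\<And>\<delta>. 0 < \<delta> \<Longrightarrow> \<delta> < b \<Longrightarrow> (1 / (1 - \<delta>)) ^ m < c"
    unfolding eventually_at_right_field by blast
  define \<delta> where "\<delta> = min (b / 2) (1 / 2)"
  have d: "0 < \<delta>" "\<delta> < 1" "\<delta> < b" using b(1) by (auto simp: \<delta>_def)
  have "(1 + \<delta>) powr real j \<le> c \<and> (1 / (1 - \<delta>)) powr real j \<le> c" if "j \<le> m" for j
  proof -
    have ge: "1 + \<delta> \<le> 1 / (1 - \<delta>)" using d by (simp add: field_simps)
    have "(1 / (1 - \<delta>)) powr real j = (1 / (1 - \<delta>)) ^ j" using d by (simp add: powr_realpow)
    also have "\<dots> \<le> (1 / (1 - \<delta>)) ^ m" using that d by (intro power_increasing) auto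
    also have "\<dots> \<le> c" using b(2)[OF d(1,3)] by simp
    finally have 1: "(1 / (1 - \<delta>)) powr real j \<le> c" .
    have "(1 + \<delta>) powr real j \<le> (1 / (1 - \<delta>)) powr real j"
      using ge d by (intro powr_mono2) auto
    with 1 show ?thesis by simp
  qed
  then show ?thesis using that d by blast
qed

lemma hausdorff_outer_near_id_factor:
  fixes h :: "'a::euclidean_space \<Rightarrow> 'a"
  assumes S: "subspace S" and W: "openin (top_of_set S) W" and h: "near_id \<delta> W h" and d: "0 \<le> \<delta>" "\<delta> < 1"
    and Z: "Z \<subseteq> W" "Z \<in> sets borel"
    and c: "(1 + \<delta>) powr s \<le> c" "(1 / (1 - \<delta>)) powr s \<le> c"
  shows "hausdorff_outer s (h ` Z) \<le> ennreal c * hausdorff_outer s Z"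
    and "hausdorff_outer s Z \<le> ennreal c * hausdorff_outer s (h ` Z)"
  using hausdorff_outer_near_id[OF S W h d Z, of s] c
  by (meson ennreal_leI mult_right_mono order_trans zero_le)+

lemma C1_map_strict_derivative:
  fixes \<phi> :: "'a::euclidean_space \<Rightarrow> 'b::euclidean_space"
  assumes "C1_map_on UNIV \<phi>" "\<eta> > 0"
  obtains \<rho> where "\<rho> > 0"
    "\<And>a b. a \<in> ball x \<rho> \<Longrightarrow> b \<in> ball x \<rho> \<Longrightarrow> norm (\<phi> a - \<phi> b - frechet_derivative \<phi> (at x) (a - b)) \<le> \<eta> * norm (a - b)"
proof -
  obtain \<phi>' where P: "continuous_on UNIV \<phi>'" "\<And>x. x \<in> UNIV \<Longrightarrow> (\<phi> has_derivative blinfun_apply (\<phi>' x)) (at x)"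
    using assms(1) unfolding C1_map_on_def by blast
  have "frechet_derivative \<phi> (at x) = blinfun_apply (\<phi>' x)"
    using frechet_derivative_at[OF P(2)[of x]] by simp
  then show ?thesis
    using C1_strict_derivative[OF open_UNIV P(1) P(2) _ assms(2), of x] that by auto
qed

lemma C1_map_linear_frechet:
  fixes \<phi> :: "'a::euclidean_space \<Rightarrow> 'b::euclidean_space"
  assumes "C1_map_on UNIV \<phi>"
  shows "linear (frechet_derivative \<phi> (at x))"
  using assms unfolding C1_map_on_def by (metis UNIV_I differentiableI linear_frechet_derivative)

lemma C1_map_continuous:
  fixes \<phi> :: "'a::euclidean_space \<Rightarrow> 'b::euclidean_space"
  assumes "C1_map_on UNIV \<phi>"
  shows "continuous_on UNIV \<phi>"
  using assms unfolding C1_map_on_def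
  by (metis UNIV_I continuous_at_imp_continuous_on has_derivative_continuous)

text \<open>
  In a tangent chart \<open>f\<close> at \<open>x\<close>, the map \<open>\<phi> \<circ> f\<close> differs from the derivative of \<open>\<phi>\<close> by a Lipschitz map with small constant.
\<close>

lemma chart_composition_estimate:
  fixes \<phi> :: "'a::euclidean_space \<Rightarrow> 'b::euclidean_space"
  assumes E: "C1_submanifold m E" and x: "x \<in> E" and \<phi>: "C1_map_on UNIV \<phi>" and d: "\<delta> > 0" and e: "\<epsilon> > 0"
  obtains W f U where "openin (top_of_set (tangent_space E x)) W" "0 \<in> W" "f 0 = x" "near_id \<delta> W f"
    "open U" "x \<in> U" "f ` W = E \<inter> U"
    "\<And>s t. s \<in> W \<Longrightarrow> t \<in> W \<Longrightarrow>
       norm (\<phi> (f s) - \<phi> (f t) - frechet_derivative \<phi> (at x) (s - t)) \<le> \<epsilon> * norm (s - t)"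
proof -
  let ?L = "frechet_derivative \<phi> (at x)"
  interpret L: linear ?L by (rule C1_map_linear_frechet[OF \<phi>])
  obtain K where K: "K > 0" "\<And>v. norm (?L v) \<le> K * norm v"
    using linear_bounded_pos[OF L.linear_axioms] by blast
  \<comment> \<open>half of \<open>\<epsilon>\<close> is spent on the error of \<open>\<phi>\<close>, doubled by the distortion of \<open>f\<close>, and half on the error of \<open>f\<close>\<close>
  define \<delta>' where "\<delta>' = min 1 (min \<delta> (\<epsilon> / (2 * K)))"
  have d': "\<delta>' > 0" "\<delta>' \<le> 1" "\<delta>' \<le> \<delta>" "K * \<delta>' \<le> \<epsilon> / 2"
  proof -
    have "K * \<delta>' \<le> K * (\<epsilon> / (2 * K))" using K by (intro mult_left_mono) (auto simp: \<delta>'_def)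
    then show "K * \<delta>' \<le> \<epsilon> / 2" using K by simp
  qed (use d e K in \<open>auto simp: \<delta>'_def\<close>)
  obtain \<rho> where \<rho>: "\<rho> > 0"
    "\<And>a b. a \<in> ball x \<rho> \<Longrightarrow> b \<in> ball x \<rho> \<Longrightarrow> norm (\<phi> a - \<phi> b - ?L (a - b)) \<le> \<epsilon> / 4 * norm (a - b)"
    using C1_map_strict_derivative[OF \<phi>, of "\<epsilon> / 4" x] e by auto
  obtain W f where W: "openin (top_of_set (tangent_space E x)) W" "0 \<in> W" "f 0 = x" "near_id \<delta>' W f"
     "f ` W \<subseteq> ball x \<rho>" "openin (top_of_set E) (f ` W)"
    using submanifold_tangent_chart(3)[OF E x d'(1), of "ball x \<rho>"] \<rho>(1) by auto
  obtain U where U: "open U" "f ` W = E \<inter> U" using W(6) by (auto simp: openin_open)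
  have xU: "x \<in> U" using U(2) W(2,3) by auto
  have "norm (\<phi> (f s) - \<phi> (f t) - ?L (s - t)) \<le> \<epsilon> * norm (s - t)" if "s \<in> W" "t \<in> W" for s t
  proof -
    have "\<phi> (f s) - \<phi> (f t) - ?L (s - t) = (\<phi> (f s) - \<phi> (f t) - ?L (f s - f t)) + ?L (f s - f t - (s - t))"
      by (simp add: L.diff)
    then have "norm (\<phi> (f s) - \<phi> (f t) - ?L (s - t)) \<le> norm (\<phi> (f s) - \<phi> (f t) - ?L (f s - f t)) + norm (?L (f s - f t - (s - t)))"
      by (simp only: norm_triangle_ineq)
    also have "\<dots> \<le> \<epsilon> / 4 * norm (f s - f t) + K * norm (f s - f t - (s - t))"
      using that W(5) by (intro add_mono \<rho>(2) K(2)) auto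
    also have "\<dots> \<le> \<epsilon> / 4 * (2 * norm (s - t)) + K * (\<delta>' * norm (s - t))"
    proof (intro add_mono mult_left_mono)
      have "norm (f s - f t) \<le> (1 + \<delta>') * norm (s - t)"
        using near_id_dist(1)[OF W(4) that] by (simp add: dist_norm)
      also have "\<dots> \<le> 2 * norm (s - t)" using d' by (intro mult_right_mono) auto
      finally show "norm (f s - f t) \<le> 2 * norm (s - t)" .
      show "norm (f s - f t - (s - t)) \<le> \<delta>' * norm (s - t)" using W(4) that by (simp add: near_id_def)
    qed (use e K in auto)
    also have "\<dots> \<le> \<epsilon> * norm (s - t)"
      using mult_right_mono[OF d'(4) norm_ge_zero[of "s - t"]] by (simp add: algebra_simps)
    finally show ?thesis .
  qed
  then show ?thesis using that[OF W(1-3) near_id_mono[OF W(4) d'(3)] U(1) xU U(2)] by blast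
qed

text \<open>
  With \<open>f\<close> a tangent chart and \<open>M\<close> a left inverse of the derivative \<open>L\<close>, the map \<open>\<phi> \<circ> f \<circ> M\<close> is close to
  the identity on an open part of \<open>L ` T\<close>.  So \<open>A\<close>, its preimage \<open>A'\<close> under \<open>f\<close>, the set \<open>L ` A'\<close> and \<open>\<phi> ` A\<close> have measures in the
  ratios 1, 1, \<open>J\<close> and \<open>J\<close>, up to factors close to 1.
\<close>

lemma immersion_local_area:
  fixes \<phi> :: "'a::euclidean_space \<Rightarrow> 'b::euclidean_space"
  assumes E: "C1_submanifold m E" and x: "x \<in> E" and \<phi>: "C1_map_on UNIV \<phi>"
    and inj: "inj_on (frechet_derivative \<phi> (at x)) (tangent_space E x)"
    and J: "\<And>A. A \<in> sets borel \<Longrightarrow> A \<subseteq> tangent_space E x \<Longrightarrow>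
       \<H> m (frechet_derivative \<phi> (at x) ` A) = ennreal J * \<H> m A"
    and c: "c > 1"
  shows "\<exists>U. open U \<and> x \<in> U \<and> (\<forall>A\<in>sets borel. A \<subseteq> E \<inter> U \<longrightarrow> inj_on \<phi> A \<and> \<phi> ` A \<in> sets borel \<and>
     \<H> m (\<phi> ` A) \<le> ennreal c * (ennreal J * \<H> m A) \<and>
     ennreal J * \<H> m A \<le> ennreal c * \<H> m (\<phi> ` A))"
proof -
  let ?L = "frechet_derivative \<phi> (at x)" and ?T = "tangent_space E x"
  note T = submanifold_tangent_chart(1,2)[OF E x]
  have L: "linear ?L" by (rule C1_map_linear_frechet[OF \<phi>])
  interpret L: linear ?L by (rule L)
  obtain M where M: "range M \<subseteq> ?T" "linear M" "\<And>t. t \<in> ?T \<Longrightarrow> M (?L t) = t"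
    using linear_exists_left_inverse_on[OF L T(1) inj] by blast
  interpret M: linear M by (rule M(2))
  obtain K where K: "K > 0" "\<And>v. norm (M v) \<le> K * norm v"
    using linear_bounded_pos[OF M(2)] by blast
  have Lbor: "?L ` A \<in> sets borel" if "A \<in> sets borel" "A \<subseteq> ?T" for A
    using hausdorff_linear_image[OF L T(1) inj] that by metis
  have "sqrt c > 1" using c by simp
  then obtain \<delta> where d: "0 < \<delta>" "\<delta> < 1"
    "\<And>j::nat. j \<le> m \<Longrightarrow> (1 + \<delta>) powr real j \<le> sqrt c \<and> (1 / (1 - \<delta>)) powr real j \<le> sqrt c"
    using exists_small_distortion[of "sqrt c" m] by blast
  have dK: "\<delta> / K > 0" using d K by simp
  obtain W f U where W: "openin (top_of_set ?T) W" "0 \<in> W" "f 0 = x" "near_id \<delta> W f"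
    "open U" "x \<in> U" "f ` W = E \<inter> U"
    "\<And>s t. s \<in> W \<Longrightarrow> t \<in> W \<Longrightarrow> norm (\<phi> (f s) - \<phi> (f t) - ?L (s - t)) \<le> \<delta> / K * norm (s - t)"
    using chart_composition_estimate[OF E x \<phi> d(1) dK] by blast
  have WT: "W \<subseteq> ?T" using openin_imp_subset[OF W(1)] .
  define g where "g = \<phi> \<circ> f \<circ> M"
  have gL: "g (?L t) = \<phi> (f t)" if "t \<in> W" for t using M(3) WT that by (auto simp: g_def)
  have LW: "openin (top_of_set (?L ` ?T)) (?L ` W)"
  proof -
    obtain V where V: "open V" "W = ?T \<inter> V" using W(1) by (auto simp: openin_open)
    have "?L ` W = ?L ` ?T \<inter> M -` V" unfolding V(2) using M(3) by auto
    moreover have "open (M -` V)"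
      using V(1) M(2) by (intro open_vimage linear_continuous_on) (simp_all add: linear_conv_bounded_linear)
    ultimately show ?thesis by (auto simp: openin_open)
  qed
  have LT: "subspace (?L ` ?T)" using linear_subspace_image[OF L T(1)] .
  have g: "near_id \<delta> (?L ` W) g"
    unfolding near_id_def
  proof (intro ballI)
    fix u v assume "u \<in> ?L ` W" "v \<in> ?L ` W"
    then obtain s t where st: "s \<in> W" "t \<in> W" "u = ?L s" "v = ?L t" by blast
    then have "g u - g v - (u - v) = \<phi> (f s) - \<phi> (f t) - ?L (s - t)" by (simp add: gL L.diff)
    then have "norm (g u - g v - (u - v)) \<le> \<delta> / K * norm (s - t)" using W(8) st by simp
    also have "s - t = M (u - v)" using st M(3)[OF subsetD[OF WT]] by (simp add: M.diff)
    also have "\<delta> / K * norm (M (u - v)) \<le> \<delta> / K * (K * norm (u - v))"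
      using dK by (intro mult_left_mono K) auto
    finally show "norm (g u - g v - (u - v)) \<le> \<delta> * norm (u - v)" using K by simp
  qed
  have main: "inj_on \<phi> A \<and> \<phi> ` A \<in> sets borel \<and>
     \<H> m (\<phi> ` A) \<le> ennreal c * (ennreal J * \<H> m A) \<and>
     ennreal J * \<H> m A \<le> ennreal c * \<H> m (\<phi> ` A)"
    if A: "A \<in> sets borel" "A \<subseteq> E \<inter> U" for A
  proof -
    define A' where "A' = {w \<in> W. f w \<in> A}"
    have A'W: "A' \<subseteq> W" by (auto simp: A'_def)
    have A'b: "A' \<in> sets borel"
      unfolding A'_def using d by (intro borel_preimage_near_id[OF T(1) W(1,4)] A) simp
    have fA': "f ` A' = A" using A(2) W(7) by (auto simp: A'_def)
    have A'T: "A' \<subseteq> ?T" using A'W WT by blast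
    define Z where "Z = ?L ` A'"
    have Z: "Z \<subseteq> ?L ` W" "Z \<in> sets borel" using A'W Lbor[OF A'b A'T] by (auto simp: Z_def)
    have gZ: "g ` Z = \<phi> ` A"
    proof -
      have "g ` Z = (\<lambda>t. \<phi> (f t)) ` A'" unfolding Z_def image_image using gL A'W by (intro image_cong) auto
      then show ?thesis using fA' by (metis image_image)
    qed
    have dd: "0 \<le> \<delta>" using d by simp
    have dm: "(1 + \<delta>) powr real m \<le> sqrt c" "(1 / (1 - \<delta>)) powr real m \<le> sqrt c" using d(3)[of m] by auto
    note Hf = hausdorff_outer_near_id_factor[OF T(1) W(1,4) dd d(2) A'W A'b dm, unfolded fA']
    note Hg = hausdorff_outer_near_id_factor[OF LT LW g dd d(2) Z dm, unfolded gZ]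
    have HZ: "\<H> m Z = ennreal J * \<H> m A'"
      unfolding Z_def by (rule J[OF A'b A'T])
    have cc: "ennreal c = ennreal (sqrt c) * ennreal (sqrt c)" using c by (simp add: ennreal_mult[symmetric])
    have "inj_on \<phi> A"
    proof (rule inj_onI)
      fix a b assume "a \<in> A" "b \<in> A" "\<phi> a = \<phi> b"
      then obtain s t where st: "s \<in> W" "t \<in> W" "a = f s" "b = f t" "\<phi> (f s) = \<phi> (f t)"
        using fA' A'W by blast
      then have "g (?L s) = g (?L t)" by (simp add: gL)
      then have "?L s = ?L t" using near_id_inj[OF g d(2)] st by (meson imageI inj_onD)
      then have "s = t" using inj WT st by (meson inj_onD subsetD)
      then show "a = b" using st by simp
    qed
    moreover have "\<phi> ` A \<in> sets borel" using borel_image_near_id[OF LT LW g dd d(2) Z] gZ by simp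
    moreover have "\<H> m (\<phi> ` A) \<le> ennreal c * (ennreal J * \<H> m A)"
    proof -
      have "\<H> m (\<phi> ` A) \<le> ennreal (sqrt c) * (ennreal J * \<H> m A')"
        using Hg(1) HZ by simp
      also have "\<dots> \<le> ennreal (sqrt c) * (ennreal J * (ennreal (sqrt c) * \<H> m A))"
        by (intro mult_left_mono Hf(2)) auto
      finally show ?thesis by (simp add: cc mult_ac)
    qed
    moreover have "ennreal J * \<H> m A \<le> ennreal c * \<H> m (\<phi> ` A)"
    proof -
      have "ennreal J * \<H> m A \<le> ennreal J * (ennreal (sqrt c) * \<H> m A')"
        by (intro mult_left_mono Hf(1)) auto
      also have "\<dots> = ennreal (sqrt c) * \<H> m Z" by (simp add: HZ mult_ac)
      also have "\<dots> \<le> ennreal (sqrt c) * (ennreal (sqrt c) * \<H> m (\<phi> ` A))"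
        by (intro mult_left_mono Hg(2)) auto
      finally show ?thesis by (simp add: cc mult_ac)
    qed
    ultimately show ?thesis by blast
  qed
  show ?thesis using W(5,6) main by (intro exI[of _ U]) simp
qed

text \<open>
  The chart \<open>f\<close> is corrected by the map \<open>G\<close> of the tangent space that replaces the component of \<open>t\<close> along
  \<open>N\<close> by the one that is mapped by \<open>L\<close> to \<open>\<phi> (f t) - \<phi> x\<close>.  Since \<open>G\<close> is close to the identity, so is the chart \<open>h = f \<circ> G\<^sup>-\<^sup>1\<close>, and
  \<open>\<phi> (h u) = \<phi> x + L u\<close> exactly.  Hence \<open>h\<close> carries the fibres of \<open>L\<close> to the fibres of \<open>\<phi>\<close>, and the linear coarea formula applies.
\<close>

lemma submersion_local_coarea:
  fixes \<phi> :: "'a::euclidean_space \<Rightarrow> 'b::euclidean_space"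
  assumes E: "C1_submanifold m E" and x: "x \<in> E" and \<phi>: "C1_map_on UNIV \<phi>"
  defines "L \<equiv> frechet_derivative \<phi> (at x)"
  defines "T \<equiv> tangent_space E x"
  defines "K \<equiv> {t \<in> T. L t = 0}"
  defines "N \<equiv> {t \<in> T. \<forall>k\<in>K. t \<bullet> k = 0}"
  assumes onto: "L ` T = UNIV"
    and J: "\<And>A. A \<in> sets borel \<Longrightarrow> A \<subseteq> N \<Longrightarrow> \<H> (dim N) (L ` A) = ennreal J * \<H> (dim N) A"
    and c: "c > 1"
  shows "\<exists>U. open U \<and> x \<in> U \<and> (\<forall>A\<in>sets borel. A \<subseteq> E \<inter> U \<longrightarrow> coarea_approx c lborel (\<lambda>y. \<H> (m - DIM('b)) (A \<inter> \<phi> -` {y})) (ennreal J * \<H> m A))"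
proof -
  note T = submanifold_tangent_chart(1,2)[OF E x, folded T_def]
  have L: "linear L" unfolding L_def by (rule C1_map_linear_frechet[OF \<phi>])
  interpret L: linear L by (rule L)
  note kc = kernel_complement[OF T(1) L, folded K_def, folded N_def]
  have NT: "N \<subseteq> T" and KT: "K \<subseteq> T" unfolding N_def K_def by blast+
  obtain S where S: "range S \<subseteq> N" "linear S" "\<And>t. t \<in> N \<Longrightarrow> S (L t) = t"
    using linear_exists_left_inverse_on[OF L kc(2,3)] by blast
  interpret S: linear S by (rule S(2))
  interpret p: linear "orth_proj K" by (rule linear_orth_proj[OF kc(1)])
  have LS: "L (S y) = y" for y
  proof -
    have "y \<in> L ` N" using kc(4) onto by simp
    then show ?thesis using S(3) by auto
  qed
  have SL: "S (L t) = t - orth_proj K t" if "t \<in> T" for t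
    using S(3)[OF kc(7)[OF that]] by (simp add: kc(8))
  have LP: "L (orth_proj K t) = 0" for t using orth_proj_in[OF kc(1), of t] unfolding K_def by blast
  obtain KS where KS: "KS > 0" "\<And>v. norm (S v) \<le> KS * norm v"
    using linear_bounded_pos[OF S(2)] by blast
  obtain \<delta> where d: "0 < \<delta>" "\<delta> < 1"
    "\<And>j::nat. j \<le> m \<Longrightarrow> (1 + \<delta>) powr real j \<le> c \<and> (1 / (1 - \<delta>)) powr real j \<le> c"
    using exists_small_distortion[OF c, of m] by blast
  \<comment> \<open>if \<open>f\<close> and \<open>G\<close> are \<open>\<epsilon>\<close>-close to the identity, then \<open>f \<circ> G\<^sup>-\<^sup>1\<close> is \<open>2\<epsilon> / (1 - \<epsilon>)\<close>-close, and this is at most \<open>\<delta>\<close>\<close>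
  define \<epsilon> where "\<epsilon> = \<delta> / 4"
  have e: "\<epsilon> > 0" "\<epsilon> < 1" using d by (auto simp: \<epsilon>_def)
  have eK: "\<epsilon> / KS > 0" using e KS by simp
  obtain W f U where W: "openin (top_of_set T) W" "0 \<in> W" "f 0 = x" "near_id \<epsilon> W f"
    "open U" "x \<in> U" "f ` W = E \<inter> U"
    "\<And>s t. s \<in> W \<Longrightarrow> t \<in> W \<Longrightarrow> norm (\<phi> (f s) - \<phi> (f t) - L (s - t)) \<le> \<epsilon> / KS * norm (s - t)"
    using chart_composition_estimate[OF E x \<phi> e(1) eK] unfolding T_def L_def by blast
  have WT: "W \<subseteq> T" using openin_imp_subset[OF W(1)] .
  define G where "G t = S (\<phi> (f t) - \<phi> x) + orth_proj K t" for t
  have GT: "G ` W \<subseteq> T"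
  proof -
    have "G t \<in> T" for t
      unfolding G_def using S(1) NT KT orth_proj_in[OF kc(1)] by (intro subspace_add[OF T(1)]) blast+
    then show ?thesis by blast
  qed
  have G: "near_id \<epsilon> W G"
    unfolding near_id_def
  proof (intro ballI)
    fix s t assume st: "s \<in> W" "t \<in> W"
    have "s - t \<in> T" using st WT T(1) by (blast intro: subspace_diff)
    then have "S (L (s - t)) = (s - t) - orth_proj K (s - t)" by (rule SL)
    then have "G s - G t - (s - t) = S (\<phi> (f s) - \<phi> (f t) - L (s - t))"
      unfolding G_def S.diff p.diff by simp
    then have "norm (G s - G t - (s - t)) \<le> KS * norm (\<phi> (f s) - \<phi> (f t) - L (s - t))" using KS by simp
    also have "\<dots> \<le> KS * (\<epsilon> / KS * norm (s - t))" using W(8)[OF st] KS by (intro mult_left_mono) auto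
    finally show "norm (G s - G t - (s - t)) \<le> \<epsilon> * norm (s - t)" using KS by simp
  qed
  have LG: "L (G t) = \<phi> (f t) - \<phi> x" for t
    unfolding G_def L.add LS LP by simp
  define W2 where "W2 = G ` W"
  have e0: "0 \<le> \<epsilon>" using e by simp
  have W2: "openin (top_of_set T) W2"
    unfolding W2_def by (rule near_id_openin[OF T(1) W(1) G e0 e(2) GT])
  have W2T: "W2 \<subseteq> T" using GT by (simp add: W2_def)
  define h where "h = f \<circ> inv_into W G"
  have injG: "inj_on G W" by (rule near_id_inj[OF G e(2)])
  have hG: "h (G t) = f t" if "t \<in> W" for t using injG that by (simp add: h_def)
  have h: "near_id \<delta> W2 h"
  proof -
    have "near_id (\<epsilon> / (1 - \<epsilon>) + \<epsilon> * (1 + \<epsilon> / (1 - \<epsilon>))) W2 h"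
      unfolding h_def W2_def
      by (rule near_id_compose[OF W(4) near_id_inverse[OF G e0 e(2)] _ e0]) (auto intro: inv_into_into)
    moreover have "\<epsilon> / (1 - \<epsilon>) + \<epsilon> * (1 + \<epsilon> / (1 - \<epsilon>)) \<le> \<delta>"
    proof -
      have "\<epsilon> / (1 - \<epsilon>) + \<epsilon> * (1 + \<epsilon> / (1 - \<epsilon>)) = 2 * \<epsilon> / (1 - \<epsilon>)"
      proof -
        have "1 + \<epsilon> / (1 - \<epsilon>) = 1 / (1 - \<epsilon>)" using e by (simp add: field_simps)
        then show ?thesis by (simp only: add_divide_distrib[symmetric] times_divide_eq_right) simp
      qed
      also have "\<dots> \<le> 2 * \<epsilon> / (1 / 2)" using d e by (intro divide_left_mono) (auto simp: \<epsilon>_def)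
      also have "\<dots> = \<delta>" by (simp add: \<epsilon>_def)
      finally show ?thesis .
    qed
    ultimately show ?thesis by (rule near_id_mono)
  qed
  have hW2: "h ` W2 = E \<inter> U"
  proof -
    have "h ` W2 = f ` W" unfolding W2_def image_image using hG by (intro image_cong) auto
    then show ?thesis using W(7) by simp
  qed
  have \<phi>h: "\<phi> (h u) = \<phi> x + L u" if "u \<in> W2" for u
    using that hG LG by (auto simp: W2_def)
  have main: "coarea_approx c lborel (\<lambda>y. \<H> (m - DIM('b)) (A \<inter> \<phi> -` {y})) (ennreal J * \<H> m A)"
    if A: "A \<in> sets borel" "A \<subseteq> E \<inter> U" for A
  proof -
    have dd: "0 \<le> \<delta>" using d by simp
    define A' where "A' = {w \<in> W2. h w \<in> A}"
    have A'W: "A' \<subseteq> W2" by (auto simp: A'_def)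
    have A'b: "A' \<in> sets borel"
      unfolding A'_def by (rule borel_preimage_near_id[OF T(1) W2 h dd A(1)])
    have hA': "h ` A' = A" using A(2) hW2 by (auto simp: A'_def)
    have A'T: "A' \<subseteq> T" using A'W W2T by blast
    define \<Theta> where "\<Theta> z = \<H> (m - DIM('b)) {t \<in> A'. L t = z}" for z
    have co: "\<Theta> \<in> borel_measurable borel" "(\<integral>\<^sup>+z. \<Theta> z \<partial>lborel) = ennreal J * \<H> m A'"
      using hausdorff_linear_coarea[OF T(1) L onto J[unfolded N_def K_def] A'b A'T]
      unfolding \<Theta>_def T(2) by auto
    define F where "F y = \<Theta> (y - \<phi> x)" for y
    have Fm: "F \<in> borel_measurable borel"
      unfolding F_def using co(1) by measurable
    have "(\<integral>\<^sup>+y. F y \<partial>lborel) = (\<integral>\<^sup>+z. \<Theta> z \<partial>distr lborel borel ((+) (- \<phi> x)))"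
      using co(1) by (simp add: nn_integral_distr F_def)
    then have IF: "(\<integral>\<^sup>+y. F y \<partial>lborel) = ennreal J * \<H> m A'"
      using co(2) by (simp add: lborel_distr_plus)
    have fac: "\<H> j (h ` Z) \<le> ennreal c * \<H> j Z"
      "\<H> j Z \<le> ennreal c * \<H> j (h ` Z)"
      if "Z \<subseteq> W2" "Z \<in> sets borel" "j \<le> m" for Z j
      using hausdorff_outer_near_id_factor[OF T(1) W2 h dd d(2) that(1,2)] d(3)[OF that(3)] by blast+
    have fib: "A \<inter> \<phi> -` {y} = h ` {t \<in> A'. L t = y - \<phi> x}" for y
    proof -
      have "\<phi> (h t) = y \<longleftrightarrow> L t = y - \<phi> x" if "t \<in> A'" for t
        using \<phi>h[of t] A'W that by (auto simp: algebra_simps)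
      then show ?thesis unfolding hA'[symmetric] by auto
    qed
    have fibb: "{t \<in> A'. L t = z} \<in> sets borel" for z
    proof -
      have "L \<in> borel_measurable borel"
        using L by (intro borel_measurable_continuous_onI linear_continuous_on) (simp add: linear_conv_bounded_linear)
      from measurable_sets[OF this, of "{z}"] have "A' \<inter> L -` {z} \<in> sets borel" using A'b by simp
      then show ?thesis by (simp add: vimage_def Int_def)
    qed
    have fibW: "{t \<in> A'. L t = z} \<subseteq> W2" for z using A'W by blast
    show ?thesis
      unfolding coarea_approx_def
    proof (intro bexI[of _ F] conjI ballI)
      fix y
      show "F y \<le> ennreal c * \<H> (m - DIM('b)) (A \<inter> \<phi> -` {y})"
        unfolding F_def \<Theta>_def fib by (rule fac(2)[OF fibW fibb]) simp
      show "\<H> (m - DIM('b)) (A \<inter> \<phi> -` {y}) \<le> ennreal c * F y"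
        unfolding F_def \<Theta>_def fib by (rule fac(1)[OF fibW fibb]) simp
    next
      have "ennreal J * \<H> m A' \<le> ennreal J * (ennreal c * \<H> m A)"
        using fac(2)[OF A'W A'b order_refl] hA' by (intro mult_left_mono) auto
      then show "(\<integral>\<^sup>+y. F y \<partial>lborel) \<le> ennreal c * (ennreal J * \<H> m A)"
        by (simp add: IF mult_ac)
      have "ennreal J * \<H> m A \<le> ennreal J * (ennreal c * \<H> m A')"
        using fac(1)[OF A'W A'b order_refl] hA' by (intro mult_left_mono) auto
      then show "ennreal J * \<H> m A \<le> ennreal c * (\<integral>\<^sup>+y. F y \<partial>lborel)"
        by (simp add: IF mult_ac)
    qed (use Fm in simp)
  qed
  show ?thesis using W(5,6) main by (intro exI[of _ U]) simp
qed

section \<open>The coarea formula on a submanifold and the density of a statistic\<close>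

text \<open>
  Maximal rank means that the derivative is injective on the tangent space or maps it onto the whole
  target; in both cases the tangential Jacobian is the positive factor of the derivative on \<open>N\<close>.
\<close>

lemma tangential_rank_cases:
  fixes \<phi> :: "'a::euclidean_space \<Rightarrow> 'b::euclidean_space"
  assumes E: "C1_submanifold m E" and x: "x \<in> E" and \<phi>: "C1_map_on UNIV \<phi>"
    and rank: "dim (frechet_derivative \<phi> (at x) ` tangent_space E x) = min m DIM('b)"
  defines "L \<equiv> frechet_derivative \<phi> (at x)"
  defines "T \<equiv> tangent_space E x"
  defines "K \<equiv> {t \<in> T. L t = 0}"
  defines "N \<equiv> {t \<in> T. \<forall>k\<in>K. t \<bullet> k = 0}"
  shows "m \<le> DIM('b) \<Longrightarrow> inj_on L T \<and> N = T"
    and "DIM('b) \<le> m \<Longrightarrow> L ` T = UNIV"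
    and "\<exists>j>0. tangential_jacobian_dim (min m DIM('b)) E \<phi> x = ennreal j \<and> dim N = min m DIM('b) \<and>
      (\<forall>A\<in>sets borel. A \<subseteq> N \<longrightarrow> \<H> (min m DIM('b)) (L ` A) = ennreal j * \<H> (min m DIM('b)) A)"
proof -
  note T = submanifold_tangent_chart(1,2)[OF E x, folded T_def]
  have L: "linear L" unfolding L_def by (rule C1_map_linear_frechet[OF \<phi>])
  interpret L: linear L by (rule L)
  note kc = kernel_complement[OF T(1) L, folded K_def, folded N_def]
  have dN: "dim N = min m DIM('b)" using kc(5) rank unfolding L_def T_def by simp
  show "inj_on L T \<and> N = T" if "m \<le> DIM('b)"
  proof -
    have "dim K = 0" using kc(6) dN T(2) that by simp
    then have K0: "K \<subseteq> {0}" by simp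
    then have "N = T" unfolding N_def by auto
    then show ?thesis using kc(3) by simp
  qed
  show "L ` T = UNIV" if "DIM('b) \<le> m"
  proof -
    have "dim (L ` T) = DIM('b)" using rank that unfolding L_def T_def by simp
    then have "span (L ` T) = UNIV" by (simp add: dim_eq_full)
    moreover have "subspace (L ` T)" by (rule linear_subspace_image[OF L T(1)])
    ultimately show ?thesis by (simp add: span_eq_iff[THEN iffD2])
  qed
  obtain j where j: "j > 0"
    "\<And>A. A \<in> sets borel \<Longrightarrow> A \<subseteq> N \<Longrightarrow> \<H> (dim N) (L ` A) = ennreal j * \<H> (dim N) A"
    using hausdorff_linear_image[OF L kc(2,3)] by metis
  have "tangential_jacobian_dim (min m DIM('b)) E \<phi> x = ennreal j"
    by (rule tangential_jacobian_dim_eq[OF T(1)[unfolded T_def] L[unfolded L_def] rank])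
       (use j dN in \<open>auto simp: N_def K_def T_def L_def\<close>)
  then show "\<exists>j>0. tangential_jacobian_dim (min m DIM('b)) E \<phi> x = ennreal j \<and> dim N = min m DIM('b) \<and>
      (\<forall>A\<in>sets borel. A \<subseteq> N \<longrightarrow> \<H> (min m DIM('b)) (L ` A) = ennreal j * \<H> (min m DIM('b)) A)"
    using j dN by (intro exI[of _ j]) simp
qed

lemma hausdorff_outer_0_inj_fibre:
  fixes A :: "'a::euclidean_space set"
  assumes "inj_on \<phi> A"
  shows "hausdorff_outer 0 (A \<inter> \<phi> -` {y}) = indicator (\<phi> ` A) y"
proof (cases "y \<in> \<phi> ` A")
  case True
  then obtain a where a: "a \<in> A" "\<phi> a = y" by auto
  then have "A \<inter> \<phi> -` {y} = {a}" using assms by (auto dest: inj_onD)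
  then show ?thesis using True by simp
next
  case False
  then have "A \<inter> \<phi> -` {y} = {}" by auto
  then show ?thesis using False by simp
qed

definition fibre_measure :: "nat \<Rightarrow> ('a::euclidean_space \<Rightarrow> 'b) \<Rightarrow> 'b \<Rightarrow> 'a measure" where
  "fibre_measure d \<phi> y = density (hausdorff_measure (real d)) (indicator (\<phi> -` {y}))"

lemma
  fixes \<phi> :: "'a::euclidean_space \<Rightarrow> 'b::euclidean_space"
  shows sets_fibre_measure: "sets (fibre_measure d \<phi> y) = sets borel"
    and emeasure_fibre_measure: "continuous_on UNIV \<phi> \<Longrightarrow> A \<in> sets borel \<Longrightarrow>
      emeasure (fibre_measure d \<phi> y) A = \<H> d (A \<inter> \<phi> -` {y})"
    and nn_integral_fibre_measure: "continuous_on UNIV \<phi> \<Longrightarrow> g \<in> borel_measurable borel \<Longrightarrow>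
      (\<integral>\<^sup>+x. g x \<partial>fibre_measure d \<phi> y) = (\<integral>\<^sup>+x. g x * indicator (\<phi> -` {y}) x \<partial>hausdorff_measure (real d))"
proof -
  show "sets (fibre_measure d \<phi> y) = sets borel" by (simp add: fibre_measure_def)
  assume "continuous_on UNIV \<phi>"
  then have "\<phi> -` {y} \<in> sets borel" by (intro borel_closed closed_vimage) auto
  then show "A \<in> sets borel \<Longrightarrow> emeasure (fibre_measure d \<phi> y) A = \<H> d (A \<inter> \<phi> -` {y})"
    and "g \<in> borel_measurable borel \<Longrightarrow>
      (\<integral>\<^sup>+x. g x \<partial>fibre_measure d \<phi> y) = (\<integral>\<^sup>+x. g x * indicator (\<phi> -` {y}) x \<partial>hausdorff_measure (real d))"
    unfolding fibre_measure_def
    by (auto simp: emeasure_restricted emeasure_hausdorff_measure Int_commute nn_integral_density mult.commute)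
qed

theorem submanifold_coarea:
  fixes \<phi> :: "'a::euclidean_space \<Rightarrow> 'b::euclidean_space" and E :: "'a set"
  assumes E: "C1_submanifold m E" and \<phi>: "C1_map_on UNIV \<phi>"
    and rank: "\<forall>x\<in>E. dim (frechet_derivative \<phi> (at x) ` tangent_space E x) = min m DIM('b)"
  defines "r \<equiv> min m DIM('b)"
  defines "J \<equiv> tangential_jacobian_dim r E \<phi>"
  shows "(\<lambda>x. J x * indicator E x) \<in> borel_measurable borel"
    and "g \<in> borel_measurable borel \<Longrightarrow>
      (\<lambda>y. \<integral>\<^sup>+x. g x * indicator (E \<inter> \<phi> -` {y}) x \<partial>hausdorff_measure (real (m - r))) \<in> borel_measurable borel"
    and "g \<in> borel_measurable borel \<Longrightarrow>
      (\<integral>\<^sup>+y. (\<integral>\<^sup>+x. g x * indicator (E \<inter> \<phi> -` {y}) x \<partial>hausdorff_measure (real (m - r))) \<partial>hausdorff_measure (real r)) =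
      (\<integral>\<^sup>+x. g x * (J x * indicator E x) \<partial>hausdorff_measure (real m))"
proof -
  have c\<phi>: "continuous_on UNIV \<phi>" by (rule C1_map_continuous[OF \<phi>])
  have Eb [measurable]: "E \<in> sets borel" by (rule sigma_compact_borel[OF submanifold_sigma_compact[OF E]])
  let ?k = "fibre_measure (m - r) \<phi>" and ?Q = "hausdorff_measure (real r) :: 'b measure"
  have loc: "\<exists>U. open U \<and> x \<in> U \<and> (\<forall>A\<in>sets borel. A \<subseteq> E \<inter> U \<longrightarrow>
      coarea_approx c ?Q (\<lambda>y. emeasure (?k y) A) (J x * emeasure (hausdorff_measure (real m)) A))"
    if x: "x \<in> E" and c: "c > 1" for x c
  proof -
    note rc = tangential_rank_cases[OF E x \<phi> bspec[OF rank x]]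
    obtain j where j: "j > 0" "J x = ennreal j"
      "dim {t \<in> tangent_space E x. \<forall>k\<in>{t \<in> tangent_space E x. frechet_derivative \<phi> (at x) t = 0}. t \<bullet> k = 0} = r"
      "\<And>A. A \<in> sets borel \<Longrightarrow> A \<subseteq> {t \<in> tangent_space E x. \<forall>k\<in>{t \<in> tangent_space E x. frechet_derivative \<phi> (at x) t = 0}. t \<bullet> k = 0}
         \<Longrightarrow> \<H> r (frechet_derivative \<phi> (at x) ` A) = ennreal j * \<H> r A"
      using rc(3) unfolding J_def r_def by blast
    show ?thesis
    proof (cases "m \<le> DIM('b)")
      case True
      then have rm: "r = m" by (simp add: r_def)
      obtain U where U: "open U" "x \<in> U" and A: "\<And>A. A \<in> sets borel \<Longrightarrow> A \<subseteq> E \<inter> U \<Longrightarrow> inj_on \<phi> A \<and> \<phi> ` A \<in> sets borel \<and>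
         \<H> m (\<phi> ` A) \<le> ennreal c * (ennreal j * \<H> m A) \<and>
         ennreal j * \<H> m A \<le> ennreal c * \<H> m (\<phi> ` A)"
        using immersion_local_area[OF E x \<phi> _ _ c, of j] rc(1)[OF True] j(4) unfolding rm by auto
      have "coarea_approx c ?Q (\<lambda>y. emeasure (?k y) A) (J x * emeasure (hausdorff_measure (real m)) A)"
        if AA: "A \<in> sets borel" "A \<subseteq> E \<inter> U" for A
        unfolding coarea_approx_def
      proof (rule bexI[of _ "indicator (\<phi> ` A)"])
        note A = A[OF AA]
        have "emeasure (?k y) A = indicator (\<phi> ` A) y" for y
          using hausdorff_outer_0_inj_fibre[of \<phi> A y] A by (simp add: emeasure_fibre_measure[OF c\<phi> AA(1)] rm)
        moreover have "indicator (\<phi> ` A) y \<le> ennreal c * indicator (\<phi> ` A) y" for y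
          using c by (auto simp: indicator_def)
        ultimately show "(\<forall>y\<in>space ?Q. indicator (\<phi> ` A) y \<le> ennreal c * emeasure (?k y) A \<and> emeasure (?k y) A \<le> ennreal c * indicator (\<phi> ` A) y) \<and>
         (\<integral>\<^sup>+y. indicator (\<phi> ` A) y \<partial>?Q) \<le> ennreal c * (J x * emeasure (hausdorff_measure (real m)) A) \<and>
         J x * emeasure (hausdorff_measure (real m)) A \<le> ennreal c * (\<integral>\<^sup>+y. indicator (\<phi> ` A) y \<partial>?Q)"
          using A AA(1) by (simp add: emeasure_hausdorff_measure j(2) rm)
        show "indicator (\<phi> ` A) \<in> borel_measurable ?Q" using A by (intro borel_measurable_indicator) simp
      qed
      then show ?thesis using U by (intro exI[of _ U]) simp
    next
      case False
      then have rn: "r = DIM('b)" and nm: "DIM('b) \<le> m" by (simp_all add: r_def)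
      obtain U where U: "open U" "x \<in> U" and A: "\<And>A. A \<in> sets borel \<Longrightarrow> A \<subseteq> E \<inter> U \<Longrightarrow>
          coarea_approx c lborel (\<lambda>y. \<H> (m - DIM('b)) (A \<inter> \<phi> -` {y})) (ennreal j * \<H> m A)"
        using submersion_local_coarea[OF E x \<phi> rc(2)[OF nm] _ c, of j] j(3,4) by auto
      show ?thesis
        using U A by (intro exI[of _ U]) (simp add: hausdorff_measure_DIM_eq_lborel emeasure_fibre_measure[OF c\<phi>] emeasure_hausdorff_measure j(2) rn)
    qed
  qed
  have pos: "\<exists>A\<in>sets borel. A \<subseteq> E \<inter> U \<and> 0 < emeasure (hausdorff_measure (real m)) A \<and> emeasure (hausdorff_measure (real m)) A < top"
    if "x \<in> E" "open U" "x \<in> U" for x U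
    using submanifold_small_positive_set[OF E that] by (auto simp: emeasure_hausdorff_measure)
  show J: "(\<lambda>x. J x * indicator E x) \<in> borel_measurable borel"
    by (rule coarea_local_to_global(1)[OF sets_hausdorff_measure sets_fibre_measure Eb loc pos])
  have km: "(\<lambda>y. emeasure (?k y) A) \<in> borel_measurable ?Q" if "A \<in> sets borel" "A \<subseteq> E" for A
    by (rule coarea_local_to_global(2)[OF sets_hausdorff_measure sets_fibre_measure Eb loc pos that])
  have ki: "(\<integral>\<^sup>+y. emeasure (?k y) A \<partial>?Q) = (\<integral>\<^sup>+x. J x * indicator A x \<partial>hausdorff_measure (real m))"
    if "A \<in> sets borel" "A \<subseteq> E" for A
    by (rule coarea_local_to_global(3)[OF sets_hausdorff_measure sets_fibre_measure Eb loc pos that])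
  assume g: "g \<in> borel_measurable borel"
  have fib: "(\<integral>\<^sup>+x. g x * indicator E x \<partial>?k y) = (\<integral>\<^sup>+x. g x * indicator (E \<inter> \<phi> -` {y}) x \<partial>hausdorff_measure (real (m - r)))" for y
    using g by (simp add: nn_integral_fibre_measure[OF c\<phi>] indicator_inter_arith mult.assoc)
  have *: "(\<lambda>y. \<integral>\<^sup>+x. g x * indicator E x \<partial>?k y) \<in> borel_measurable ?Q \<and>
    (\<integral>\<^sup>+y. (\<integral>\<^sup>+x. g x * indicator E x \<partial>?k y) \<partial>?Q) = (\<integral>\<^sup>+x. g x * (J x * indicator E x) \<partial>hausdorff_measure (real m))"
    by (rule coarea_nn_integral[OF sets_hausdorff_measure sets_fibre_measure Eb J km ki g])
  then show "(\<lambda>y. \<integral>\<^sup>+x. g x * indicator (E \<inter> \<phi> -` {y}) x \<partial>hausdorff_measure (real (m - r))) \<in> borel_measurable borel"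
    by (simp add: fib measurable_cong_sets[OF sets_hausdorff_measure refl])
  from * show "(\<integral>\<^sup>+y. (\<integral>\<^sup>+x. g x * indicator (E \<inter> \<phi> -` {y}) x \<partial>hausdorff_measure (real (m - r))) \<partial>hausdorff_measure (real r)) =
      (\<integral>\<^sup>+x. g x * (J x * indicator E x) \<partial>hausdorff_measure (real m))"
    by (simp add: fib)
qed

text \<open>
  The map is locally injective on \<open>E\<close>, and countably many of the corresponding neighbourhoods cover \<open>E\<close>.
\<close>

lemma immersion_countable_fibre:
  fixes \<phi> :: "'a::euclidean_space \<Rightarrow> 'b::euclidean_space" and E :: "'a set"
  assumes E: "C1_submanifold m E" and \<phi>: "C1_map_on UNIV \<phi>" and m: "m \<le> DIM('b)"
    and rank: "\<forall>x\<in>E. dim (frechet_derivative \<phi> (at x) ` tangent_space E x) = m"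
  shows "countable {x \<in> E. \<phi> x = y}"
proof -
  have Eb: "E \<in> sets borel" by (rule sigma_compact_borel[OF submanifold_sigma_compact[OF E]])
  have "\<exists>U. open U \<and> x \<in> U \<and> inj_on \<phi> (E \<inter> U)" if x: "x \<in> E" for x
  proof -
    have mm: "min m DIM('b) = m" using m by simp
    note rc = tangential_rank_cases[OF E x \<phi>, unfolded mm, OF bspec[OF rank x]]
    obtain j where j: "\<And>A. A \<in> sets borel \<Longrightarrow> A \<subseteq> tangent_space E x
         \<Longrightarrow> \<H> m (frechet_derivative \<phi> (at x) ` A) = ennreal j * \<H> m A"
      using rc(3) rc(1)[OF m] by auto
    obtain U where "open U" "x \<in> U" and U: "\<forall>A\<in>sets borel. A \<subseteq> E \<inter> U \<longrightarrow> inj_on \<phi> A"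
      using immersion_local_area[OF E x \<phi> _ j, of 2] rc(1)[OF m] by auto
    moreover have "E \<inter> U \<in> sets borel" using Eb \<open>open U\<close> by simp
    ultimately show ?thesis by blast
  qed
  then obtain U where U: "\<And>x. x \<in> E \<Longrightarrow> open (U x) \<and> x \<in> U x \<and> inj_on \<phi> (E \<inter> U x)" by metis
  obtain \<F> where F: "\<F> \<subseteq> U ` E" "countable \<F>" "\<Union>\<F> = \<Union>(U ` E)"
    using Lindelof[of "U ` E"] U by blast
  have "countable {x \<in> E \<inter> V. \<phi> x = y}" if "V \<in> \<F>" for V
  proof -
    have inj: "inj_on \<phi> (E \<inter> V)" using that F(1) U by auto
    have "\<exists>a. {x \<in> E \<inter> V. \<phi> x = y} \<subseteq> {a}"
    proof (cases "{x \<in> E \<inter> V. \<phi> x = y} = {}")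
      case False
      then obtain a where "a \<in> E \<inter> V" "\<phi> a = y" by blast
      then show ?thesis using inj by (intro exI[of _ a]) (auto dest: inj_onD)
    qed auto
    then show ?thesis by (meson countable_empty countable_insert countable_subset)
  qed
  then have "countable (\<Union>V\<in>\<F>. {x \<in> E \<inter> V. \<phi> x = y})" using F(2) by (intro countable_UN)
  moreover have "{x \<in> E. \<phi> x = y} \<subseteq> (\<Union>V\<in>\<F>. {x \<in> E \<inter> V. \<phi> x = y})"
  proof
    fix x assume x: "x \<in> {x \<in> E. \<phi> x = y}"
    then have "x \<in> \<Union>\<F>" unfolding F(3) using U by blast
    then show "x \<in> (\<Union>V\<in>\<F>. {x \<in> E \<inter> V. \<phi> x = y})" using x by blast
  qed
  ultimately show ?thesis by (rule countable_subset[rotated])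
qed

text \<open>
  The right-hand side does not mention \<open>\<mu>\<close>, so that any two measures with unit mass at the points of \<open>C\<close> have
  the same integrals over \<open>C\<close>.
\<close>

lemma nn_integral_countable_unit_atoms:
  fixes f :: "'a \<Rightarrow> ennreal"
  assumes C: "countable C" and \<mu>: "\<And>c. c \<in> C \<Longrightarrow> {c} \<in> sets \<mu> \<and> emeasure \<mu> {c} = 1"
  shows "(\<integral>\<^sup>+x. f x * indicator C x \<partial>\<mu>) =
    (\<Sum>n. if n \<in> to_nat_on C ` C then f (from_nat_into C n) else 0)"
proof -
  let ?u = "\<lambda>n x. if n \<in> to_nat_on C ` C then f (from_nat_into C n) * indicator {from_nat_into C n} x else 0"
  have "(\<integral>\<^sup>+x. f x * indicator C x \<partial>\<mu>) = (\<integral>\<^sup>+x. (\<Sum>n. ?u n x) \<partial>\<mu>)"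
  proof (rule nn_integral_cong)
    fix x
    show "f x * indicator C x = (\<Sum>n. ?u n x)"
    proof (cases "x \<in> C")
      case True
      have "(\<Sum>n. ?u n x) = (\<Sum>n\<in>{to_nat_on C x}. ?u n x)"
        by (rule suminf_finite) (use C in \<open>auto simp: indicator_def\<close>)
      then show ?thesis using True C by simp
    next
      case False
      then have "?u n x = 0" for n using C by (auto simp: indicator_def)
      then show ?thesis using False by simp
    qed
  qed
  also have "\<dots> = (\<Sum>n. \<integral>\<^sup>+x. ?u n x \<partial>\<mu>)"
  proof (rule nn_integral_suminf)
    fix n
    show "?u n \<in> borel_measurable \<mu>"
    proof (cases "n \<in> to_nat_on C ` C")
      case True
      then have "{from_nat_into C n} \<in> sets \<mu>" using C \<mu> by auto
      then show ?thesis using True by simp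
    qed simp
  qed
  also have "\<dots> = (\<Sum>n. if n \<in> to_nat_on C ` C then f (from_nat_into C n) else 0)"
  proof (rule suminf_cong)
    fix n
    show "(\<integral>\<^sup>+x. ?u n x \<partial>\<mu>) = (if n \<in> to_nat_on C ` C then f (from_nat_into C n) else 0)"
      using C \<mu> by (auto simp: nn_integral_cmult_indicator)
  qed
  finally show ?thesis .
qed

lemma nn_integral_hausdorff_0_countable:
  fixes f :: "'a::euclidean_space \<Rightarrow> ennreal"
  assumes "countable C"
  shows "(\<integral>\<^sup>+x. f x * indicator C x \<partial>hausdorff_measure 0) = (\<Sum>\<^sub>\<infinity>x\<in>C. f x)"
proof -
  have "(\<integral>\<^sup>+x. f x * indicator C x \<partial>hausdorff_measure 0) = (\<integral>\<^sup>+x. f x * indicator C x \<partial>count_space UNIV)"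
    by (subst (1 2) nn_integral_countable_unit_atoms[OF assms]) (auto simp: emeasure_hausdorff_measure)
  then show ?thesis using infsum_ennreal_eq_nn_integral[OF assms, of f] by simp
qed

text \<open>
  A density with values in \<open>[0, \<infinity>]\<close> has integral 1, so it is finite almost everywhere and can be made real-valued; and a
  density of finite integral is unique almost everywhere.
\<close>

lemma has_density_of_extended_density:
  assumes M: "prob_space M" and Y: "Y \<in> measurable M N" and F: "F \<in> borel_measurable N"
    and d: "distr M N Y = density N F"
  shows "absolutely_continuous N (distr M N Y)"
    and "\<exists>fY. has_density M N Y fY"
    and "has_density M N Y fY \<Longrightarrow> AE y in N. ennreal (fY y) = F y"
proof -
  interpret prob_space M by fact
  show "absolutely_continuous N (distr M N Y)"
    unfolding d by (rule absolutely_continuousI_density[OF F])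
  have "(\<integral>\<^sup>+y. F y \<partial>N) = emeasure (density N F) (space N)"
    using F by (simp add: emeasure_density cong: nn_integral_cong)
  also have "\<dots> = emeasure M (Y -` space N \<inter> space M)"
    unfolding d[symmetric] using Y by (simp add: emeasure_distr)
  also have "\<dots> = 1" using emeasure_space_1 measurable_space[OF Y] by (simp add: vimage_def Int_def conj_commute cong: conj_cong)
  finally have I: "(\<integral>\<^sup>+y. F y \<partial>N) = 1" .
  have fin: "AE y in N. F y \<noteq> \<infinity>" using F I by (intro nn_integral_PInf_AE) auto
  have "density N (\<lambda>y. ennreal (enn2real (F y))) = density N F"
    using F fin by (intro density_cong) (auto elim!: eventually_mono simp: less_top)
  then have "has_density M N Y (\<lambda>y. enn2real (F y))"
    unfolding has_density_def distributed_def using F Y d by simp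
  then show "\<exists>fY. has_density M N Y fY" by blast
  assume "has_density M N Y fY"
  then have "density N F = density N (\<lambda>y. ennreal (fY y))" "(\<lambda>y. ennreal (fY y)) \<in> borel_measurable N"
    unfolding has_density_def distributed_def using d by auto
  then have "AE y in N. F y = ennreal (fY y)"
    using finite_density_unique[of F N "\<lambda>y. ennreal (fY y)"] F I by simp
  then show "AE y in N. ennreal (fY y) = F y" by (auto elim: eventually_mono)
qed

text \<open>
  The coarea formula for \<open>g = fX / J\<close> restricted to \<open>\<phi> -` B\<close>.
\<close>

lemma statistic_density:
  fixes \<phi> :: "'a::euclidean_space \<Rightarrow> 'b::euclidean_space" and E :: "'a set" and fX :: "'a \<Rightarrow> real"
  assumes E: "C1_submanifold m E" and \<phi>: "C1_map_on UNIV \<phi>"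
    and rank: "\<forall>x\<in>E. dim (frechet_derivative \<phi> (at x) ` tangent_space E x) = min m DIM('b)"
    and X: "has_density M (hausdorff_on (real m) E) X fX"
  defines "r \<equiv> min m DIM('b)"
  defines "F \<equiv> (\<lambda>y. \<integral>\<^sup>+x\<in>E \<inter> \<phi> -` {y}. (ennreal (fX x) * (1 / tangential_jacobian_dim r E \<phi> x)) \<partial>hausdorff_measure (real (m - r)))"
  shows "F \<in> borel_measurable borel"
    and "\<phi> \<circ> X \<in> borel_measurable M" and "\<And>\<omega>. \<omega> \<in> space M \<Longrightarrow> X \<omega> \<in> E"
    and "\<And>B. B \<in> sets borel \<Longrightarrow> emeasure M ((\<phi> \<circ> X) -` B \<inter> space M) = (\<integral>\<^sup>+y. F y * indicator B y \<partial>hausdorff_measure (real r))"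
proof -
  let ?H = "hausdorff_measure (real m) :: 'a measure"
  let ?J = "tangential_jacobian_dim r E \<phi>"
  note co = submanifold_coarea[OF E \<phi> rank, folded r_def]
  have Eb [measurable]: "E \<in> sets borel" by (rule sigma_compact_borel[OF submanifold_sigma_compact[OF E]])
  have \<phi>m [measurable]: "\<phi> \<in> borel_measurable borel"
    by (rule borel_measurable_continuous_onI[OF C1_map_continuous[OF \<phi>]])
  have Xd: "distr M (restrict_space ?H E) X = density (restrict_space ?H E) (\<lambda>x. ennreal (fX x))"
    "(\<lambda>x. ennreal (fX x)) \<in> borel_measurable (restrict_space ?H E)" "X \<in> measurable M (restrict_space ?H E)"
    using X unfolding has_density_def distributed_def by auto
  show XE: "X \<omega> \<in> E" if "\<omega> \<in> space M" for \<omega>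
    using measurable_space[OF Xd(3) that] by (simp add: space_restrict_space)
  have Xm: "X \<in> borel_measurable M"
    using measurable_restrict_space2_iff[of X M ?H E] Xd(3) by (simp cong: measurable_cong_sets)
  then show "\<phi> \<circ> X \<in> borel_measurable M" by (rule measurable_comp[OF _ \<phi>m])
  define g where "g x = ennreal (fX x) * indicator E x" for x
  have g [measurable]: "g \<in> borel_measurable borel"
    unfolding g_def using Xd(2) by (simp add: borel_measurable_restrict_space_iff_ennreal cong: measurable_cong_sets)
  have Jm [measurable]: "(\<lambda>x. ?J x * indicator E x) \<in> borel_measurable borel" by (rule co(1))
  \<comment> \<open>only \<open>J \<cdot> 1\<^sub>E\<close> is known to be measurable; off \<open>E\<close> the product is \<open>0 \<cdot> \<infinity> = 0\<close>\<close>
  define w where "w x = g x * (1 / (?J x * indicator E x))" for x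
  have w [measurable]: "w \<in> borel_measurable borel" unfolding w_def by measurable
  have Fw: "F y = (\<integral>\<^sup>+x. w x * indicator (E \<inter> \<phi> -` {y}) x \<partial>hausdorff_measure (real (m - r)))" for y
    unfolding F_def by (rule nn_integral_cong) (auto simp: w_def g_def split: split_indicator)
  show Fm: "F \<in> borel_measurable borel" unfolding Fw by (rule co(2)[OF w])
  fix B :: "'b set" assume B [measurable]: "B \<in> sets borel"
  have \<phi>B [measurable]: "\<phi> -` B \<in> sets borel" using measurable_sets[OF \<phi>m B] by simp
  have "emeasure M ((\<phi> \<circ> X) -` B \<inter> space M) = emeasure M (X -` (E \<inter> \<phi> -` B) \<inter> space M)"
    using XE by (intro arg_cong2[where f = emeasure]) auto
  also have "\<dots> = emeasure (distr M (restrict_space ?H E) X) (E \<inter> \<phi> -` B)"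
    using Xd(3) by (subst emeasure_distr) (auto simp: sets_restrict_space)
  also have "\<dots> = (\<integral>\<^sup>+x. ennreal (fX x) * indicator (E \<inter> \<phi> -` B) x \<partial>restrict_space ?H E)"
    unfolding Xd(1) using Xd(2) by (subst emeasure_density) (auto simp: sets_restrict_space)
  also have "\<dots> = (\<integral>\<^sup>+x. ennreal (fX x) * indicator (E \<inter> \<phi> -` B) x * indicator E x \<partial>?H)"
    by (rule nn_integral_restrict_space) simp
  also have "\<dots> = (\<integral>\<^sup>+x. (w x * indicator (\<phi> -` B) x) * (?J x * indicator E x) \<partial>?H)"
  proof (rule nn_integral_cong)
    fix x
    show "ennreal (fX x) * indicator (E \<inter> \<phi> -` B) x * indicator E x = (w x * indicator (\<phi> -` B) x) * (?J x * indicator E x)"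
    proof (cases "x \<in> E")
      case True
      obtain j where j: "j > 0" "?J x = ennreal j"
        using tangential_rank_cases(3)[OF E True \<phi> bspec[OF rank True]] unfolding r_def by blast
      have "1 / ennreal j * ennreal j = 1"
        using j(1) by (simp add: divide_ennreal ennreal_1[symmetric] ennreal_mult[symmetric] del: ennreal_1)
      then show ?thesis using True by (simp add: w_def g_def j(2) mult.assoc mult.left_commute split: split_indicator)
    qed simp
  qed
  also have "\<dots> = (\<integral>\<^sup>+y. (\<integral>\<^sup>+x. (w x * indicator (\<phi> -` B) x) * indicator (E \<inter> \<phi> -` {y}) x \<partial>hausdorff_measure (real (m - r))) \<partial>hausdorff_measure (real r))"
    by (rule co(3)[symmetric]) measurable
  also have "\<dots> = (\<integral>\<^sup>+y. F y * indicator B y \<partial>hausdorff_measure (real r))"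
  proof (rule nn_integral_cong)
    fix y
    have "(\<integral>\<^sup>+x. (w x * indicator (\<phi> -` B) x) * indicator (E \<inter> \<phi> -` {y}) x \<partial>hausdorff_measure (real (m - r))) =
       (\<integral>\<^sup>+x. (w x * indicator (E \<inter> \<phi> -` {y}) x) * indicator B y \<partial>hausdorff_measure (real (m - r)))"
      by (rule nn_integral_cong) (auto split: split_indicator)
    also have "\<dots> = F y * indicator B y"
      unfolding Fw by (cases "y \<in> B") auto
    finally show "(\<integral>\<^sup>+x. (w x * indicator (\<phi> -` B) x) * indicator (E \<inter> \<phi> -` {y}) x \<partial>hausdorff_measure (real (m - r))) = F y * indicator B y" .
  qed
  finally show "emeasure M ((\<phi> \<circ> X) -` B \<inter> space M) = (\<integral>\<^sup>+y. F y * indicator B y \<partial>hausdorff_measure (real r))" .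
qed

theorem theorem5p2:
  fixes M :: "'w measure"
    and E :: "(real ^ 'k) set" and m :: nat
    and X :: "'w \<Rightarrow> real ^ 'k" and fX :: "real ^ 'k \<Rightarrow> real"
    and \<phi> :: "real ^ 'k \<Rightarrow> real ^ 'n"
  assumes "prob_space M"
    and "C1_submanifold m E"
    and "has_density M (hausdorff_on (real m) E) X fX"
    and "C1_map_on UNIV \<phi>"
    and "\<And>x. x \<in> E \<Longrightarrow>
           dim (tangential_jacobian E \<phi> x ` tangent_space E x) = min m CARD('n)"
  shows
    "(m \<le> CARD('n) \<longrightarrow>
        absolutely_continuous (hausdorff_on (real m) (\<phi> ` E))
          (distr M (hausdorff_on (real m) (\<phi> ` E)) (\<phi> \<circ> X)) \<and>
        (\<exists>fY. has_density M (hausdorff_on (real m) (\<phi> ` E)) (\<phi> \<circ> X) fY) \<and>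
        (\<forall>fY. has_density M (hausdorff_on (real m) (\<phi> ` E)) (\<phi> \<circ> X) fY \<longrightarrow>
          (AE y in hausdorff_on (real m) (\<phi> ` E).
             ennreal (fY y) =
               (\<integral>\<^sup>+x\<in>E \<inter> \<phi> -` {y}. (ennreal (fX x) * (1 / tangential_jacobian_dim m E \<phi> x))
                  \<partial>hausdorff_measure 0) \<and>
             ennreal (fY y) =
               (\<Sum>\<^sub>\<infinity>x\<in>{x \<in> E. \<phi> x = y}. ennreal (fX x) * (1 / tangential_jacobian_dim m E \<phi> x))))) \<and>
     (CARD('n) \<le> m \<longrightarrow>
        absolutely_continuous lborel (distr M lborel (\<phi> \<circ> X)) \<and>
        (\<exists>fY. has_density M lborel (\<phi> \<circ> X) fY) \<and>
        (\<forall>fY. has_density M lborel (\<phi> \<circ> X) fY \<longrightarrow>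
          (AE y in lborel. y \<in> \<phi> ` E \<longrightarrow>
             ennreal (fY y) =
               (\<integral>\<^sup>+x\<in>E \<inter> \<phi> -` {y}. (ennreal (fX x) * (1 / tangential_jacobian_dim CARD('n) E \<phi> x))
                  \<partial>hausdorff_measure (real (m - CARD('n)))))))"
proof -
  note M = assms(1) and E = assms(2) and X = assms(3) and \<phi> = assms(4)
  have rank: "\<forall>x\<in>E. dim (frechet_derivative \<phi> (at x) ` tangent_space E x) = min m DIM(real ^ 'n)"
  proof
    fix x assume x: "x \<in> E"
    have "tangential_jacobian E \<phi> x ` tangent_space E x = frechet_derivative \<phi> (at x) ` tangent_space E x"
      unfolding tangential_jacobian_def by (intro image_cong) auto
    then show "dim (frechet_derivative \<phi> (at x) ` tangent_space E x) = min m DIM(real ^ 'n)"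
      using assms(5)[OF x] by simp
  qed
  note sd = statistic_density[OF E \<phi> rank X]
  show ?thesis
  proof (intro conjI impI)
    assume m: "m \<le> CARD('n)"
    let ?N = "hausdorff_on (real m) (\<phi> ` E)"
    let ?F = "\<lambda>y. \<integral>\<^sup>+x\<in>E \<inter> \<phi> -` {y}. (ennreal (fX x) * (1 / tangential_jacobian_dim m E \<phi> x)) \<partial>hausdorff_measure 0"
    have r: "min m DIM(real ^ 'n) = m" "real (m - m) = 0" using m by simp_all
    note sd = sd[unfolded r]
    have \<phi>E: "\<phi> ` E \<in> sets borel"
      using C1_map_continuous[OF \<phi>] submanifold_sigma_compact[OF E]
      by (intro sigma_compact_borel sigma_compact_image) (auto intro: continuous_on_subset)
    have Y: "\<phi> \<circ> X \<in> measurable M ?N"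
      using sd(2,3) by (intro measurable_restrict_space2) (auto cong: measurable_cong_sets)
    have Fm: "?F \<in> borel_measurable ?N"
      using sd(1) by (intro measurable_restrict_space1) (simp cong: measurable_cong_sets)
    have d: "distr M ?N (\<phi> \<circ> X) = density ?N ?F"
    proof (rule measure_eqI)
      fix B assume "B \<in> sets (distr M ?N (\<phi> \<circ> X))"
      then have B: "B \<in> sets ?N" "B \<in> sets borel" "B \<subseteq> \<phi> ` E"
        using \<phi>E by (auto simp: sets_restrict_space)
      have "emeasure (distr M ?N (\<phi> \<circ> X)) B = (\<integral>\<^sup>+y. ?F y * indicator B y \<partial>hausdorff_measure (real m))"
        using sd(4)[OF B(2)] Y B(1) by (simp add: emeasure_distr)
      also have "\<dots> = (\<integral>\<^sup>+y. ?F y * indicator B y * indicator (\<phi> ` E) y \<partial>hausdorff_measure (real m))"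
        using B(3) by (intro nn_integral_cong) (auto split: split_indicator)
      also have "\<dots> = (\<integral>\<^sup>+y. ?F y * indicator B y \<partial>?N)"
        using \<phi>E by (intro nn_integral_restrict_space[symmetric]) simp
      also have "\<dots> = emeasure (density ?N ?F) B"
        using Fm B(1) by (rule emeasure_density[symmetric])
      finally show "emeasure (distr M ?N (\<phi> \<circ> X)) B = emeasure (density ?N ?F) B" .
    qed simp
    note dens = has_density_of_extended_density[OF M Y Fm d]
    show "absolutely_continuous ?N (distr M ?N (\<phi> \<circ> X))" by (rule dens(1))
    show "\<exists>fY. has_density M ?N (\<phi> \<circ> X) fY" by (rule dens(2))
    have sum: "?F y = (\<Sum>\<^sub>\<infinity>x\<in>{x \<in> E. \<phi> x = y}. ennreal (fX x) * (1 / tangential_jacobian_dim m E \<phi> x))" for y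
    proof -
      have "countable {x \<in> E. \<phi> x = y}"
        by (rule immersion_countable_fibre[OF E \<phi>]) (use m rank in auto)
      moreover have "E \<inter> \<phi> -` {y} = {x \<in> E. \<phi> x = y}" by auto
      ultimately show ?thesis by (simp add: nn_integral_hausdorff_0_countable)
    qed
    show "\<forall>fY. has_density M ?N (\<phi> \<circ> X) fY \<longrightarrow> (AE y in ?N. ennreal (fY y) = ?F y \<and>
       ennreal (fY y) = (\<Sum>\<^sub>\<infinity>x\<in>{x \<in> E. \<phi> x = y}. ennreal (fX x) * (1 / tangential_jacobian_dim m E \<phi> x)))"
      unfolding sum[symmetric] using dens(3) by simp
  next
    assume m: "CARD('n) \<le> m"
    let ?F = "\<lambda>y. \<integral>\<^sup>+x\<in>E \<inter> \<phi> -` {y}. (ennreal (fX x) * (1 / tangential_jacobian_dim CARD('n) E \<phi> x)) \<partial>hausdorff_measure (real (m - CARD('n)))"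
    have r: "min m DIM(real ^ 'n) = CARD('n)" using m by simp
    have lb: "hausdorff_measure (real CARD('n)) = (lborel :: (real ^ 'n) measure)"
      using hausdorff_measure_DIM_eq_lborel[where 'a = "real ^ 'n"] by simp
    note sd = sd[unfolded r]
    have Y: "\<phi> \<circ> X \<in> measurable M lborel" using sd(2) by simp
    have Fm: "?F \<in> borel_measurable lborel" using sd(1) by simp
    have d: "distr M lborel (\<phi> \<circ> X) = density lborel ?F"
    proof (rule measure_eqI)
      fix B assume "B \<in> sets (distr M lborel (\<phi> \<circ> X))"
      then have B: "B \<in> sets borel" by simp
      show "emeasure (distr M lborel (\<phi> \<circ> X)) B = emeasure (density lborel ?F) B"
        using sd(4)[OF B] Y B Fm by (simp add: emeasure_distr emeasure_density lb)
    qed simp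
    note dens = has_density_of_extended_density[OF M Y Fm d]
    show "absolutely_continuous lborel (distr M lborel (\<phi> \<circ> X))" by (rule dens(1))
    show "\<exists>fY. has_density M lborel (\<phi> \<circ> X) fY" by (rule dens(2))
    show "\<forall>fY. has_density M lborel (\<phi> \<circ> X) fY \<longrightarrow> (AE y in lborel. y \<in> \<phi> ` E \<longrightarrow> ennreal (fY y) = ?F y)"
    proof (intro allI impI)
      fix fY assume "has_density M lborel (\<phi> \<circ> X) fY"
      from dens(3)[OF this] show "AE y in lborel. y \<in> \<phi> ` E \<longrightarrow> ennreal (fY y) = ?F y"
        by (rule eventually_mono) simp
    qed
  qed
qed

end
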